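(* Let $G$ be a finite nonabelian simple group acting effectively by homeomorphisms on a closed flat $n$-manifold $M$ with holonomy group $\Phi$. Then there exist a finite subgroup $\Phi^*<\mathrm{GL}_n(\mathbb{Z})$ and a normal subgroup $\Phi'\trianglelefteq\Phi^*$ isomorphic to $\Phi$ such that $G\cong\Phi^*/\Phi'$.
   Context: A closed flat $n$-manifold is $\mathbb{R}^n/\pi$ with $\pi$ a torsion-free discrete cocompact subgroup of $\mathbb{R}^n\rtimes O(n)$; its holonomy group is the quotient of $\pi$ by its maximal abelian normal subgroup (the translation subgroup, free abelian of rank $n$). *)

theory Defs
  imports "HOL-Analysis.Analysis" "HOL-Algebra.SimpleGroups" "HOL-Algebra.Coset"
begin

text \<open>The isometry group R^n semidirect O(n): a pair (A, v) acts by x maps to A x + v.\<close>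
definition Isom :: "((real^'n^'n) \<times> (real^'n)) monoid" where
  "Isom = \<lparr> carrier = {(A, v). orthogonal_matrix A},
            mult = (\<lambda>(A, v) (B, w). (A ** B, A *v w + v)),
            one = (mat 1, 0) \<rparr>"

definition isom_apply :: "(real^'n^'n) \<times> (real^'n) \<Rightarrow> real^'n \<Rightarrow> real^'n" where
  "isom_apply g x = fst g *v x + snd g"

text \<open>Bieberbach group: torsion-free, discrete, cocompact subgroup of Isom.\<close>
definition bieberbach :: "((real^'n^'n) \<times> (real^'n)) set \<Rightarrow> bool" where
  "bieberbach \<pi> \<longleftrightarrow> subgroup \<pi> Isom
     \<and> (\<forall>g\<in>\<pi>. \<exists>e>0. \<forall>h\<in>\<pi>. dist h g < e \<longrightarrow> h = g)
     \<and> (\<exists>K. compact K \<and> (\<forall>x. \<exists>g\<in>\<pi>. isom_apply g x \<in> K))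
     \<and> (\<forall>g\<in>\<pi>. \<forall>k::nat. k > 0 \<longrightarrow> g [^]\<^bsub>Isom\<^esub> k = \<one>\<^bsub>Isom\<^esub> \<longrightarrow> g = \<one>\<^bsub>Isom\<^esub>)"

text \<open>Translation subgroup and holonomy group (quotient of pi by its translations).\<close>
definition transl_subgroup :: "((real^'n^'n) \<times> (real^'n)) set \<Rightarrow> ((real^'n^'n) \<times> (real^'n)) set" where
  "transl_subgroup \<pi> = {g \<in> \<pi>. fst g = mat 1}"

definition holonomy :: "((real^'n^'n) \<times> (real^'n)) set \<Rightarrow> ((real^'n^'n) \<times> (real^'n)) set monoid" where
  "holonomy \<pi> = (Isom\<lparr>carrier := \<pi>\<rparr>) Mod (transl_subgroup \<pi>)"

text \<open>X (with quotient map q) is the flat manifold R^n / pi.\<close>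
definition is_flat_manifold_quotient ::
  "((real^'n^'n) \<times> (real^'n)) set \<Rightarrow> 'm topology \<Rightarrow> (real^'n \<Rightarrow> 'm) \<Rightarrow> bool" where
  "is_flat_manifold_quotient \<pi> X q \<longleftrightarrow> bieberbach \<pi> \<and> quotient_map euclidean X q
     \<and> (\<forall>x y. q x = q y \<longleftrightarrow> (\<exists>g\<in>\<pi>. isom_apply g x = y))"

text \<open>Effective action of G on X by homeomorphisms.\<close>
definition effective_homeo_action :: "('g, 'b) monoid_scheme \<Rightarrow> 'm topology \<Rightarrow> ('g \<Rightarrow> 'm \<Rightarrow> 'm) \<Rightarrow> bool" where
  "effective_homeo_action G X \<phi> \<longleftrightarrow>
     (\<forall>g\<in>carrier G. homeomorphic_map X X (\<phi> g))
     \<and> (\<forall>g\<in>carrier G. \<forall>h\<in>carrier G. \<forall>x\<in>topspace X. \<phi> (g \<otimes>\<^bsub>G\<^esub> h) x = \<phi> g (\<phi> h x))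
     \<and> (\<forall>x\<in>topspace X. \<phi> \<one>\<^bsub>G\<^esub> x = x)
     \<and> (\<forall>g\<in>carrier G. (\<forall>x\<in>topspace X. \<phi> g x = x) \<longrightarrow> g = \<one>\<^bsub>G\<^esub>)"

text \<open>GL_n(Z): integer matrices with integer inverse.\<close>
definition GLZ :: "(int^'n^'n) monoid" where
  "GLZ = \<lparr> carrier = {A. \<exists>B. A ** B = mat 1 \<and> B ** A = mat 1},
           mult = (**), one = mat 1 \<rparr>"

end

theory Submission
  imports Defs "HOL-Homology.Homology" "HOL-Number_Theory.Cong"
begin

text \<open>The lifts of the action of \<open>G\<close> to \<open>\<real>\<^sup>n\<close> form an extension of \<open>G\<close> by \<open>\<pi>\<close>, which acts by conjugation on the
  lattice \<open>L\<close> of translations of \<open>\<pi>\<close> (\<open>L\<close> is algebraically characterised in \<open>\<pi>\<close>, hence preserved).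
  This gives a homomorphism \<open>\<rho>\<close> to \<open>GL\<^sub>n(\<int>)\<close>, and \<open>\<Phi>\<^sup>*\<close> is the image of all lifts, \<open>\<Phi>'\<close> the image of \<open>\<pi>\<close>.
  The point is that lifts in the kernel \<open>C\<close> of \<open>\<rho>\<close> lie in \<open>\<pi>\<close>. As \<open>G\<close> is simple, otherwise \<open>C\<close> maps onto \<open>G\<close>,
  and \<open>C\<close> is a central extension of \<open>G\<close> by \<open>L\<close>. An element of \<open>C\<close> of finite order is a periodic homeomorphism of
  \<open>\<real>\<^sup>n\<close> with bounded displacement, hence the identity (a variant of Newman's theorem). So \<open>C\<close> is torsion-free, and then
  the transfer to \<open>L\<close> shows that \<open>C\<close>, and with it \<open>G\<close>, is abelian.\<close>

section \<open>Lattices in Euclidean space\<close>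

text \<open>Bieberbach's first theorem enters in two forms. Full rank of \<open>L\<close> makes the
  integer matrices faithful on the holonomy and gives a compact fundamental domain, hence bounded
  displacement. Finiteness of the linear parts gives a common exponent, so that translations are the
  elements commuting with all \<open>k\<close>-th powers in \<pi> for some positive
  \<open>k\<close>. Lifts are only homeomorphisms, so a criterion free of geometry is what they can
  be seen to preserve. The main obstacle is torsion: a lift of finite order is merely continuous,
  and neither isometry nor smoothness can force it to be the identity. A degree argument replaces
  them: an invariant map near the identity has degree one, whereas free orbits in its zero set would
  make the degree divisible by a prime. The extension of \<open>G\<close> is never built as an
  abstract group. Lifts stay functions on Euclidean space and can therefore be added, which turns
  the transfer into a finite sum.\<close>

definition of_int_vec :: "int^'n \<Rightarrow> real^'n" where
  "of_int_vec z = (\<chi> i. of_int (z $ i))"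

lemma of_int_vec_nth [simp]: "of_int_vec z $ i = of_int (z $ i)"
  by (simp add: of_int_vec_def)

lemma of_int_vec_add: "of_int_vec (y + z) = of_int_vec y + of_int_vec z"
  and of_int_vec_inject [simp]: "of_int_vec y = of_int_vec z \<longleftrightarrow> y = z"
  by (simp_all add: vec_eq_iff)

lemma det_of_int: "det ((\<chi> i j. of_int (Z $ i $ j)) :: real^'n^'n) = of_int (det (Z :: int^'n^'n))"
  unfolding det_def by simp

lemma matrix_columns_of_basis:
  fixes L :: "(real^'n) set"
  assumes "span L = UNIV"
  obtains V :: "real^'n^'n" where "det V \<noteq> 0" "\<And>j. column j V \<in> L"
proof -
  obtain B where B: "B \<subseteq> L" "independent B" "L \<subseteq> span B" "card B = dim L"
    by (rule basis_exists[of L]) auto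
  have spB: "span B = UNIV" using B(3) assms by (metis span_mono span_span top.extremum_uniqueI)
  have "dim L = CARD('n)" using assms by (metis dim_span dim_UNIV DIM_cart DIM_real mult.right_neutral)
  then have cB: "card B = CARD('n)" using B(4) by simp
  have fB: "finite B" using B(2) by (rule finiteI_independent)
  obtain f :: "'n \<Rightarrow> real^'n" where f: "bij_betw f UNIV B"
    using finite_same_card_bij[of "UNIV :: 'n set" B] fB cB by auto
  define V :: "real^'n^'n" where "V = (\<chi> i j. f j $ i)"
  have col: "column j V = f j" for j by (simp add: V_def column_def vec_eq_iff)
  have "columns V = B" using f by (auto simp: columns_def col bij_betw_def)
  then have "\<exists>W. V ** W = mat 1" using matrix_right_invertible_span_columns[of V] spB by (simp add: span_vec_eq)
  then have "invertible V" by (simp add: invertible_right_inverse)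
  then have "det V \<noteq> 0" by (simp add: invertible_det_nz)
  moreover have "column j V \<in> L" for j using f B(1) by (auto simp: col bij_betw_def)
  ultimately show ?thesis by (rule that)
qed

locale euclidean_lattice =
  fixes L :: "(real^'n) set"
  assumes zero: "0 \<in> L" and diff: "\<And>x y. x \<in> L \<Longrightarrow> y \<in> L \<Longrightarrow> x - y \<in> L"
    and discrete: "\<And>R. finite {x \<in> L. norm x \<le> R}" and spanning: "span L = UNIV"
begin

lemma minus: "x \<in> L \<Longrightarrow> - x \<in> L"
  using diff[OF zero] by fastforce

lemma add: "x \<in> L \<Longrightarrow> y \<in> L \<Longrightarrow> x + y \<in> L"
  using diff[of x "- y"] minus by simp

lemma nat_scale: "x \<in> L \<Longrightarrow> real k *\<^sub>R x \<in> L"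
  by (induction k) (auto simp: zero algebra_simps intro: add)

lemma int_scale: "x \<in> L \<Longrightarrow> of_int k *\<^sub>R x \<in> L"
  using nat_scale[of x] minus by (cases k rule: int_cases2) auto

lemma lattice_sum: "finite A \<Longrightarrow> (\<And>i. i \<in> A \<Longrightarrow> f i \<in> L) \<Longrightarrow> sum f A \<in> L"
  by (induction A rule: finite_induct) (auto simp: zero add)

lemma int_combination:
  assumes "\<And>j. column j W \<in> L"
  shows "W *v of_int_vec z \<in> L"
proof -
  have "W *v of_int_vec z = (\<Sum>j\<in>UNIV. of_int (z $ j) *\<^sub>R column j W)"
    by (simp add: matrix_mult_sum scalar_mult_eq_scaleR)
  then show ?thesis using assms by (simp add: lattice_sum int_scale)
qed

text \<open>The multiples of \<open>t\<close> have fractional parts with respect to \<open>V\<close>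
  in one finite set, so two agree by pigeonhole and their difference is a multiple of
  \<open>t\<close> in the sublattice. The factorial of the size of that set is divisible by every
  factor that can occur.\<close>

lemma finite_index:
  assumes det: "det V \<noteq> 0" and V: "\<And>j. column j V \<in> L"
  obtains M :: nat where "M > 0" "\<And>t. t \<in> L \<Longrightarrow> \<exists>z. real M *\<^sub>R t = V *v of_int_vec z"
proof -
  define fl :: "real^'n \<Rightarrow> int^'n" where "fl c = (\<chi> i. \<lfloor>c $ i\<rfloor>)" for c
  obtain Vi where Vi: "V ** Vi = mat 1" "Vi ** V = mat 1"
    using det invertible_det_nz[of V] unfolding invertible_def by auto
  have VVi: "V *v (Vi *v x) = x" for x by (simp add: matrix_vector_mul_assoc Vi)
  define fr where "fr x = x - V *v of_int_vec (fl (Vi *v x))" for x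
  define R where "R = (\<Sum>j\<in>UNIV. norm (column j V))"
  have frR: "norm (fr x) \<le> R" for x
  proof -
    define c where "c = Vi *v x"
    have "fr x = V *v c - V *v of_int_vec (fl c)" by (simp add: fr_def c_def VVi)
    also have "\<dots> = V *v (c - of_int_vec (fl c))" by (simp add: matrix_vector_mult_diff_distrib)
    also have "\<dots> = (\<Sum>j\<in>UNIV. (c $ j - of_int \<lfloor>c $ j\<rfloor>) *\<^sub>R column j V)"
      by (simp add: matrix_mult_sum scalar_mult_eq_scaleR fl_def)
    finally have "norm (fr x) \<le> (\<Sum>j\<in>UNIV. norm ((c $ j - of_int \<lfloor>c $ j\<rfloor>) *\<^sub>R column j V))"
      by (simp only: norm_sum)
    also have "\<dots> \<le> R"
      unfolding R_def
    proof (rule sum_mono)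
      fix j
      have "\<bar>c $ j - of_int \<lfloor>c $ j\<rfloor>\<bar> \<le> 1" by linarith
      then show "norm ((c $ j - of_int \<lfloor>c $ j\<rfloor>) *\<^sub>R column j V) \<le> norm (column j V)"
        by (simp add: mult_left_le_one_le)
    qed
    finally show ?thesis .
  qed
  define F where "F = {x \<in> L. norm x \<le> R}"
  have frF: "fr t \<in> F" if "t \<in> L" for t
    using frR diff[OF that int_combination[OF V]] by (simp add: F_def fr_def)
  have fF: "finite F" using discrete by (simp add: F_def)
  show ?thesis
  proof
    show "fact (card F) > (0::nat)" by simp
    fix t assume t: "t \<in> L"
    have "\<not> inj_on (\<lambda>k::nat. fr (real k *\<^sub>R t)) {..card F}"
    proof
      assume "inj_on (\<lambda>k::nat. fr (real k *\<^sub>R t)) {..card F}"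
      then have "card {..card F} \<le> card F"
        by (rule card_inj_on_le) (use fF frF nat_scale[OF t] in auto)
      then show False by simp
    qed
    then obtain k l :: nat where kl: "k < l" "l \<le> card F" "fr (real k *\<^sub>R t) = fr (real l *\<^sub>R t)"
      unfolding inj_on_def by (metis atMost_iff linorder_neqE_nat)
    define z where "z = fl (Vi *v (real l *\<^sub>R t)) - fl (Vi *v (real k *\<^sub>R t))"
    have "real l *\<^sub>R t - real k *\<^sub>R t = V *v of_int_vec (fl (Vi *v (real l *\<^sub>R t))) - V *v of_int_vec (fl (Vi *v (real k *\<^sub>R t)))"
      using kl(3) unfolding fr_def by (simp add: algebra_simps)
    also have "\<dots> = V *v of_int_vec z"
      unfolding z_def matrix_vector_mult_diff_distrib[symmetric]
      by (rule arg_cong[of _ _ "(*v) V"]) (simp add: vec_eq_iff)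
    finally have e: "real (l - k) *\<^sub>R t = V *v of_int_vec z"
      using kl(1) by (simp add: of_nat_diff scaleR_diff_left)
    have "l - k dvd fact (card F)" using kl by (intro dvd_fact) auto
    then obtain m where m: "fact (card F) = (l - k) * m" by (auto elim: dvdE)
    have "real (fact (card F)) *\<^sub>R t = real m *\<^sub>R (real (l - k) *\<^sub>R t)"
      unfolding m by (simp add: mult.commute)
    also have "\<dots> = V *v of_int_vec (\<chi> i. int m * z $ i)"
      unfolding e matrix_vector_mult_scaleR[symmetric]
      by (rule arg_cong[of _ _ "(*v) V"]) (simp add: vec_eq_iff)
    finally show "\<exists>z. real (fact (card F)) *\<^sub>R t = V *v of_int_vec z" by blast
  qed
qed

text \<open>A basis of minimal covolume generates: otherwise replacing a basis vector by a
  vector with a fractional coordinate in \<open>(0, 1)\<close> shrinks the determinant.\<close>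
lemma integral_basis:
  obtains W :: "real^'n^'n" where "det W \<noteq> 0" "L = {W *v of_int_vec z | z. True}"
proof -
  obtain V :: "real^'n^'n" where V: "det V \<noteq> 0" "\<And>j. column j V \<in> L"
    using matrix_columns_of_basis[OF spanning] by blast
  obtain M where M: "M > 0" "\<And>t. t \<in> L \<Longrightarrow> \<exists>z. real M *\<^sub>R t = V *v of_int_vec z"
    using finite_index[OF V] by blast
  \<comment> \<open>By \<open>finite_index\<close>, \<open>M\<close> times a lattice vector has
    integer coordinates in \<open>V\<close>, so all nonzero covolumes are positive integer multiples
    of one constant; hence a minimal one exists.\<close>
  define P where "P k \<longleftrightarrow> k > 0 \<and> (\<exists>W :: real^'n^'n. (\<forall>j. column j W \<in> L)
      \<and> real M ^ CARD('n) * \<bar>det W\<bar> = real k * \<bar>det V\<bar>)" for k :: nat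
  have PW: "\<exists>k. P k \<and> real M ^ CARD('n) * \<bar>det W\<bar> = real k * \<bar>det V\<bar>"
    if W: "\<And>j. column j W \<in> L" "det W \<noteq> 0" for W :: "real^'n^'n"
  proof -
    have "\<forall>j. \<exists>z. real M *\<^sub>R column j W = V *v of_int_vec z" using M(2) W(1) by blast
    then obtain z where z: "\<And>j. real M *\<^sub>R column j W = V *v of_int_vec (z j)" by metis
    define Z :: "int^'n^'n" where "Z = (\<chi> i j. z j $ i)"
    define Zr :: "real^'n^'n" where "Zr = (\<chi> i j. of_int (Z $ i $ j))"
    have "(\<chi> i. real M *s W $ i) = V ** Zr"
    proof -
      have "(\<chi> i. real M *s W $ i) $ i $ j = (V ** Zr) $ i $ j" for i j
      proof -
        have "(real M *\<^sub>R column j W) $ i = (V *v of_int_vec (z j)) $ i" by (simp only: z)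
        then show ?thesis
          by (simp add: column_def matrix_vector_mult_def matrix_matrix_mult_def Zr_def Z_def)
      qed
      then show ?thesis by (simp add: vec_eq_iff)
    qed
    then have "det (\<chi> i. real M *s W $ i) = det V * of_int (det Z)"
      by (simp only: det_mul Zr_def det_of_int)
    moreover have "det (\<chi> i. real M *s W $ i) = real M ^ CARD('n) * det W"
      by (subst det_rows_mul) simp
    ultimately have eq: "real M ^ CARD('n) * det W = det V * of_int (det Z)" by simp
    then have "det Z \<noteq> 0" using W(2) M(1) by auto
    have eq2: "real M ^ CARD('n) * \<bar>det W\<bar> = real (nat \<bar>det Z\<bar>) * \<bar>det V\<bar>"
      using arg_cong[OF eq, of abs] by (simp add: abs_mult mult.commute)
    have "P (nat \<bar>det Z\<bar>)"
      unfolding P_def using eq2 W(1) \<open>det Z \<noteq> 0\<close> by auto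
    then show ?thesis using eq2 by blast
  qed
  obtain k where k: "P k" "\<And>l. l < k \<Longrightarrow> \<not> P l"
    using PW[OF V(2) V(1)] exists_least_iff[of P] by blast
  then obtain W :: "real^'n^'n" where W: "\<And>j. column j W \<in> L" and k0: "k > 0"
    and kW: "real M ^ CARD('n) * \<bar>det W\<bar> = real k * \<bar>det V\<bar>"
    unfolding P_def by blast
  have dW: "det W \<noteq> 0"
  proof
    assume "det W = 0"
    then show False using kW k0 V(1) by simp
  qed
  obtain Wi where Wi: "W ** Wi = mat 1" "Wi ** W = mat 1"
    using dW invertible_det_nz[of W] unfolding invertible_def by auto
  have "\<exists>z. t = W *v of_int_vec z" if t: "t \<in> L" for t
  proof -
    define c where "c = Wi *v t"
    define z :: "int^'n" where "z = (\<chi> i. \<lfloor>c $ i\<rfloor>)"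
    define s where "s = t - W *v of_int_vec z"
    have sL: "s \<in> L" unfolding s_def using diff[OF t int_combination[OF W]] .
    define f where "f = c - of_int_vec z"
    have Wc: "W *v c = t" by (simp add: c_def matrix_vector_mul_assoc Wi)
    have sf: "s = W *v f" by (simp add: s_def f_def matrix_vector_mult_diff_distrib Wc)
    have "f $ i = 0" for i
    proof (rule ccontr)
      assume fi: "f $ i \<noteq> 0"
      have fi1: "0 \<le> f $ i" "f $ i < 1" by (simp_all add: f_def z_def) linarith
      \<comment> \<open>Column \<open>i\<close> is exchanged for \<open>s\<close>; by Cramer's rule
        this multiplies the determinant by \<open>f $ i\<close>, which lies strictly between 0 and
        1.\<close>
      define W' :: "real^'n^'n" where "W' = (\<chi> a j. if j = i then (W *v f) $ a else W $ a $ j)"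
      have dW': "det W' = f $ i * det W" unfolding W'_def by (rule cramer_lemma)
      have colW': "column j W' \<in> L" for j
      proof (cases "j = i")
        case True
        then have "column j W' = s" by (simp add: W'_def column_def vec_eq_iff sf)
        then show ?thesis using sL by simp
      next
        case False
        then have "column j W' = column j W" by (simp add: W'_def column_def vec_eq_iff)
        then show ?thesis using W by simp
      qed
      obtain l where l: "P l" "real M ^ CARD('n) * \<bar>det W'\<bar> = real l * \<bar>det V\<bar>"
        using PW[OF colW'] dW' fi dW by auto
      have "real l * \<bar>det V\<bar> = f $ i * (real M ^ CARD('n) * \<bar>det W\<bar>)"
        unfolding l(2)[symmetric] dW' using fi1 by (simp add: abs_mult)
      also have "\<dots> = f $ i * real k * \<bar>det V\<bar>" by (simp add: kW)
      finally have "real l = f $ i * real k" using V(1) by simp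
      also have "\<dots> < 1 * real k" using fi1(2) k0 by (intro mult_strict_right_mono) auto
      finally have "l < k" by simp
      then show False using k(2) l(1) by blast
    qed
    then have "f = 0" by (simp add: vec_eq_iff)
    then show ?thesis using Wc by (auto simp: f_def)
  qed
  then have "L = {W *v of_int_vec z | z. True}" using int_combination[OF W] by auto
  then show ?thesis using that dW by blast
qed

end

section \<open>Orthogonal transformations\<close>

lemma Isom_simps [simp]:
  "carrier Isom = {(A, v). orthogonal_matrix A}"
  "\<one>\<^bsub>Isom\<^esub> = (mat 1, 0)"
  "(A, v) \<otimes>\<^bsub>Isom\<^esub> (B, w) = (A ** B, A *v w + v)"
  by (auto simp: Isom_def)

lemma orthogonal_matrix_cancel:
  "orthogonal_matrix (A :: real^'n^'n) \<Longrightarrow> transpose A ** A = mat 1"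
  "orthogonal_matrix (A :: real^'n^'n) \<Longrightarrow> A ** transpose A = mat 1"
  by (auto simp: orthogonal_matrix_def)

lemma orthogonal_matrix_vector_cancel:
  "orthogonal_matrix (A :: real^'n^'n) \<Longrightarrow> transpose A *v (A *v x) = x"
  "orthogonal_matrix (A :: real^'n^'n) \<Longrightarrow> A *v (transpose A *v x) = x"
  by (simp_all add: matrix_vector_mul_assoc orthogonal_matrix_cancel del: transpose_matrix_vector)

lemma group_Isom: "group (Isom :: ((real^'n^'n) \<times> (real^'n)) monoid)"
proof (rule groupI)
  fix x y z :: "(real^'n^'n) \<times> (real^'n)"
  assume x: "x \<in> carrier Isom" and y: "y \<in> carrier Isom" and z: "z \<in> carrier Isom"
  show "x \<otimes>\<^bsub>Isom\<^esub> y \<in> carrier Isom"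
    using x y by (auto simp: orthogonal_matrix_mul)
  show "x \<otimes>\<^bsub>Isom\<^esub> y \<otimes>\<^bsub>Isom\<^esub> z = x \<otimes>\<^bsub>Isom\<^esub> (y \<otimes>\<^bsub>Isom\<^esub> z)"
    by (cases x; cases y; cases z)
      (simp add: matrix_mul_assoc matrix_vector_mul_assoc matrix_vector_right_distrib add.assoc)
  show "\<one>\<^bsub>Isom\<^esub> \<otimes>\<^bsub>Isom\<^esub> x = x" by (cases x) simp
  obtain A v where xA: "x = (A, v)" by force
  have "(transpose A, - (transpose A *v v)) \<otimes>\<^bsub>Isom\<^esub> x = \<one>\<^bsub>Isom\<^esub>"
    using x xA by (simp add: orthogonal_matrix_cancel del: transpose_matrix_vector)
  moreover have "(transpose A, - (transpose A *v v)) \<in> carrier Isom"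
    using x xA by simp
  ultimately show "\<exists>y\<in>carrier Isom. y \<otimes>\<^bsub>Isom\<^esub> x = \<one>\<^bsub>Isom\<^esub>" by blast
next
  show "\<one>\<^bsub>Isom\<^esub> \<in> carrier (Isom :: ((real^'n^'n) \<times> (real^'n)) monoid)"
    by (simp add: orthogonal_matrix_id)
qed

lemma inv_Isom:
  assumes "orthogonal_matrix A"
  shows "inv\<^bsub>Isom\<^esub> (A, v) = (transpose A, - (transpose A *v v))"
proof (rule group.inv_equality[OF group_Isom])
  show "(transpose A, - (transpose A *v v)) \<otimes>\<^bsub>Isom\<^esub> (A, v) = \<one>\<^bsub>Isom\<^esub>"
    using assms by (simp add: orthogonal_matrix_cancel del: transpose_matrix_vector)
qed (use assms in auto)

lemma norm_orthogonal [simp]: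
  fixes A :: "real^'n^'n"
  assumes "orthogonal_matrix A" shows "norm (A *v x) = norm x"
  using assms orthogonal_transformation_matrix[of "(*v) A"] orthogonal_transformation_norm[of "(*v) A" x] by simp

lemma norm_matrix_vector_le:
  fixes M :: "real^'n^'m"
  shows "norm (M *v x) \<le> real CARD('m) * norm M * norm x"
proof -
  have "norm (M *v x) \<le> (\<Sum>i\<in>UNIV. \<bar>(M *v x) $ i\<bar>)" by (rule norm_le_l1_cart)
  also have "\<dots> \<le> (\<Sum>i\<in>(UNIV::'m set). norm M * norm x)"
  proof (rule sum_mono)
    fix i
    have "\<bar>(M *v x) $ i\<bar> \<le> norm (M $ i) * norm x"
      unfolding matrix_vector_mul_component by (rule Cauchy_Schwarz_ineq2)
    also have "\<dots> \<le> norm M * norm x" by (intro mult_right_mono Finite_Cartesian_Product.norm_nth_le) simp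
    finally show "\<bar>(M *v x) $ i\<bar> \<le> norm M * norm x" .
  qed
  finally show ?thesis by simp
qed

text \<open>The norm of a matrix is the Euclidean norm of its entries, not the operator norm; the
  dimension factors are a crude conversion between the two.\<close>

lemma norm_matrix_le:
  fixes M :: "real^'n^'m" and c :: real
  assumes "\<And>x. norm (M *v x) \<le> c * norm x"
  shows "norm M \<le> real CARD('m) * real CARD('n) * c"
proof -
  have "norm M \<le> (\<Sum>i\<in>UNIV. norm (M $ i))"
    unfolding norm_vec_def by (rule L2_set_le_sum) simp
  also have "\<dots> \<le> (\<Sum>i\<in>(UNIV::'m set). real CARD('n) * c)"
  proof (rule sum_mono)
    fix i
    have "norm (M $ i) \<le> (\<Sum>j\<in>UNIV. \<bar>M $ i $ j\<bar>)" by (rule norm_le_l1_cart)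
    also have "\<dots> \<le> (\<Sum>j\<in>(UNIV::'n set). c)"
    proof (rule sum_mono)
      fix j
      have "M $ i $ j = (M *v axis j 1) $ i" by (simp add: matrix_vector_mult_basis column_def)
      then have "\<bar>M $ i $ j\<bar> \<le> norm (M *v axis j 1)" using component_le_norm_cart[of "M *v axis j 1" i] by simp
      also have "\<dots> \<le> c" using assms[of "axis j 1"] by simp
      finally show "\<bar>M $ i $ j\<bar> \<le> c" .
    qed
    finally show "norm (M $ i) \<le> CARD('n) * c" by simp
  qed
  finally show ?thesis by (simp add: mult.assoc)
qed

lemma infinite_bounded_close_points:
  fixes S :: "'a::heine_borel set"
  assumes "infinite S" "bounded S" "e > 0"
  obtains x y where "x \<in> S" "y \<in> S" "x \<noteq> y" "dist x y < e"
proof -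
  obtain l where l: "l islimpt S"
    using bounded_infinite_imp_islimpt[OF subset_refl assms(2,1)] by blast
  then have "infinite (S \<inter> ball l (e/2))" using assms(3) by (simp add: islimpt_eq_infinite_ball)
  then obtain x where x: "x \<in> S \<inter> ball l (e/2)" by (metis finite.emptyI ex_in_conv)
  have "infinite (S \<inter> ball l (e/2) - {x})" using \<open>infinite (S \<inter> ball l (e/2))\<close> by simp
  then obtain y where y: "y \<in> S \<inter> ball l (e/2) - {x}" by (metis finite.emptyI ex_in_conv)
  have "dist x y < e"
    using x y by (intro dist_triangle_half_r[of l x e y]) auto
  then show ?thesis using that x y by blast
qed

text \<open>The operator norm is taken, not the entrywise one, because the commutator estimate then
  has constant 2: commutators with a rotation of size at most 1/2 do not grow.\<close>

definition rotation_size :: "real^'n^'n \<Rightarrow> real" where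
  "rotation_size A = onorm (\<lambda>x. A *v x - x)"

lemma bounded_linear_rotation: "bounded_linear (\<lambda>x. A *v x - x)" for A :: "real^'n^'n"
  by (intro bounded_linear_sub matrix_vector_mul_bounded_linear bounded_linear_ident)

lemma rotation_size: "norm (A *v x - x) \<le> rotation_size A * norm x"
  unfolding rotation_size_def by (rule onorm[OF bounded_linear_rotation])

lemma rotation_size_le: "(\<And>x. norm (A *v x - x) \<le> c * norm x) \<Longrightarrow> rotation_size A \<le> c"
  unfolding rotation_size_def by (rule onorm_le)

lemma rotation_size_nonneg: "0 \<le> rotation_size A"
  unfolding rotation_size_def by (rule onorm_pos_le[OF bounded_linear_rotation])

lemma rotation_size_eq_0: "rotation_size A = 0 \<longleftrightarrow> A = mat 1"
proof
  assume "rotation_size A = 0"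
  then have "A *v x = mat 1 *v x" for x using rotation_size[of A x] by simp
  then show "A = mat 1" by (metis matrix_eq)
next
  assume "A = mat 1"
  then have "rotation_size A \<le> 0" by (intro rotation_size_le) simp
  then show "rotation_size A = 0" using rotation_size_nonneg[of A] by simp
qed

lemma norm_rotation_normalized:
  fixes A :: "real^'n^'n"
  shows "norm (A *v ((1 / norm x) *\<^sub>R x) - (1 / norm x) *\<^sub>R x) = norm (A *v x - x) / norm x"
proof -
  have "A *v ((1 / norm x) *\<^sub>R x) - (1 / norm x) *\<^sub>R x = (1 / norm x) *\<^sub>R (A *v x - x)"
    by (simp add: matrix_vector_mult_scaleR scaleR_diff_right)
  then show ?thesis by (simp only: norm_scaleR) simp
qed

text \<open>With \<open>[A, B]\<close> the commutator,
  \<open>[A, B] - 1 = ((A - 1)(B - 1) - (B - 1)(A - 1)) A^-1 B^-1\<close>, and the last two factors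
  preserve norms.\<close>

lemma rotation_size_commutator:
  fixes A B :: "real^'n^'n"
  assumes A: "orthogonal_matrix A" and B: "orthogonal_matrix B"
  shows "rotation_size (A ** B ** transpose A ** transpose B) \<le> 2 * rotation_size A * rotation_size B"
proof (rule rotation_size_le)
  fix x :: "real^'n"
  define y where "y = transpose A *v (transpose B *v x)"
  have xy: "x = B *v (A *v y)"
    using A B by (simp add: y_def matrix_vector_mul_assoc matrix_mul_assoc orthogonal_matrix_cancel del: transpose_matrix_vector)
  have ny: "norm y = norm x" using A B by (simp add: y_def del: transpose_matrix_vector)
  have "(A ** B ** transpose A ** transpose B) *v x = A *v (B *v y)"
    by (simp add: y_def matrix_vector_mul_assoc matrix_mul_assoc del: transpose_matrix_vector)
  then have "(A ** B ** transpose A ** transpose B) *v x - x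
      = (A *v (B *v y - y) - (B *v y - y)) - (B *v (A *v y - y) - (A *v y - y))"
    by (simp add: xy matrix_vector_mult_diff_distrib)
  also have "norm \<dots> \<le> norm (A *v (B *v y - y) - (B *v y - y)) + norm (B *v (A *v y - y) - (A *v y - y))"
    by (rule norm_triangle_ineq4)
  also have "\<dots> \<le> rotation_size A * (rotation_size B * norm y) + rotation_size B * (rotation_size A * norm y)"
    by (intro add_mono order_trans[OF rotation_size] mult_left_mono rotation_size rotation_size_nonneg)
  finally show "norm ((A ** B ** transpose A ** transpose B) *v x - x) \<le> 2 * rotation_size A * rotation_size B * norm x"
    by (simp add: ny algebra_simps)
qed

text \<open>\<open>E\<close> is the eigenspace of \<open>(A - 1)\<^sup>T (A - 1) = 2 - A - A\<^sup>T\<close> for its largest eigenvalue.\<close>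
lemma maximal_rotation_space:
  fixes A :: "real^'n^'n"
  assumes A: "orthogonal_matrix A" and nz: "A \<noteq> mat 1"
  obtains P :: "real^'n \<Rightarrow> real^'n" and m' u where
    "linear P" "\<And>x. P (A *v x) = A *v P x"
    "\<And>x. (norm x)\<^sup>2 = (norm (P x))\<^sup>2 + (norm (x - P x))\<^sup>2"
    "\<And>x. norm (A *v P x - P x) = rotation_size A * norm (P x)"
    "0 \<le> m'" "m' < rotation_size A"
    "\<And>x. norm (A *v (x - P x) - (x - P x)) \<le> m' * norm (x - P x)"
    "norm u = 1" "P u = u"
proof -
  define m where "m = rotation_size A"
  have m0: "m > 0" using nz rotation_size_eq_0 rotation_size_nonneg by (metis m_def less_eq_real_def)
  define AT where "AT = transpose A"
  have AT: "orthogonal_matrix AT" using A by (simp add: AT_def)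
  have AAT: "A *v (AT *v x) = x" "AT *v (A *v x) = x" for x
    using A by (simp_all add: AT_def matrix_vector_mul_assoc orthogonal_matrix_cancel del: transpose_matrix_vector)
  have adj: "(A *v x) \<bullet> y = x \<bullet> (AT *v y)" for x y
    by (simp add: AT_def dot_lmul_matrix[symmetric] inner_commute[of _ y] flip: transpose_matrix_vector)
  \<comment> \<open>\<open>S\<close> is \<open>m^2\<close> minus the operator whose largest
    eigenvalue is sought. It is positive semidefinite because \<open>m\<close> is the norm of
    \<open>A - 1\<close>, and its kernel is \<open>E\<close>.\<close>
  define S where "S x = (m\<^sup>2 - 2) *\<^sub>R x + A *v x + AT *v x" for x
  have linS: "linear S" unfolding S_def
    by (rule linearI) (simp_all add: algebra_simps matrix_vector_right_distrib matrix_vector_mult_scaleR)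
  have dist2: "(norm (A *v x - x))\<^sup>2 = 2 * (norm x)\<^sup>2 - 2 * (x \<bullet> (A *v x))" for x
  proof -
    have "(norm (A *v x - x))\<^sup>2 = (norm (A *v x))\<^sup>2 - 2 * (x \<bullet> (A *v x)) + (norm x)\<^sup>2"
      by (simp add: power2_norm_eq_inner inner_diff inner_commute)
    then show ?thesis using A by simp
  qed
  have xSx: "x \<bullet> S x = (m * norm x)\<^sup>2 - (norm (A *v x - x))\<^sup>2" for x
  proof -
    have "x \<bullet> (AT *v x) = x \<bullet> (A *v x)" using adj[of x x] by (simp add: inner_commute)
    then show ?thesis
      unfolding dist2 S_def by (simp add: inner_add_right power_mult_distrib power2_norm_eq_inner algebra_simps)
  qed
  have psd: "0 \<le> x \<bullet> S x" for x
    unfolding xSx using rotation_size[of A x] by (simp add: m_def power_mono)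
  have symS: "x \<bullet> S y = S x \<bullet> y" for x y
    unfolding S_def using adj[of x y] adj[of y x]
    by (simp add: inner_add_right inner_add_left inner_commute)
  \<comment> \<open>A semidefinite form that vanishes at \<open>x\<close> is minimal there, so its
    gradient \<open>2 S x\<close> must vanish; a step of length factor \<open>k\<close> against
    \<open>S x\<close> would make the form negative.\<close>
  have S0: "S x = 0" if "x \<bullet> S x = 0" for x
  proof (rule ccontr)
    assume nz: "S x \<noteq> 0"
    define s where "s = S x \<bullet> S x"
    define c where "c = S x \<bullet> S (S x)"
    have s0: "s > 0" using nz by (simp add: s_def)
    have c0: "c \<ge> 0" unfolding c_def by (rule psd)
    have q: "0 \<le> - 2 * t * s + t\<^sup>2 * c" for t
    proof -
      have "(x - t *\<^sub>R S x) \<bullet> S (x - t *\<^sub>R S x) = - 2 * t * s + t\<^sup>2 * c"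
        using that symS[of x "S x"]
        by (simp add: linear_diff[OF linS] linear_scale[OF linS] inner_diff s_def c_def power2_eq_square inner_commute algebra_simps)
      then show ?thesis using psd[of "x - t *\<^sub>R S x"] by simp
    qed
    define k where "k = s / (c + 1)"
    have k: "k > 0" "s = k * (c + 1)" using s0 c0 by (simp_all add: k_def)
    have "- 2 * k * s + k\<^sup>2 * c = k\<^sup>2 * (- c - 2)"
      unfolding k(2) by (simp add: algebra_simps power2_eq_square)
    moreover have "k\<^sup>2 * (- c - 2) < 0"
      using k(1) c0 by (intro mult_pos_neg) auto
    ultimately show False using q[of k] by simp
  qed
  define E where "E = {x. S x = 0}"
  have subE: "subspace E" unfolding E_def by (rule linear_subspace_kernel[OF linS])
  have E_iff: "x \<in> E \<longleftrightarrow> norm (A *v x - x) = m * norm x" for x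
  proof -
    have "x \<in> E \<longleftrightarrow> x \<bullet> S x = 0" using S0 by (auto simp: E_def)
    also have "\<dots> \<longleftrightarrow> norm (A *v x - x) = m * norm x"
      unfolding xSx using m0 by (metis eq_iff_diff_eq_0 mult_nonneg_nonneg norm_ge_zero power2_eq_iff_nonneg less_imp_le)
    finally show ?thesis .
  qed
  have SA: "S (A *v x) = A *v S x" "S (AT *v x) = AT *v S x" for x
    by (simp_all add: S_def matrix_vector_right_distrib matrix_vector_mult_scaleR AAT)
  have EA: "A *v x \<in> E" "AT *v x \<in> E" if "x \<in> E" for x using that by (simp_all add: E_def SA)
  have "\<exists>y. y \<in> E \<and> (\<forall>e\<in>E. orthogonal (x - y) e)" for x
  proof -
    obtain y z where "y \<in> span E" "\<And>w. w \<in> span E \<Longrightarrow> orthogonal z w" "x = y + z"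
      by (rule orthogonal_subspace_decomp_exists[of E x]) blast
    then show ?thesis using subE by (intro exI[of _ y]) (simp add: span_eq_iff[THEN iffD2])
  qed
  then obtain P where P: "\<And>x. P x \<in> E" "\<And>x e. e \<in> E \<Longrightarrow> orthogonal (x - P x) e" by metis
  have Puniq: "P (y + z) = y" if "y \<in> E" "\<And>e. e \<in> E \<Longrightarrow> orthogonal z e" for y z
  proof -
    define d where "d = P (y + z) - y"
    have d: "d \<in> E" unfolding d_def using subE P(1) that(1) by (rule subspace_diff)
    have "(y + z - P (y + z)) \<bullet> d = 0" "z \<bullet> d = 0"
      using P(2)[OF d] that(2)[OF d] by (auto simp: orthogonal_def)
    moreover have "d \<bullet> d = (P (y + z) - y) \<bullet> d" unfolding d_def[symmetric] ..
    ultimately have "d \<bullet> d = 0" by (simp add: inner_diff_left inner_add_left)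
    then show ?thesis by (simp add: d_def)
  qed
  have Padd: "P (x + y) = P x + P y" for x y
  proof -
    have "P ((P x + P y) + ((x - P x) + (y - P y))) = P x + P y"
      by (rule Puniq) (use P subE in \<open>auto simp: subspace_add orthogonal_def inner_add_left\<close>)
    then show ?thesis by simp
  qed
  have Pscale: "P (c *\<^sub>R x) = c *\<^sub>R P x" for c x
  proof -
    have "P (c *\<^sub>R P x + c *\<^sub>R (x - P x)) = c *\<^sub>R P x"
      by (rule Puniq) (use P subE in \<open>auto simp: subspace_scale orthogonal_def\<close>)
    then show ?thesis by (simp add: scaleR_diff_right)
  qed
  have orthA: "orthogonal (A *v z) e" if "\<And>e. e \<in> E \<Longrightarrow> orthogonal z e" "e \<in> E" for z e
    using that EA(2)[OF that(2)] by (simp add: orthogonal_def adj)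
  have PA: "P (A *v x) = A *v P x" for x
  proof -
    have "P (A *v P x + A *v (x - P x)) = A *v P x"
      by (rule Puniq) (use P EA orthA in auto)
    then show ?thesis by (simp add: matrix_vector_right_distrib[symmetric])
  qed
  have pyth: "(norm x)\<^sup>2 = (norm (P x))\<^sup>2 + (norm (x - P x))\<^sup>2" for x
    using norm_add_Pythagorean[of "P x" "x - P x"] P(2)[OF P(1), of x x] by (simp add: orthogonal_commute)
  have PE: "norm (A *v P x - P x) = m * norm (P x)" for x using P(1)[of x] by (simp add: E_iff)
  define F where "F = {z. \<forall>e\<in>E. orthogonal z e}"
  obtain u where u: "norm u = 1" "u \<in> E"
  proof -
    have ne: "sphere (0::real^'n) 1 \<noteq> {}" by (simp add: sphere_eq_empty)
    have "continuous_on (sphere (0::real^'n) 1) (\<lambda>x. norm (A *v x - x))"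
      by (intro continuous_on_norm linear_continuous_on bounded_linear_rotation)
    then obtain u where u: "u \<in> sphere 0 1" "\<And>y. y \<in> sphere 0 1 \<Longrightarrow> norm (A *v y - y) \<le> norm (A *v u - u)"
      using continuous_attains_sup[OF compact_sphere ne] by blast
    have "m \<le> norm (A *v u - u)"
      unfolding m_def
    proof (rule rotation_size_le)
      fix x :: "real^'n"
      show "norm (A *v x - x) \<le> norm (A *v u - u) * norm x"
      proof (cases "x = 0")
        case False
        have "norm (A *v ((1 / norm x) *\<^sub>R x) - (1 / norm x) *\<^sub>R x) \<le> norm (A *v u - u)"
          by (rule u(2)) (use False in simp)
        then have "norm (A *v x - x) / norm x \<le> norm (A *v u - u)"
          unfolding norm_rotation_normalized .
        then show ?thesis using False by (simp add: divide_le_eq)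
      qed simp
    qed
    then have "u \<in> E" using rotation_size[of A u] u(1) by (simp add: E_iff m_def)
    then show ?thesis using that u by simp
  qed
  have Pu: "P u = u" using Puniq[of u 0] u by (simp add: orthogonal_def)
  \<comment> \<open>On the orthogonal complement \<open>F\<close> of \<open>E\<close> the maximal
    rotation is attained on the compact unit sphere and is less than \<open>m\<close>, since a
    vector attaining \<open>m\<close> lies in \<open>E\<close>. For trivial \<open>F\<close> the
    value 0 serves.\<close>
  obtain m' where m': "0 \<le> m'" "m' < m" "\<And>z. z \<in> F \<Longrightarrow> norm (A *v z - z) \<le> m' * norm z"
  proof (cases "F \<subseteq> {0}")
    case True
    then have "norm (A *v z - z) \<le> 0 * norm z" if "z \<in> F" for z using that by auto
    then show ?thesis using that[of 0] m0 by blast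
  next
    case False
    have subF: "subspace F" unfolding F_def subspace_def by (auto simp: orthogonal_def inner_add_left)
    have nrm: "(1 / norm z) *\<^sub>R z \<in> sphere 0 1 \<inter> F" if "z \<in> F" "z \<noteq> 0" for z
      using that subspace_scale[OF subF] by simp
    have ne: "sphere 0 1 \<inter> F \<noteq> {}" using False nrm by blast
    have "compact (sphere 0 1 \<inter> F)" using closed_subspace[OF subF] by (simp add: compact_Int_closed)
    moreover have "continuous_on (sphere 0 1 \<inter> F) (\<lambda>x. norm (A *v x - x))"
      by (intro continuous_on_norm linear_continuous_on bounded_linear_rotation)
    ultimately obtain v where v: "v \<in> sphere 0 1 \<inter> F" "\<And>y. y \<in> sphere 0 1 \<inter> F \<Longrightarrow> norm (A *v y - y) \<le> norm (A *v v - v)"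
      using continuous_attains_sup[OF _ ne] by blast
    have "v \<notin> E"
    proof
      assume "v \<in> E"
      then have "orthogonal v v" using v(1) by (auto simp: F_def)
      then show False using v(1) by (simp add: orthogonal_def)
    qed
    moreover have "norm (A *v v - v) \<le> m" using rotation_size[of A v] v(1) by (simp add: m_def)
    ultimately have lt: "norm (A *v v - v) < m" using v(1) by (simp add: E_iff)
    have bnd: "norm (A *v z - z) \<le> norm (A *v v - v) * norm z" if "z \<in> F" for z
    proof (cases "z = 0")
      case False
      have "norm (A *v z - z) / norm z \<le> norm (A *v v - v)"
        using v(2)[OF nrm[OF that False]] unfolding norm_rotation_normalized .
      then show ?thesis using False by (simp add: divide_le_eq)
    qed simp
    show ?thesis by (rule that[OF norm_ge_zero lt bnd])
  qed
  have PF: "x - P x \<in> F" for x using P(2) by (simp add: F_def)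
  show ?thesis
    by (rule that[OF linearI[OF Padd Pscale] PA pyth PE[unfolded m_def] m'(1) m'(2)[unfolded m_def] m'(3)[OF PF] u(1) Pu])
qed

section \<open>Bieberbach's first theorem\<close>

lemma matrix_vector_mult_minus: "A *v (- x) = - (A *v x)" for A :: "real^'n^'m"
  using matrix_vector_mult_diff_distrib[of A 0 x] by simp

locale crystallographic =
  fixes \<pi> :: "((real^'n^'n) \<times> (real^'n)) set"
  assumes bieb: "bieberbach \<pi>"
begin

lemma subgroup_pi: "subgroup \<pi> Isom"
  using bieb by (simp add: bieberbach_def)

lemma isolated: "g \<in> \<pi> \<Longrightarrow> \<exists>e>0. \<forall>h\<in>\<pi>. dist h g < e \<longrightarrow> h = g"
  and cocompact: "\<exists>K. compact K \<and> (\<forall>x. \<exists>g\<in>\<pi>. isom_apply g x \<in> K)"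
  and torsion_free: "g \<in> \<pi> \<Longrightarrow> k > 0 \<Longrightarrow> g [^]\<^bsub>Isom\<^esub> (k::nat) = \<one>\<^bsub>Isom\<^esub> \<Longrightarrow> g = \<one>\<^bsub>Isom\<^esub>"
  using bieb by (simp_all only: bieberbach_def)

lemma orth: "(A, a) \<in> \<pi> \<Longrightarrow> orthogonal_matrix A"
  using subgroup.subset[OF subgroup_pi] by auto

lemma mult_mem: "(A, a) \<in> \<pi> \<Longrightarrow> (B, b) \<in> \<pi> \<Longrightarrow> (A ** B, A *v b + a) \<in> \<pi>"
  using subgroup.m_closed[OF subgroup_pi, of "(A, a)" "(B, b)"] by simp

lemma inv_mem: "(A, a) \<in> \<pi> \<Longrightarrow> (transpose A, - (transpose A *v a)) \<in> \<pi>"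
  using subgroup.m_inv_closed[OF subgroup_pi, of "(A, a)"] inv_Isom[OF orth, of A a a] by simp

lemma one_mem: "(mat 1, 0) \<in> \<pi>"
  using subgroup.one_closed[OF subgroup_pi] by simp

text \<open>Discreteness is assumed pointwise, but translating by the group makes isolation of the
  identity uniform. Orthogonal matrices are bounded, so an infinite set of this kind would contain
  two distinct close elements \<open>g\<close>, \<open>h\<close>, with \<open>g^-1 h\<close> too
  close to the identity.\<close>

lemma finite_bounded: "finite {g \<in> \<pi>. norm (snd g) \<le> R}"
proof (rule ccontr)
  define N where "N = real CARD('n)"
  have N0: "N > 0" by (simp add: N_def)
  obtain e where e: "e > 0" "\<And>h. h \<in> \<pi> \<Longrightarrow> dist h (mat 1, 0) < e \<Longrightarrow> h = (mat 1, 0)"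
    using isolated[OF one_mem] by blast
  let ?S = "{g \<in> \<pi>. norm (snd g) \<le> R}"
  assume "infinite ?S"
  moreover have "bounded ?S"
    unfolding bounded_iff
  proof (intro exI ballI)
    fix g assume g: "g \<in> ?S"
    obtain A a where Aa: "g = (A, a)" by force
    have "norm A \<le> N * N * 1"
      unfolding N_def by (rule norm_matrix_le) (use g Aa orth in auto)
    then show "norm g \<le> N * N + R" using norm_Pair_le[of A a] g Aa by simp
  qed
  \<comment> \<open>\<open>N * N * N\<close> is the loss in comparing matrix norms for the linear
    part of \<open>g^-1 h\<close>, and 1 accounts for its translation part.\<close>
  moreover define \<epsilon> where "\<epsilon> = e / (N * N * N + 1)"
  moreover have "\<epsilon> > 0" using e N0 by (simp add: \<epsilon>_def add_pos_pos)
  ultimately obtain g h where gh: "g \<in> ?S" "h \<in> ?S" "g \<noteq> h" "dist g h < \<epsilon>"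
    using infinite_bounded_close_points by blast
  obtain A a B b where g: "g = (A, a)" and h: "h = (B, b)" by (metis surj_pair)
  have A: "orthogonal_matrix A" using gh g orth by auto
  have "norm (B - A) \<le> dist g h" "norm (b - a) \<le> dist g h"
    unfolding dist_commute[of g h] using dist_fst_le[of h g] dist_snd_le[of h g] by (simp_all add: g h dist_norm)
  then have d: "norm (B - A) < \<epsilon>" "norm (b - a) < \<epsilon>" using gh by auto
  have mem: "(transpose A ** B, transpose A *v b + - (transpose A *v a)) \<in> \<pi>"
    using gh g h by (intro mult_mem inv_mem) auto
  have "norm (transpose A ** B - mat 1) \<le> N * N * (N * norm (B - A))"
    unfolding N_def
  proof (rule norm_matrix_le)
    fix x
    have "(transpose A ** B - mat 1) *v x = transpose A *v ((B - A) *v x)"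
      using A by (simp add: matrix_vector_mult_diff_rdistrib matrix_vector_mult_diff_distrib matrix_vector_mul_assoc orthogonal_matrix_cancel del: transpose_matrix_vector)
    then show "norm ((transpose A ** B - mat 1) *v x) \<le> real CARD('n) * norm (B - A) * norm x"
      using A norm_matrix_vector_le[of "B - A" x] by (simp del: transpose_matrix_vector)
  qed
  moreover have "norm (transpose A *v b + - (transpose A *v a) - 0) = norm (b - a)"
    using A by (simp add: matrix_vector_mult_diff_distrib[symmetric] del: transpose_matrix_vector)
  ultimately have "dist (transpose A ** B, transpose A *v b + - (transpose A *v a)) (mat 1, 0)
      \<le> N * N * (N * norm (B - A)) + norm (b - a)"
    unfolding dist_norm by (simp only: diff_Pair) (rule order_trans[OF norm_Pair_le], simp)
  also have "\<dots> < N * N * (N * \<epsilon>) + \<epsilon>"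
    using d N0 by (intro add_strict_mono mult_strict_left_mono) auto
  also have "\<dots> = (N * N * N + 1) * \<epsilon>" by (simp add: algebra_simps)
  also have "\<dots> = e"
  proof -
    have "N * N * N + 1 > 0" using N0 by (intro add_pos_pos mult_pos_pos) auto
    then show ?thesis by (simp add: \<epsilon>_def)
  qed
  finally have "(transpose A ** B, transpose A *v b + - (transpose A *v a)) = (mat 1, 0)"
    using e(2) mem by blast
  then have 1: "transpose A ** B = mat 1" and 2: "transpose A *v b = transpose A *v a" by (simp_all del: transpose_matrix_vector)
  have "B = A"
  proof -
    have "A ** (transpose A ** B) = B" using A by (simp add: matrix_mul_assoc orthogonal_matrix_cancel)
    then show ?thesis by (simp add: 1)
  qed
  moreover have "b = a"
  proof -
    have "A *v (transpose A *v x) = x" for x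
      using A by (simp add: matrix_vector_mul_assoc orthogonal_matrix_cancel del: transpose_matrix_vector)
    then show ?thesis using 2 by metis
  qed
  ultimately show False using gh g h by simp
qed

text \<open>Discreteness turns the infimum of translation lengths into a minimum, as a descent
  argument requires.\<close>

lemma minimal_translation:
  assumes "Q \<subseteq> \<pi>" "Q \<noteq> {}"
  obtains g where "g \<in> Q" "\<And>h. h \<in> Q \<Longrightarrow> norm (snd g) \<le> norm (snd h)"
proof -
  obtain g0 where g0: "g0 \<in> Q" using assms by blast
  let ?S = "{g \<in> Q. norm (snd g) \<le> norm (snd g0)}"
  have fin: "finite ?S" by (rule finite_subset[OF _ finite_bounded[of "norm (snd g0)"]]) (use assms in auto)
  have "g0 \<in> ?S" using g0 by simp
  then have ne: "?S \<noteq> {}" by blast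
  define g where "g = arg_min_on (\<lambda>g. norm (snd g)) ?S"
  have g: "g \<in> ?S" unfolding g_def by (rule arg_min_if_finite(1)[OF fin ne])
  have gmin: "norm (snd g) \<le> norm (snd h)" if "h \<in> ?S" for h
    unfolding g_def by (rule arg_min_least[OF fin ne that])
  have "norm (snd g) \<le> norm (snd h)" if "h \<in> Q" for h
  proof (cases "h \<in> ?S")
    case False
    then show ?thesis using that g by simp
  qed (rule gmin)
  moreover have "g \<in> Q" using g by simp
  ultimately show ?thesis using that by blast
qed

text \<open>If \<open>g\<close> moves \<open>x\<close> into a bounded set, then \<open>g^-1\<close>
  moves the origin near \<open>x\<close>, and the image of the origin is the translation part of
  \<open>g^-1\<close>.\<close>

lemma coarsely_dense: obtains d where "\<And>x. \<exists>(A, a)\<in>\<pi>. norm (a - x) \<le> d"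
proof -
  obtain K where K: "compact K" "\<And>x. \<exists>g\<in>\<pi>. isom_apply g x \<in> K"
    using cocompact by blast
  obtain d where d: "\<And>x. x \<in> K \<Longrightarrow> norm x \<le> d" using compact_imp_bounded[OF K(1)] by (auto simp: bounded_iff)
  have "\<exists>(A, a)\<in>\<pi>. norm (a - x) \<le> d" for x
  proof -
    obtain A a where Aa: "(A, a) \<in> \<pi>" "isom_apply (A, a) x \<in> K" using K(2) by (metis surj_pair)
    have A: "orthogonal_matrix A" using orth[OF Aa(1)] .
    have "norm (- (transpose A *v a) - x) = norm (transpose A *v (A *v x + a))"
      using A by (simp add: matrix_vector_right_distrib matrix_vector_mul_assoc orthogonal_matrix_cancel norm_minus_commute[of _ x] del: transpose_matrix_vector)
    also have "\<dots> = norm (A *v x + a)" using A by (simp del: transpose_matrix_vector)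
    also have "\<dots> \<le> d" using d[OF Aa(2)] by (simp add: isom_apply_def)
    finally show ?thesis using inv_mem[OF Aa(1)] by blast
  qed
  then show ?thesis by (rule that)
qed

text \<open>Elements carrying the origin near \<open>k u\<close> have linear parts in a compact set,
  so two with very different \<open>k\<close> have nearly equal linear parts. Their quotient rotates
  little and translates by a long multiple of \<open>u\<close> up to an error that is small relative
  to this length.\<close>

lemma almost_translation_in_direction:
  assumes u: "norm u = 1" and e: "e > 0"
  obtains B b c where "(B, b) \<in> \<pi>" "c > 0" "norm (b - c *\<^sub>R u) \<le> e * c" "rotation_size B \<le> e"
proof -
  define N where "N = real CARD('n)"
  have N0: "N > 0" by (simp add: N_def)
  obtain d where "\<And>x. \<exists>(A, a)\<in>\<pi>. norm (a - x) \<le> d" using coarsely_dense by blast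
  then have "\<forall>k::nat. \<exists>A a. (A, a) \<in> \<pi> \<and> norm (a - real k *\<^sub>R u) \<le> d" by fast
  then obtain A a where Aa: "\<And>k::nat. (A k, a k) \<in> \<pi>" and ad: "\<And>k. norm (a k - real k *\<^sub>R u) \<le> d" by metis
  have d0: "d \<ge> 0" using ad[of 0] norm_ge_zero order_trans by blast
  have "bounded (range A)"
    unfolding bounded_iff
  proof (intro exI ballI)
    fix M assume "M \<in> range A"
    then have M: "orthogonal_matrix M" using Aa orth by blast
    show "norm M \<le> N * N * 1" unfolding N_def by (rule norm_matrix_le) (simp add: M)
  qed
  then obtain l r where r: "strict_mono (r :: nat \<Rightarrow> nat)" "(A \<circ> r) \<longlonglongrightarrow> l"
    using bounded_imp_convergent_subsequence by blast
  then have "Cauchy (A \<circ> r)" using LIMSEQ_imp_Cauchy by blast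
  then have "\<forall>e>0. \<exists>M. \<forall>m\<ge>M. \<forall>n\<ge>M. dist (A (r m)) (A (r n)) < e" by (simp add: Cauchy_def)
  moreover have "e / N > 0" using e N0 by simp
  ultimately obtain n0 where n0: "\<And>i j. i \<ge> n0 \<Longrightarrow> j \<ge> n0 \<Longrightarrow> dist (A (r i)) (A (r j)) < e / N"
    by metis
  define i where "i = r n0"
  obtain c :: nat where c: "real c > (2 * d + 2 * norm (a i)) / e" using reals_Archimedean2 by blast
  \<comment> \<open>As \<open>r\<close> is strictly increasing, \<open>j\<close> exceeds
    \<open>i\<close> by at least \<open>c\<close>, and \<open>e * c\<close> absorbs the fixed error
    \<open>2 * d + 2 * norm (a i)\<close>.\<close>
  define j where "j = r (n0 + i + c + 1)"
  have "n0 + i + c + 1 \<le> j" unfolding j_def by (rule seq_suble[OF r(1)])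
  then have ji: "j \<ge> i + c" "j > i" by auto
  define B where "B = A j ** transpose (A i)"
  define b where "b = A j *v (- (transpose (A i) *v a i)) + a j"
  have Bb: "(B, b) \<in> \<pi>" unfolding B_def b_def by (intro mult_mem inv_mem Aa)
  have Ai: "orthogonal_matrix (A i)" and Aj: "orthogonal_matrix (A j)" using orth Aa by auto
  have "dist (A j) (A i) < e / N" unfolding i_def j_def by (rule n0) auto
  then have dA: "norm (A j - A i) < e / N" by (simp add: dist_norm)
  have "rotation_size B \<le> e"
  proof (rule rotation_size_le)
    fix x
    have "B *v x - x = (A j - A i) *v (transpose (A i) *v x)"
      using Ai by (simp add: B_def matrix_vector_mult_diff_rdistrib matrix_vector_mul_assoc[symmetric] orthogonal_matrix_vector_cancel del: transpose_matrix_vector)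
    also have "norm \<dots> \<le> N * norm (A j - A i) * norm (transpose (A i) *v x)"
      unfolding N_def by (rule norm_matrix_vector_le)
    also have "\<dots> \<le> N * (e / N) * norm (transpose (A i) *v x)"
      using dA N0 by (intro mult_right_mono mult_left_mono) auto
    also have "\<dots> = e * norm x" using Ai N0 by (simp del: transpose_matrix_vector)
    finally show "norm (B *v x - x) \<le> e * norm x" .
  qed
  moreover have "norm (b - real (j - i) *\<^sub>R u) \<le> e * real (j - i)"
  proof -
    have "b - real (j - i) *\<^sub>R u = (a j - real j *\<^sub>R u) - (a i - real i *\<^sub>R u) + (a i - A j *v (transpose (A i) *v a i))"
      using ji by (simp add: b_def of_nat_diff algebra_simps matrix_vector_mult_minus matrix_vector_mult_diff_distrib del: transpose_matrix_vector)
    also have "norm \<dots> \<le> norm ((a j - real j *\<^sub>R u) - (a i - real i *\<^sub>R u)) + norm (a i - A j *v (transpose (A i) *v a i))"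
      by (rule norm_triangle_ineq)
    also have "\<dots> \<le> (d + d) + (norm (a i) + norm (a i))"
    proof (rule add_mono)
      show "norm ((a j - real j *\<^sub>R u) - (a i - real i *\<^sub>R u)) \<le> d + d"
        by (rule order_trans[OF norm_triangle_ineq4]) (intro add_mono ad)
      have "norm (A j *v (transpose (A i) *v a i)) = norm (a i)" using Ai Aj by (simp del: transpose_matrix_vector)
      then show "norm (a i - A j *v (transpose (A i) *v a i)) \<le> norm (a i) + norm (a i)"
        using norm_triangle_ineq4[of "a i" "A j *v (transpose (A i) *v a i)"] by simp
    qed
    also have "\<dots> \<le> e * real c" using c e by (simp add: field_simps)
    also have "\<dots> \<le> e * real (j - i)" using e ji by (intro mult_left_mono) auto
    finally show ?thesis .
  qed
  moreover have "real (j - i) > 0" using ji by simp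
  ultimately show ?thesis using that Bb by blast
qed

text \<open>Buser's geometric proof of Bieberbach's theorem: take an element with small nontrivial
  rotation and shortest translation part; its commutator with an almost-translation in the direction of
  largest rotation is a shorter such almost-translation.\<close>
lemma small_rotation_trivial:
  assumes mem: "(A, a) \<in> \<pi>" and small: "rotation_size A \<le> 1/2"
  shows "A = mat 1"
proof (rule ccontr)
  assume "A \<noteq> mat 1"
  let ?Q = "{g \<in> \<pi>. fst g \<noteq> mat 1 \<and> rotation_size (fst g) \<le> 1/2}"
  have "?Q \<noteq> {}" using mem small \<open>A \<noteq> mat 1\<close> by (simp add: set_eq_iff) blast
  note neQ = this
  have subQ: "?Q \<subseteq> \<pi>" by blast
  obtain \<alpha> where \<alpha>: "\<alpha> \<in> ?Q" "\<And>h. h \<in> ?Q \<Longrightarrow> norm (snd \<alpha>) \<le> norm (snd h)"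
    by (rule minimal_translation[OF subQ neQ], rule that)
  obtain A a where Aa: "\<alpha> = (A, a)" by force
  have mem: "(A, a) \<in> \<pi>" and nz: "A \<noteq> mat 1" and small: "rotation_size A \<le> 1/2" using \<alpha> Aa by auto
  have amin: "norm a \<le> norm b" if "(B, b) \<in> \<pi>" "B \<noteq> mat 1" "rotation_size B \<le> 1/2" for B b
    using \<alpha>(2)[of "(B, b)"] that Aa by simp
  have A: "orthogonal_matrix A" using orth mem .
  obtain P :: "real^'n \<Rightarrow> real^'n" and m' u where
    linP: "linear P" and PA: "\<And>x. P (A *v x) = A *v P x"
    and pyth: "\<And>x. (norm x)\<^sup>2 = (norm (P x))\<^sup>2 + (norm (x - P x))\<^sup>2"
    and PE: "\<And>x. norm (A *v P x - P x) = rotation_size A * norm (P x)"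
    and m': "0 \<le> m'" "m' < rotation_size A"
    and PF: "\<And>x. norm (A *v (x - P x) - (x - P x)) \<le> m' * norm (x - P x)"
    and u: "norm u = 1" "P u = u"
    by (rule maximal_rotation_space[OF A nz], rule that)
  define m where "m = rotation_size A"
  note P0 = linear_0[OF linP] and Padd = linear_add[OF linP] and Pdiff = linear_diff[OF linP]
  have Pn: "norm (P x) \<le> norm x" "norm (x - P x) \<le> norm x" for x
    by (rule power2_le_imp_le; use pyth[of x] in simp)+
  have Pu: "P (c *\<^sub>R u) = c *\<^sub>R u" for c
    using linear_scale[OF linP] u by simp
  \<comment> \<open>The remainder \<open>r\<close> of the commutator below has norm at most
    \<open>2 * \<kappa> * norm b\<close>, where \<open>norm b < 2 * e\<close>; the 8 makes this less
    than half of the gap \<open>(m - m') * e\<close>.\<close>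
  define \<kappa> where "\<kappa> = (m - m') / 8"
  have \<kappa>: "\<kappa> > 0" "\<kappa> \<le> 1/16" using m' small by (auto simp: \<kappa>_def m_def)
  \<comment> \<open>Elements of small rotation whose translation points mainly into the space of
    maximal rotation of \<open>A\<close>. The commutator with \<open>A\<close> stays in this
    set.\<close>
  let ?R = "{g \<in> \<pi>. snd g \<noteq> 0 \<and> norm (snd g - P (snd g)) < norm (P (snd g)) \<and> rotation_size (fst g) \<le> \<kappa>}"
  have "?R \<noteq> {}"
  proof -
    obtain B b c where B: "(B, b) \<in> \<pi>" "c > 0" "norm (b - c *\<^sub>R u) \<le> \<kappa> * c" "rotation_size B \<le> \<kappa>"
      using almost_translation_in_direction[OF u(1) \<kappa>(1)] by blast
    define s where "s = b - c *\<^sub>R u"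
    have b: "b = c *\<^sub>R u + s" by (simp add: s_def)
    have "\<kappa> * c \<le> (1/16) * c" using \<kappa> B(2) by (intro mult_right_mono) auto
    then have s: "norm s \<le> c / 16" using B(3) by (simp add: s_def)
    have Pb: "P b = c *\<^sub>R u + P s" by (simp add: b Padd Pu)
    have "norm (b - P b) \<le> norm s" using Pn(2)[of s] by (simp add: Pb) (simp add: b)
    moreover have "norm (P b) \<ge> c - norm s"
      using norm_diff_ineq[of "c *\<^sub>R u" "P s"] Pn(1)[of s] u(1) B(2) by (simp add: Pb)
    ultimately have bP: "norm (b - P b) < norm (P b)" using s B(2) by linarith
    then have "b \<noteq> 0" using P0 by auto
    then have "(B, b) \<in> ?R" using bP B(1,4) by simp
    then show ?thesis by blast
  qed
  note neR = this
  have subR: "?R \<subseteq> \<pi>" by blast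
  obtain \<beta> where \<beta>: "\<beta> \<in> ?R" "\<And>h. h \<in> ?R \<Longrightarrow> norm (snd \<beta>) \<le> norm (snd h)"
    by (rule minimal_translation[OF subR neR], rule that)
  obtain B b where Bb: "\<beta> = (B, b)" by force
  have memB: "(B, b) \<in> \<pi>" and b0: "b \<noteq> 0" and bP: "norm (b - P b) < norm (P b)" and Bk: "rotation_size B \<le> \<kappa>"
    using \<beta> Bb by auto
  have B: "orthogonal_matrix B" using orth memB .
  define C where "C = A ** B ** transpose A ** transpose B"
  define c where "c = (A ** B) *v (transpose A *v (- (transpose B *v b)) + - (transpose A *v a)) + (A *v b + a)"
  have memC: "(C, c) \<in> \<pi>"
    using mult_mem[OF mult_mem[OF mem memB] mult_mem[OF inv_mem[OF mem] inv_mem[OF memB]]]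
    by (simp add: C_def c_def matrix_mul_assoc)
  have rC: "rotation_size C \<le> 2 * m * rotation_size B"
    unfolding C_def m_def by (rule rotation_size_commutator[OF A B])
  have m1: "2 * m \<le> 1" using small by (simp add: m_def)
  have m0: "0 \<le> m" by (simp add: m_def rotation_size_nonneg)
  have "2 * m * rotation_size B \<le> 1 * rotation_size B"
    by (intro mult_right_mono m1 rotation_size_nonneg)
  then have CB: "rotation_size C \<le> rotation_size B" using rC by simp
  \<comment> \<open>The translation part of the commutator is \<open>A *v b - b\<close> up to
    \<open>r\<close>, and \<open>r\<close> is small because \<open>C\<close> and \<open>B\<close>
    rotate little.\<close>
  define r where "r = (b - C *v b) + (a - A *v (B *v (transpose A *v a)))"
  have c_eq: "c = (A *v b - b) + r"
    by (simp add: c_def r_def C_def matrix_vector_mult_add_rdistrib matrix_vector_right_distrib matrix_vector_mul_assoc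
        matrix_mul_assoc matrix_vector_mult_minus matrix_vector_mult_diff_distrib del: transpose_matrix_vector)
  have "norm (b - C *v b) \<le> rotation_size B * norm b"
    using rotation_size[of C b] mult_right_mono[OF CB, of "norm b"] by (simp add: norm_minus_commute)
  moreover have "norm (a - A *v (B *v (transpose A *v a))) \<le> rotation_size B * norm a"
  proof -
    have "a - A *v (B *v (transpose A *v a)) = - (A *v (B *v (transpose A *v a) - transpose A *v a))"
      using A by (simp add: matrix_vector_mult_diff_distrib matrix_vector_mul_assoc orthogonal_matrix_cancel del: transpose_matrix_vector)
    then have "norm (a - A *v (B *v (transpose A *v a))) = norm (B *v (transpose A *v a) - transpose A *v a)"
      using A by (simp del: transpose_matrix_vector)
    also have "\<dots> \<le> rotation_size B * norm (transpose A *v a)" by (rule rotation_size)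
    finally show ?thesis using A by (simp del: transpose_matrix_vector)
  qed
  ultimately have "norm r \<le> rotation_size B * norm b + rotation_size B * norm a"
    unfolding r_def by (rule norm_triangle_le[OF add_mono])
  \<comment> \<open>Minimality of \<open>\<alpha>\<close> enters: a nontrivial \<open>B\<close>
    competes with \<open>A\<close>, so \<open>b\<close> is at least as long as \<open>a\<close>; for
    trivial \<open>B\<close> the factor vanishes.\<close>
  moreover have "rotation_size B * norm a \<le> rotation_size B * norm b"
  proof (cases "B = mat 1")
    case True
    then show ?thesis using rotation_size_eq_0[of B] by simp
  next
    case False
    then show ?thesis using amin[OF memB False] Bk \<kappa> by (intro mult_left_mono rotation_size_nonneg) auto
  qed
  moreover have "rotation_size B * norm b \<le> \<kappa> * norm b" by (intro mult_right_mono Bk) simp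
  ultimately have r1: "norm r \<le> 2 * \<kappa> * norm b" by linarith
  define e where "e = norm (P b)"
  define f where "f = norm (b - P b)"
  have ef: "0 \<le> f" "f < e" using bP by (simp_all add: e_def f_def)
  have "norm b \<le> e + f" using norm_triangle_ineq[of "P b" "b - P b"] by (simp add: e_def f_def)
  then have "norm b < 2 * e" using ef by simp
  then have "2 * \<kappa> * norm b < 2 * \<kappa> * (2 * e)" using \<kappa> by (intro mult_strict_left_mono) auto
  moreover have "2 * \<kappa> * (2 * e) = (m - m') / 2 * e" by (simp add: \<kappa>_def)
  ultimately have r2: "norm r < (m - m') / 2 * e" using r1 by linarith
  have Pc: "P c = (A *v P b - P b) + P r" by (simp add: c_eq Padd Pdiff PA)
  have cPc: "c - P c = (A *v (b - P b) - (b - P b)) + (r - P r)"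
    unfolding Pc by (simp add: c_eq matrix_vector_mult_diff_distrib)
  have "norm (P c) \<ge> m * e - norm r"
    using norm_diff_ineq[of "A *v P b - P b" "P r"] PE[of b] Pn(1)[of r] by (simp add: Pc m_def e_def)
  moreover have "norm (c - P c) \<le> m' * f + norm r"
    unfolding cPc f_def by (rule norm_triangle_le[OF add_mono[OF PF Pn(2)]])
  moreover have "m' * f \<le> m' * e" using m' ef by (intro mult_left_mono) auto
  moreover have "m * e - (m - m') / 2 * e = m' * e + (m - m') / 2 * e" by (simp add: field_simps)
  ultimately have cc: "norm (c - P c) < norm (P c)" using r2 by linarith
  then have c0: "c \<noteq> 0" using P0 by auto
  have "(C, c) \<in> ?R" using memC c0 cc CB Bk by simp
  \<comment> \<open>This contradicts minimality of \<open>\<beta>\<close>: \<open>A *v b - b\<close>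
    has at most half and \<open>r\<close> at most an eighth of the length of
    \<open>b\<close>.\<close>
  then have "norm b \<le> norm c" using \<beta>(2)[of "(C, c)"] Bb by simp
  also have "norm c \<le> m * norm b + norm r"
    unfolding c_eq m_def by (rule norm_triangle_le[OF add_mono[OF rotation_size order_refl]])
  also have "\<dots> \<le> (1/2) * norm b + (1/8) * norm b"
  proof (rule add_mono)
    show "m * norm b \<le> (1/2) * norm b" using m1 by (intro mult_right_mono) auto
    have "2 * \<kappa> * norm b \<le> (1/8) * norm b" using \<kappa> by (intro mult_right_mono) auto
    then show "norm r \<le> (1/8) * norm b" using r1 by simp
  qed
  finally show False using b0 by simp
qed

section \<open>Rank of the translation lattice and finiteness of the holonomy\<close>

definition L :: "(real^'n) set" where "L = {t. (mat 1, t) \<in> \<pi>}"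

text \<open>If a unit vector \<open>u\<close> were orthogonal to all translations, an
  almost-translation along \<open>u\<close> of small rotation would be a translation by
  \<open>small_rotation_trivial\<close>, yet have a nonzero component along
  \<open>u\<close>.\<close>

lemma lattice_L: "euclidean_lattice L"
proof
  show "0 \<in> L" using one_mem by (simp add: L_def)
  show "x - y \<in> L" if "x \<in> L" "y \<in> L" for x y
    using mult_mem[OF inv_mem, of "mat 1" y "mat 1" x] that by (simp add: L_def)
  show "finite {x \<in> L. norm x \<le> R}" for R
  proof (rule finite_subset)
    show "{x \<in> L. norm x \<le> R} \<subseteq> snd ` {g \<in> \<pi>. norm (snd g) \<le> R}"
      by (force simp: L_def)
  qed (intro finite_imageI finite_bounded)
  show "span L = UNIV"
  proof (rule ccontr)
    assume "span L \<noteq> UNIV"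
    then obtain v where v: "v \<noteq> 0" "\<And>t. t \<in> span L \<Longrightarrow> orthogonal v t"
      using span_not_univ_subset_hyperplane[of L] by (auto simp: orthogonal_def)
    define u where "u = (1 / norm v) *\<^sub>R v"
    have u: "norm u = 1" "\<And>t. t \<in> L \<Longrightarrow> u \<bullet> t = 0"
      using v span_base by (auto simp: u_def orthogonal_def)
    obtain B b c where B: "(B, b) \<in> \<pi>" "c > 0" "norm (b - c *\<^sub>R u) \<le> (1/2) * c" "rotation_size B \<le> 1/2"
      using almost_translation_in_direction[OF u(1), of "1/2"] by auto
    have "B = mat 1" using small_rotation_trivial B(1,4) .
    then have "u \<bullet> b = 0" using B(1) u(2) by (simp add: L_def)
    then have "u \<bullet> (b - c *\<^sub>R u) = - c" using u(1) by (simp add: inner_diff_right power2_norm_eq_inner[symmetric])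
    then have "c \<le> norm u * norm (b - c *\<^sub>R u)" using Cauchy_Schwarz_ineq2[of u "b - c *\<^sub>R u"] B(2) by simp
    then show False using B(2,3) u(1) by simp
  qed
qed

text \<open>Infinitely many linear parts would include two distinct close ones; their quotient has
  small rotation and is therefore trivial.\<close>

lemma finite_linear_parts: "finite (fst ` \<pi>)"
proof (rule ccontr)
  define N where "N = real CARD('n)"
  have N0: "N > 0" by (simp add: N_def)
  assume "infinite (fst ` \<pi>)"
  moreover have "bounded (fst ` \<pi>)"
    unfolding bounded_iff
  proof (intro exI ballI)
    fix M assume "M \<in> fst ` \<pi>"
    then have M: "orthogonal_matrix M" using orth by force
    show "norm M \<le> N * N * 1" unfolding N_def by (rule norm_matrix_le) (simp add: M)
  qed
  moreover have "1 / (2 * N) > 0" using N0 by simp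
  ultimately obtain A B where AB: "A \<in> fst ` \<pi>" "B \<in> fst ` \<pi>" "A \<noteq> B" "dist A B < 1 / (2 * N)"
    by (rule infinite_bounded_close_points)
  then obtain a b where a: "(A, a) \<in> \<pi>" and b: "(B, b) \<in> \<pi>" by force
  have B: "orthogonal_matrix B" using orth[OF b] .
  have "A ** transpose B = mat 1"
  proof (rule small_rotation_trivial[OF mult_mem[OF a inv_mem[OF b]]], rule rotation_size_le)
    fix x
    have "(A ** transpose B) *v x - x = (A - B) *v (transpose B *v x)"
      using B by (simp add: matrix_vector_mult_diff_rdistrib matrix_vector_mul_assoc[symmetric] orthogonal_matrix_vector_cancel del: transpose_matrix_vector)
    also have "norm \<dots> \<le> N * norm (A - B) * norm (transpose B *v x)"
      unfolding N_def by (rule norm_matrix_vector_le)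
    also have "\<dots> \<le> N * (1 / (2 * N)) * norm (transpose B *v x)"
      using AB(4) N0 by (intro mult_right_mono mult_left_mono) (auto simp: dist_norm)
    also have "\<dots> = (1/2) * norm x" using B N0 by (simp del: transpose_matrix_vector)
    finally show "norm ((A ** transpose B) *v x - x) \<le> (1/2) * norm x" .
  qed
  then have "A ** (transpose B ** B) = mat 1 ** B" by (simp add: matrix_mul_assoc)
  then show False using B AB(3) by (simp add: orthogonal_matrix_cancel)
qed

end

section \<open>Top-dimensional homology of Euclidean space\<close>

lemma iso_preimage:
  assumes "f \<in> Group.iso G H" "y \<in> carrier H"
  obtains x where "x \<in> carrier G" "f x = y"
proof -
  have "f ` carrier G = carrier H"
    using assms(1) by (simp add: iso_def bij_betw_def)
  then have "y \<in> f ` carrier G" using assms(2) by (rule ssubst)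
  then show ?thesis using that by auto
qed

lemma iso_eqD:
  "\<lbrakk>f \<in> Group.iso G H; x \<in> carrier G; y \<in> carrier G; f x = f y\<rbrakk> \<Longrightarrow> x = y"
  by (rule inj_onD[of f "carrier G"]) (simp_all add: iso_def bij_betw_def)

text \<open>The surjective half of additivity, by two excisions. Excising \<open>T\<close> from
  \<open>(X, A \<union> T)\<close> produces \<open>v1\<close>; the rest of \<open>v\<close> comes
  from \<open>(A \<union> T, A)\<close> by exactness of the triple, and excising
  \<open>A \<inter> S\<close> places it on \<open>T\<close>.\<close>

lemma relative_homology_two_open_pieces:
  assumes S: "openin X S" and T: "openin X T" and dis: "S \<inter> T = {}" and un: "S \<union> T = topspace X"
    and A: "A \<subseteq> topspace X"
    and v: "v \<in> carrier (relative_homology_group p X A)"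
  obtains v1 v2 where "v1 \<in> carrier (relative_homology_group p (subtopology X S) (A \<inter> S))"
    "v2 \<in> carrier (relative_homology_group p (subtopology X T) (A \<inter> T))"
    "v = hom_induced p (subtopology X S) (A \<inter> S) X A id v1
       \<otimes>\<^bsub>relative_homology_group p X A\<^esub> hom_induced p (subtopology X T) (A \<inter> T) X A id v2"
proof -
  let ?G = "relative_homology_group p X A"
  let ?H = "relative_homology_group p X (A \<union> T)"
  let ?q = "hom_induced p X A X (A \<union> T) id"
  have clS: "closedin X S" and clT: "closedin X T"
  proof -
    have "topspace X - S = T" "topspace X - T = S" "S \<subseteq> topspace X" "T \<subseteq> topspace X" using dis un by auto
    then show "closedin X S" "closedin X T" using S T by (simp_all add: closedin_def)
  qed
  have ST: "topspace X - T = S" "S \<union> T - T = S" using dis un by auto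
  have e1: "hom_induced p (subtopology X (topspace X - T)) ((A \<union> T) - T) (subtopology X (topspace X)) (A \<union> T) id
      \<in> iso (relative_homology_group p (subtopology X (topspace X - T)) ((A \<union> T) - T))
          (relative_homology_group p (subtopology X (topspace X)) (A \<union> T))"
  proof (rule homology_excision_axiom)
    show "X closure_of T \<subseteq> X interior_of (A \<union> T)"
      by (simp add: closure_of_closedin[OF clT] interior_of_maximal[OF _ T])
    show "A \<union> T \<subseteq> topspace X" using A un by auto
  qed
  have AT: "(A \<union> T) - T = A \<inter> S" using A dis un by auto
  have e1': "hom_induced p (subtopology X S) (A \<inter> S) X (A \<union> T) id
      \<in> iso (relative_homology_group p (subtopology X S) (A \<inter> S)) ?H"
    using e1 unfolding ST AT by simp
  have qv: "?q v \<in> carrier ?H" by (simp add: hom_induced_carrier)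
  then obtain v1 where v1: "v1 \<in> carrier (relative_homology_group p (subtopology X S) (A \<inter> S))"
    and v1q: "hom_induced p (subtopology X S) (A \<inter> S) X (A \<union> T) id v1 = ?q v"
    using iso_preimage[OF e1'] by metis
  define w where "w = hom_induced p (subtopology X S) (A \<inter> S) X A id v1"
  have w: "w \<in> carrier ?G" by (simp add: w_def hom_induced_carrier)
  have qw: "?q w = ?q v"
    unfolding w_def v1q[symmetric]
    by (subst hom_induced_compose') (auto simp: continuous_map_from_subtopology)
  interpret G: comm_group ?G by simp
  interpret q: group_hom ?G ?H ?q
    by (simp add: group_hom_def group_hom_axioms_def hom_induced_hom)
  define d where "d = inv\<^bsub>?G\<^esub> w \<otimes>\<^bsub>?G\<^esub> v"
  have d: "d \<in> carrier ?G" using v w by (simp add: d_def)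
  have "?q d = \<one>\<^bsub>?H\<^esub>"
    using v w qw by (simp add: d_def)
  then have "d \<in> kernel ?G ?H ?q" using d by (simp add: kernel_def)
  moreover have "exact_seq ([?H, ?G, relative_homology_group p (subtopology X (A \<union> T)) A],
                    [?q, hom_induced p (subtopology X (A \<union> T)) A X A id])"
    by (rule homology_exactness_triple_3) auto
  ultimately obtain v' where v': "v' \<in> carrier (relative_homology_group p (subtopology X (A \<union> T)) A)"
    and dv': "d = hom_induced p (subtopology X (A \<union> T)) A X A id v'"
    by auto
  let ?Y = "subtopology X (A \<union> T)"
  have tY: "topspace ?Y = A \<union> T" using A un by auto
  have AS: "A \<inter> S \<subseteq> A" by auto
  have clAS: "closedin ?Y (A \<inter> S)" and opA: "openin ?Y (A \<inter> S)"
  proof -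
    have "A \<inter> S = (A \<union> T) \<inter> S" using dis by auto
    then show "closedin ?Y (A \<inter> S)" "openin ?Y (A \<inter> S)"
      using clS S by (auto simp: closedin_subtopology openin_subtopology Int_commute)
  qed
  have e2: "hom_induced p (subtopology ?Y ((A \<union> T) - (A \<inter> S))) (A - (A \<inter> S)) (subtopology ?Y (A \<union> T)) A id
      \<in> iso (relative_homology_group p (subtopology ?Y ((A \<union> T) - (A \<inter> S))) (A - (A \<inter> S)))
          (relative_homology_group p (subtopology ?Y (A \<union> T)) A)"
  proof (rule homology_excision_axiom)
    show "?Y closure_of (A \<inter> S) \<subseteq> ?Y interior_of A"
      by (simp add: closure_of_closedin[OF clAS] interior_of_maximal[OF AS opA])
  qed auto
  have eq: "(A \<union> T) - (A \<inter> S) = T" "A - (A \<inter> S) = A \<inter> T" "subtopology ?Y (A \<union> T) = ?Y"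
    "subtopology ?Y T = subtopology X T" 
    using A un dis by (auto simp: subtopology_subtopology Int_absorb1)
  have e2': "hom_induced p (subtopology X T) (A \<inter> T) ?Y A id
      \<in> iso (relative_homology_group p (subtopology X T) (A \<inter> T)) (relative_homology_group p ?Y A)"
    using e2 unfolding eq .
  then obtain v2 where v2: "v2 \<in> carrier (relative_homology_group p (subtopology X T) (A \<inter> T))"
    and v2': "hom_induced p (subtopology X T) (A \<inter> T) ?Y A id v2 = v'"
    using iso_preimage[OF e2' v'] by metis
  have cTY: "continuous_map (subtopology X T) ?Y id"
    by (simp add: continuous_map_in_subtopology continuous_map_from_subtopology)
  have "d = hom_induced p (subtopology X T) (A \<inter> T) X A id v2"
    unfolding dv' v2'[symmetric]
    by (subst hom_induced_compose') (auto simp: continuous_map_from_subtopology cTY)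
  moreover have "v = w \<otimes>\<^bsub>?G\<^esub> d"
    using v w by (simp add: d_def G.m_assoc[symmetric])
  ultimately show ?thesis using that v1 v2 w_def by blast
qed

text \<open>The homology group relative to the punctured space is infinite cyclic, via the sphere.
  Its generator comes from the complement of the ball because the punctured space relative to that
  complement has trivial homology. Indivisibility records the generator without carrying an
  isomorphism to the integers along.\<close>

lemma top_homology_class_euclidean:
  fixes R :: real
  assumes "R \<ge> 0"
  obtains u where "u \<in> carrier (relative_homology_group (int DIM('a::euclidean_space)) (euclidean :: 'a topology) (-cball 0 R))"
    and "\<And>m w. \<lbrakk>(m::nat) > 1; w \<in> carrier (relative_homology_group (int DIM('a)) (euclidean :: 'a topology) (-{0}))\<rbrakk>
        \<Longrightarrow> hom_induced (int DIM('a)) (euclidean :: 'a topology) (-cball 0 R) euclidean (-{0}) id u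
          \<noteq> w [^]\<^bsub>relative_homology_group (int DIM('a)) (euclidean :: 'a topology) (-{0})\<^esub> m"
proof -
  let ?n = "int DIM('a)"
  let ?E = "euclidean :: 'a topology"
  let ?Z = "relative_homology_group ?n ?E (-{0})"
  let ?U = "relative_homology_group ?n ?E (-cball 0 R)"
  have d0: "DIM('a) \<noteq> 0" by simp
  obtain b :: 'a where b: "b \<in> Basis" using nonempty_Basis by blast
  have ne: "topspace ?E \<inter> -{0::'a} \<noteq> {}"
  proof -
    have "b \<noteq> 0" using b by auto
    then show ?thesis by auto
  qed
  have ctr: "contractible_space ?E"  using contractible_space_top_of_set[of "UNIV :: 'a set"] by simp
  have i1: "?Z \<cong> reduced_homology_group (?n - 1) (top_of_set (-{0::'a}))"
    using isomorphic_group_relative_homology_of_contractible[OF ctr ne, of ?n] by simp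
  have i2: "reduced_homology_group (?n - 1) (top_of_set (-{0::'a})) \<cong> reduced_homology_group (?n - 1) (top_of_set (sphere (0::'a) 1))"
  proof -
    have "top_of_set (sphere (0::'a) 1) homotopy_equivalent_space top_of_set (-{0::'a})"
      using homotopy_eqv_rel_frontier_punctured_affine_hull [of "cball (0::'a) 1" 0]
      by (simp add: affine_hull_nonempty_interior Compl_eq_Diff_UNIV rel_interior_nonempty_interior)
    then have "top_of_set (-{0::'a}) homotopy_equivalent_space top_of_set (sphere (0::'a) 1)"
      by (rule homotopy_equivalent_space_sym[THEN iffD1])
    then show ?thesis
      by (rule homotopy_equivalent_space_imp_isomorphic_reduced_homology_groups)
  qed
  have i3: "reduced_homology_group (?n - 1) (top_of_set (sphere (0::'a) 1)) \<cong> reduced_homology_group (?n - 1) (nsphere (DIM('a) - 1))"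
  proof -
    obtain f :: "(nat \<Rightarrow> real) \<Rightarrow> 'a" and g where "homeomorphic_maps (nsphere(DIM('a) - 1)) (top_of_set (sphere 0 1 \<inter> span Basis)) f g"
      by (rule homeomorphic_maps_nsphere_euclidean_sphere[OF independent_Basis orthogonal_Basis refl d0 norm_Basis])
    then have "homeomorphic_maps (top_of_set (sphere (0::'a) 1)) (nsphere(DIM('a) - 1)) g f"
      unfolding span_Basis Int_UNIV_right by (rule homeomorphic_maps_sym[THEN iffD1])
    then have "top_of_set (sphere (0::'a) 1) homeomorphic_space nsphere (DIM('a) - 1)"
      unfolding homeomorphic_space_def by blast
    then show ?thesis
      by (rule homeomorphic_space_imp_isomorphic_reduced_homology_groups)
  qed
  have i4: "reduced_homology_group (?n - 1) (nsphere (DIM('a) - 1)) \<cong> integer_group"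
    using reduced_homology_group_nsphere(1)[of "DIM('a) - 1"] d0 by (simp add: of_nat_diff)
  have "?Z \<cong> integer_group"
    by (rule iso_trans[OF iso_trans[OF iso_trans[OF i1 i2] i3] i4])
  then obtain f where f: "f \<in> iso ?Z integer_group" by (auto simp: is_iso_def)
  then obtain z where z: "z \<in> carrier ?Z" "f z = 1"
    using iso_preimage[OF f, of 1] by (auto simp: carrier_integer_group)
  have nd: "z \<noteq> w [^]\<^bsub>?Z\<^esub> m" if "m > 1" "w \<in> carrier ?Z" for m :: nat and w
  proof
    assume eq: "z = w [^]\<^bsub>?Z\<^esub> m"
    interpret f: group_hom ?Z integer_group f
      using f by (simp add: group_hom_def group_hom_axioms_def iso_def)
    have pow: "x [^]\<^bsub>integer_group\<^esub> k = int k * x" for k :: nat and x :: int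
      by (induction k) (auto simp: algebra_simps)
    have "f z = int m * f w" unfolding eq using that by (simp add: f.hom_nat_pow pow)
    then have "int m dvd 1" using z(2) by (metis dvd_triv_left)
    then show False using \<open>m > 1\<close> by simp
  qed
  let ?T = "relative_homology_group (?n - 1) (subtopology ?E (-{0})) (-cball 0 R)"
  have "exact_seq ([?T, ?Z, ?U],
     [hom_relboundary ?n ?E (-{0}) (-cball 0 R), hom_induced ?n ?E (-cball 0 R) ?E (-{0}) id])"
    by (rule homology_exactness_triple_1) (use assms in auto)
  then have ex: "hom_induced ?n ?E (-cball 0 R) ?E (-{0}) id ` carrier ?U = kernel ?Z ?T (hom_relboundary ?n ?E (-{0}) (-cball 0 R))"
    by simp
  have tr: "trivial_group ?T"
  proof (rule trivial_relative_homology_group_alt)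
    \<comment> \<open>Pushing points radially outwards by \<open>R + 1\<close> lands outside the
      ball, and along the homotopy to the identity no point gets closer to 0 than it was
      initially.\<close>
    let ?g = "\<lambda>x::'a. x + ((R+1) / norm x) *\<^sub>R x"
    have nrm: "norm (x + s *\<^sub>R ((R+1) / norm x) *\<^sub>R x) = norm x + s * (R+1)" if "x \<noteq> 0" "s \<ge> 0" for x :: 'a and s
    proof -
      have "x + s *\<^sub>R ((R+1) / norm x) *\<^sub>R x = (1 + s * (R+1) / norm x) *\<^sub>R x"
        by (simp add: algebra_simps)
      moreover have "1 + s * (R+1) / norm x \<ge> 0" using assms that by simp
      ultimately show ?thesis using that by (simp add: field_simps)
    qed
    have n1: "norm (?g x) = norm x + (R + 1)" if "x \<noteq> 0" for x using nrm[of x 1] that by simp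
    show "continuous_map (top_of_set (-{0})) (subtopology (top_of_set (-{0})) (-cball 0 R)) ?g"
    proof -
      have "continuous_on (-{0}) ?g" by (intro continuous_intros) auto
      moreover have "?g x \<in> -{0} \<inter> -cball 0 R" if "x \<in> -{0}" for x
      proof -
        have "norm (?g x) > R" using n1[of x] that by (smt (verit) ComplD insertI1 norm_ge_zero zero_less_norm_iff)
        then show ?thesis using assms by (metis ComplI Int_iff linorder_not_le mem_cball_0 norm_zero singletonD)
      qed
      ultimately show ?thesis
        by (auto simp: subtopology_subtopology continuous_map_in_subtopology)
    qed
    let ?h = "\<lambda>(s::real, x::'a). x + (1 - s) *\<^sub>R (((R+1) / norm x) *\<^sub>R x)"
    show "homotopic_with (\<lambda>k. k ` (- cball 0 R) \<subseteq> - cball 0 R) (top_of_set (- {0})) (top_of_set (- {0})) ?g id"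
      unfolding homotopic_with_def
    proof (intro exI[of _ ?h] conjI ballI)
      have c: "continuous_on ({0..1} \<times> (-{0})) ?h" 
        unfolding case_prod_unfold by (intro continuous_intros) auto
      have "?h y \<in> -{0}" if "y \<in> {0..1} \<times> (-{0})" for y
        using nrm[of "snd y" "1 - fst y"] that assms
        by (auto simp: case_prod_unfold simp del: scaleR_scaleR) (smt (verit, best) mult_nonneg_nonneg norm_zero zero_less_norm_iff)
      then show "continuous_map (prod_topology (top_of_set {0..1}) (top_of_set (- {0}))) (top_of_set (- {0})) ?h"
        using c by (simp add: prod_topology_subtopology_eu continuous_map_in_subtopology Pi_iff)
      show "(\<lambda>x. ?h (s, x)) ` (- cball 0 R) \<subseteq> - cball 0 R" if "s \<in> {0..1}" for s
      proof clarsimp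
        fix x :: 'a assume x: "\<not> norm x \<le> R" and le: "norm (x + ((1 - s) * (R + 1) / norm x) *\<^sub>R x) \<le> R"
        then have "x \<noteq> 0" using assms by auto
        have "0 \<le> (1 - s) * (R + 1)" using that assms by (intro mult_nonneg_nonneg) auto
        moreover have "norm (x + ((1 - s) * (R + 1) / norm x) *\<^sub>R x) = norm x + (1 - s) * (R + 1)"
          using nrm[OF \<open>x \<noteq> 0\<close>, of "1 - s"] that by simp
        ultimately show False using x le by linarith
      qed
    qed auto
  qed
  have "hom_relboundary ?n ?E (-{0}) (-cball 0 R) z = \<one>\<^bsub>?T\<^esub>"
    using hom_relboundary[of ?n ?E "-{0}" "-cball 0 R" z] tr unfolding trivial_group_def by (metis singletonD)
  then have "z \<in> hom_induced ?n ?E (-cball 0 R) ?E (-{0}) id ` carrier ?U"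
    unfolding ex kernel_def using z by simp
  then obtain u where "u \<in> carrier ?U" "hom_induced ?n ?E (-cball 0 R) ?E (-{0}) id u = z"
    by auto
  then show ?thesis using that nd by blast
qed

lemma continuous_on_funpow: "continuous_on UNIV f \<Longrightarrow> continuous_on UNIV (f ^^ i)"
  for f :: "'a::topological_space \<Rightarrow> 'a"
proof (induction i)
  case (Suc i)
  then show ?case using continuous_on_compose2[of UNIV f UNIV "f ^^ i"] by (simp add: o_def)
qed (simp add: id_def)

lemma funpow_displacement:
  fixes f :: "'a::real_normed_vector \<Rightarrow> 'a"
  assumes "\<And>x. norm (f x - x) \<le> B"
  shows "norm ((f ^^ i) x - x) \<le> i * B"
proof (induction i)
  case (Suc i)
  have "norm ((f ^^ Suc i) x - x) \<le> norm (f ((f ^^ i) x) - (f ^^ i) x) + norm ((f ^^ i) x - x)"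
    using norm_triangle_ineq[of "f ((f ^^ i) x) - (f ^^ i) x" "(f ^^ i) x - x"] by simp
  also have "\<dots> \<le> B + i * B" using assms Suc by (rule add_mono)
  finally show ?case by (simp add: algebra_simps)
qed simp

text \<open>The induced map factors through the homology of \<open>X\<close> relative to itself,
  which is trivial.\<close>

lemma hom_induced_into_subspace:
  assumes f: "continuous_map X Y f" and T: "f \<in> topspace X \<rightarrow> T" and S: "S \<subseteq> topspace X"
    and c: "c \<in> carrier (relative_homology_group p X S)"
  shows "hom_induced p X S Y T f c = \<one>\<^bsub>relative_homology_group p Y T\<^esub>"
proof -
  let ?M = "relative_homology_group p X (topspace X)"
  have "hom_induced p X S X (topspace X) id c \<in> carrier ?M" by (simp add: hom_induced_carrier)
  then have 1: "hom_induced p X S X (topspace X) id c = \<one>\<^bsub>?M\<^esub>"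
    using trivial_relative_homology_group_topspace[of p X] unfolding trivial_group_def by (metis singletonD)
  have "hom_induced p X S Y T f c = hom_induced p X (topspace X) Y T f (hom_induced p X S X (topspace X) id c)"
    by (subst hom_induced_compose') (use f T S in auto)
  also have "\<dots> = \<one>\<^bsub>relative_homology_group p Y T\<^esub>"
    unfolding 1 by (rule hom_one[OF hom_induced_hom]) simp_all
  finally show ?thesis .
qed

lemma hom_induced_linear_homotopy:
  fixes f g :: "'a::real_normed_vector \<Rightarrow> 'b::real_normed_vector"
  assumes f: "continuous_on UNIV f" and g: "continuous_on UNIV g"
    and S: "\<And>x s. \<lbrakk>x \<in> S; 0 \<le> s; s \<le> 1\<rbrakk> \<Longrightarrow> (1 - s) *\<^sub>R f x + s *\<^sub>R g x \<in> T"
  shows "hom_induced p euclidean S euclidean T f = hom_induced p euclidean S euclidean T g"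
proof (rule homology_homotopy_axiom)
  let ?h = "\<lambda>(s::real, x). (1 - s) *\<^sub>R f x + s *\<^sub>R g x"
  show "homotopic_with (\<lambda>h. h \<in> S \<rightarrow> T) euclidean euclidean f g"
    unfolding homotopic_with_def
  proof (intro exI[of _ ?h] conjI ballI)
    have "continuous_on ({0..1} \<times> UNIV) ?h" 
      unfolding case_prod_unfold
      by (intro continuous_intros continuous_on_compose2[OF f] continuous_on_compose2[OF g]) auto
    then show "continuous_map (prod_topology (top_of_set {0..1}) euclidean) euclidean ?h"
      using prod_topology_subtopology_eu[of "{0..1::real}" "UNIV :: 'a set"] by simp
    show "(\<lambda>x. ?h (s, x)) \<in> S \<rightarrow> T" if "s \<in> {0..1}" for s
      using S that by auto
  qed auto
qed

lemma excision_euclidean: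
  fixes D :: "'a::topological_space set"
  assumes "open D" "closed K" "K \<subseteq> D"
  shows "hom_induced p (top_of_set D) (D - K) euclidean (-K) id
    \<in> Group.iso (relative_homology_group p (top_of_set D) (D - K)) (relative_homology_group p euclidean (-K))"
proof -
  have "hom_induced p (subtopology euclidean (UNIV - (-D))) ((-K) - (-D)) (top_of_set UNIV) (-K) id
    \<in> Group.iso (relative_homology_group p (subtopology euclidean (UNIV - (-D))) ((-K) - (-D))) (relative_homology_group p (top_of_set UNIV) (-K))"
  proof (rule homology_excision_axiom)
    have "closure (-D) = -D" "interior (-K) = -K" using assms by (simp_all add: interior_open open_Compl closed_Compl closure_closed)
    then show "euclidean closure_of (- D) \<subseteq> euclidean interior_of (- K)" using assms by auto
  qed auto
  moreover have "UNIV - (-D) = D" "(-K) - (-D) = D - K" by auto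
  ultimately show ?thesis by simp
qed

text \<open>The class of \<open>H\<^sub>n\<close> at infinity is carried by the zero set of \<open>a\<close>, which splits
  into \<open>p\<close> pieces permuted by \<open>h\<close>; all of them contribute equally to the degree of \<open>a\<close>, which is one.\<close>
lemma no_invariant_map_with_free_zero_set:
  fixes h a :: "'a::euclidean_space \<Rightarrow> 'a" and p :: nat
  assumes p: "p > 1" and ch: "continuous_on UNIV h" and hp: "h ^^ p = id"
    and bnd: "\<And>x. norm (h x - x) \<le> B"
    and ca: "continuous_on UNIV a" and inv: "\<And>x. a (h x) = a x" and abnd: "\<And>x. norm (a x - x) \<le> B"
    and D: "open D" and disj: "\<And>i j. \<lbrakk>i < p; j < p; i \<noteq> j\<rbrakk> \<Longrightarrow> (h ^^ i) ` D \<inter> (h ^^ j) ` D = {}"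
    and cov: "\<And>x. a x = 0 \<Longrightarrow> \<exists>i<p. x \<in> (h ^^ i) ` D"
  shows False
proof -
  have B0: "B \<ge> 0" using bnd[of 0] norm_ge_zero order_trans by blast
  let ?n = "int DIM('a)"
  let ?E = "euclidean :: 'a topology"
  let ?Z = "relative_homology_group ?n ?E (-{0})"
  note chi = continuous_on_funpow[OF ch]
  have ainv: "a \<circ> (h ^^ i) = a" for i
    by (induction i) (auto simp: fun_eq_iff inv)
  note bndi = funpow_displacement[of h B, OF bnd]
  have comp1: "(h ^^ i) \<circ> (h ^^ (p - i)) = id" "(h ^^ (p - i)) \<circ> (h ^^ i) = id" if "i < p" for i
    using that hp by (simp_all add: funpow_add[symmetric])
  define Di where "Di i = (h ^^ i) ` D" for i
  have Di_vim: "Di i = (h ^^ (p - i)) -` D" if "i < p" for i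
    unfolding Di_def
  proof (rule Set.set_eqI, rule iffI)
    fix x assume "x \<in> (h ^^ i) ` D"
    then obtain y where "y \<in> D" "x = (h ^^ i) y" by auto
    then show "x \<in> (h ^^ (p - i)) -` D" using fun_cong[OF comp1(2)[OF that], of y] by simp
  next
    fix x assume x: "x \<in> (h ^^ (p - i)) -` D"
    have "x = (h ^^ i) ((h ^^ (p - i)) x)" using fun_cong[OF comp1(1)[OF that], of x] by simp
    then show "x \<in> (h ^^ i) ` D" using x by blast
  qed
  have oDi: "open (Di i)" if "i < p" for i
    unfolding Di_vim[OF that] using chi D by (simp add: open_vimage continuous_on_eq_continuous_within)
  define K where "K = a -` {0}"
  have clK: "closed K"
    unfolding K_def using ca by (simp add: closed_vimage continuous_on_eq_continuous_within)
  have nK: "norm x \<le> B" if "x \<in> K" for x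
    using abnd[of x] that by (simp add: K_def)
  define Ki where "Ki i = K \<inter> Di i" for i
  have clKi: "closed (Ki i)" if "i < p" for i
  proof -
    \<comment> \<open>Disjoint open pieces covering \<open>K\<close> are also closed relative to
      \<open>K\<close>, which makes excision onto each of them possible.\<close>
    have "Ki i = K - (\<Union>j\<in>{..<p} - {i}. Di j)"
      using cov disj[OF that] that unfolding Ki_def K_def Di_def by (auto; blast)
    then show ?thesis using clK oDi by (auto intro!: closed_Diff)
  qed
  \<comment> \<open>\<open>K\<close> lies within radius \<open>B\<close> and the iterates used move
    points by at most \<open>p * B\<close>, so beyond radius \<open>R\<close> the segment from
    \<open>x\<close> to an iterate misses \<open>K\<close>, and the segment from \<open>x\<close> to
    \<open>a x\<close> misses 0.\<close>
  define R where "R = B + p * B + 1"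
  have RB: "R > B" "R > 0" using B0 by (auto simp: R_def add_nonneg_pos)
  have KL: "K \<subseteq> cball 0 R" using nK RB by force
  obtain u where u: "u \<in> carrier (relative_homology_group ?n ?E (-cball 0 R))"
    and und: "\<And>m w. \<lbrakk>(m::nat) > 1; w \<in> carrier ?Z\<rbrakk>
        \<Longrightarrow> hom_induced ?n ?E (-cball 0 R) ?E (-{0}) id u \<noteq> w [^]\<^bsub>?Z\<^esub> m"
    using top_homology_class_euclidean[where 'a = 'a, of R] RB by (metis less_imp_le)
  define z where "z i = hom_induced ?n ?E (-cball 0 R) ?E (- Ki i) id u" for i
  let ?H = "\<lambda>S. relative_homology_group ?n (top_of_set S) (S - K)"
  have e: "hom_induced ?n (top_of_set (Di i)) (Di i - K) ?E (- Ki i) id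
      \<in> Group.iso (?H (Di i)) (relative_homology_group ?n ?E (- Ki i))" if "i < p" for i
  proof -
    have "Di i - Ki i = Di i - K" by (auto simp: Ki_def)
    then show ?thesis using excision_euclidean[OF oDi[OF that] clKi[OF that], of ?n] by (simp add: Ki_def)
  qed
  have p0: "0 < p" using p by simp
  obtain v0 where v0: "v0 \<in> carrier (?H (Di 0))"
    and v0z: "hom_induced ?n (top_of_set (Di 0)) (Di 0 - K) ?E (- Ki 0) id v0 = z 0"
    by (rule iso_preimage[OF e[OF p0], of "z 0"]) (auto simp: z_def hom_induced_carrier)
  let ?a = "\<lambda>S. hom_induced ?n (top_of_set S) (S - K) ?E (-{0}) a"
  have aS: "continuous_map (top_of_set S) ?E a" "a \<in> S - K \<rightarrow> -{0}" for S
    using continuous_on_subset[OF ca] by (auto simp: K_def)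
  define w0 where "w0 = ?a (Di 0) v0"
  \<comment> \<open>Transport by \<open>h ^^ i\<close> does not change the image under the invariant
    map \<open>a\<close>. The transported class equals \<open>v\<close> by excision, since
    \<open>h ^^ i\<close> is homotopic to the identity near infinity and so carries
    \<open>z 0\<close> to \<open>z i\<close>.\<close>
  have key: "?a (Di i) v = w0" if i: "i < p" and v: "v \<in> carrier (?H (Di i))"
    and vz: "hom_induced ?n (top_of_set (Di i)) (Di i - K) ?E (- Ki i) id v = z i" for i v
  proof -
    let ?h = "h ^^ i"
    have hK: "x \<in> K \<longleftrightarrow> ?h x \<in> K" for x using fun_cong[OF ainv[of i], of x] by (simp add: K_def)
    have D0: "Di 0 = D" by (simp add: Di_def)
    have hD: "?h x \<in> Di i" if "x \<in> Di 0" for x using that by (auto simp: Di_def)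
    have hDiff: "?h \<in> Di 0 - K \<rightarrow> Di i - K" using hK hD by auto
    have hinj: "x \<in> D" if "?h x \<in> Di i" for x
      using that fun_cong[OF comp1(2)[OF i]] unfolding Di_def by (metis (no_types) comp_apply id_apply imageE)
    have hKi: "?h \<in> - Ki 0 \<rightarrow> - Ki i" using hinj hK by (auto simp: Ki_def D0)
    have cth: "continuous_map (top_of_set (Di 0)) (top_of_set (Di i)) ?h"
      using continuous_on_subset[OF chi] hD by auto
    define v' where "v' = hom_induced ?n (top_of_set (Di 0)) (Di 0 - K) (top_of_set (Di i)) (Di i - K) ?h v0"
    have v': "v' \<in> carrier (?H (Di i))" by (simp add: v'_def hom_induced_carrier)
    have "hom_induced ?n (top_of_set (Di i)) (Di i - K) ?E (- Ki i) id v'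
        = hom_induced ?n (top_of_set (Di 0)) (Di 0 - K) ?E (- Ki i) ?h v0"
      unfolding v'_def by (subst hom_induced_compose') (use cth hDiff in \<open>auto simp: Ki_def\<close>)
    also have "\<dots> = hom_induced ?n ?E (- Ki 0) ?E (- Ki i) ?h (z 0)"
      unfolding v0z[symmetric] 
      by (subst hom_induced_compose') (use hKi chi[of i] continuous_on_subset[OF chi[of i]] in \<open>auto simp: Ki_def\<close>)
    also have "\<dots> = hom_induced ?n ?E (- cball 0 R) ?E (- Ki i) ?h u"
      unfolding z_def
      by (subst hom_induced_compose') (use hKi chi[of i] KL in \<open>auto simp: Ki_def\<close>)
    also have "\<dots> = z i"
      unfolding z_def
    proof (rule fun_cong[OF hom_induced_linear_homotopy])
      fix x :: 'a and s :: real assume x: "x \<in> - cball 0 R" and s: "0 \<le> s" "s \<le> 1"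
      have eq: "(1 - s) *\<^sub>R ?h x + s *\<^sub>R id x = x + (1 - s) *\<^sub>R (?h x - x)"
        by (simp add: algebra_simps)
      have "norm ((1 - s) *\<^sub>R (?h x - x)) \<le> norm (?h x - x)"
        using s by (simp add: mult_left_le_one_le)
      also have "\<dots> \<le> i * B" by (rule bndi)
      also have "\<dots> \<le> p * B" using i B0 by (intro mult_right_mono) auto
      finally have "norm (x + (1 - s) *\<^sub>R (?h x - x)) > B"
        using norm_diff_ineq[of x "(1 - s) *\<^sub>R (?h x - x)"] x by (simp add: R_def)
      then show "(1 - s) *\<^sub>R ?h x + s *\<^sub>R id x \<in> - Ki i"
        using nK unfolding eq Ki_def by fastforce
    qed (use chi in auto)
    finally have "v = v'"
      using iso_eqD[OF e[OF i] v v'] vz by metis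
    then have "?a (Di i) v = hom_induced ?n (top_of_set (Di 0)) (Di 0 - K) ?E (-{0}) (a \<circ> ?h) v0"
      unfolding v'_def by (subst hom_induced_compose'[symmetric, OF cth hDiff aS]) simp
    then show ?thesis unfolding ainv w0_def .
  qed
  define U where "U k = (\<Union>i<k. Di i)" for k
  have oU: "open (U k)" if "k \<le> p" for k using oDi that by (auto simp: U_def)
  \<comment> \<open>Induction over the number of pieces. The class \<open>y\<close> is specified by
    its local classes \<open>z i\<close> because this description is inherited by both summands when
    the last piece is split off.\<close>
  have main: "?a (U k) y = w0 [^]\<^bsub>?Z\<^esub> k"
    if "k \<le> p" "y \<in> carrier (?H (U k))"
      "\<And>i. i < k \<Longrightarrow> hom_induced ?n (top_of_set (U k)) (U k - K) ?E (- Ki i) id y = z i" for k y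
    using that
  proof (induction k arbitrary: y)
    case 0
    have "?a (U 0) y = \<one>\<^bsub>?Z\<^esub>"
      by (rule hom_induced_into_subspace[OF _ _ _ 0(2)]) (use aS in \<open>auto simp: U_def\<close>)
    then show ?case by simp
  next
    case (Suc k)
    have k: "k < p" using Suc by simp
    let ?X = "top_of_set (U (Suc k))"
    have USuc: "U (Suc k) = U k \<union> Di k" by (auto simp: U_def lessThan_Suc)
    have UD: "U k \<inter> Di k = {}"
    proof -
      have "Di i \<inter> Di k = {}" if "i < k" for i
        unfolding Di_def using disj[of i k] that k by simp
      then show ?thesis by (auto simp: U_def)
    qed
    obtain v1 v2 where
      v1: "v1 \<in> carrier (relative_homology_group ?n (subtopology ?X (U k)) ((U (Suc k) - K) \<inter> U k))"
      and v2: "v2 \<in> carrier (relative_homology_group ?n (subtopology ?X (Di k)) ((U (Suc k) - K) \<inter> Di k))"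
      and y: "y = hom_induced ?n (subtopology ?X (U k)) ((U (Suc k) - K) \<inter> U k) ?X (U (Suc k) - K) id v1
         \<otimes>\<^bsub>?H (U (Suc k))\<^esub> hom_induced ?n (subtopology ?X (Di k)) ((U (Suc k) - K) \<inter> Di k) ?X (U (Suc k) - K) id v2"
    proof (rule relative_homology_two_open_pieces[OF _ _ UD _ _ Suc(3)])
      show "openin ?X (U k)" "openin ?X (Di k)"
        using oU[of k] oDi[OF k] k USuc by (auto simp: openin_open intro: exI[of _ "U k"] exI[of _ "Di k"])
    qed (use USuc in auto)
    have eqs: "subtopology ?X (U k) = top_of_set (U k)" "(U (Suc k) - K) \<inter> U k = U k - K"
      "subtopology ?X (Di k) = top_of_set (Di k)" "(U (Suc k) - K) \<inter> Di k = Di k - K"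
      using USuc by (auto simp: subtopology_subtopology Int_absorb1)
    note v1 = v1[unfolded eqs] and v2 = v2[unfolded eqs] and y = y[unfolded eqs]
    have im: "hom_induced ?n ?X (U (Suc k) - K) ?E T f y
        = hom_induced ?n (top_of_set (U k)) (U k - K) ?E T f v1
          \<otimes>\<^bsub>relative_homology_group ?n ?E T\<^esub> hom_induced ?n (top_of_set (Di k)) (Di k - K) ?E T f v2"
      if f: "continuous_on UNIV f" "f \<in> U (Suc k) - K \<rightarrow> T" for f T
    proof -
      have cf: "continuous_map ?X ?E f" using continuous_on_subset[OF f(1)] by auto
      have ci: "continuous_map (top_of_set (U k)) ?X id" "continuous_map (top_of_set (Di k)) ?X id"
        using USuc by (auto simp: continuous_map_in_subtopology)
      have si: "id \<in> U k - K \<rightarrow> U (Suc k) - K" "id \<in> Di k - K \<rightarrow> U (Suc k) - K" using USuc by auto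
      show ?thesis
        unfolding y
        by (subst hom_mult[OF hom_induced_hom])
           (simp_all add: hom_induced_carrier hom_induced_compose'[OF ci(1) si(1) cf f(2)] hom_induced_compose'[OF ci(2) si(2) cf f(2)])
    qed
    have v1z: "hom_induced ?n (top_of_set (U k)) (U k - K) ?E (- Ki i) id v1 = z i" if "i < k" for i
    proof -
      have "hom_induced ?n (top_of_set (Di k)) (Di k - K) ?E (- Ki i) id v2 = \<one>\<^bsub>relative_homology_group ?n ?E (- Ki i)\<^esub>"
      proof (rule hom_induced_into_subspace[OF _ _ _ v2])
        have "Di i \<inter> Di k = {}" unfolding Di_def using disj[of i k] that k by simp
        then show "id \<in> topspace (top_of_set (Di k)) \<rightarrow> - Ki i" by (auto simp: Ki_def)
      qed auto
      note one = this
      have yz: "hom_induced ?n ?X (U (Suc k) - K) ?E (- Ki i) id y = z i" by (rule Suc(4)) (use that in simp)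
      show ?thesis
        unfolding yz[symmetric]
        by (subst im)
          (simp_all only: one monoid.r_one[OF group.is_monoid[OF group_relative_homology_group] hom_induced_carrier] continuous_on_id', auto simp: Ki_def)
    qed
    have v2z: "hom_induced ?n (top_of_set (Di k)) (Di k - K) ?E (- Ki k) id v2 = z k"
    proof -
      have "hom_induced ?n (top_of_set (U k)) (U k - K) ?E (- Ki k) id v1 = \<one>\<^bsub>relative_homology_group ?n ?E (- Ki k)\<^esub>"
        by (rule hom_induced_into_subspace[OF _ _ _ v1]) (use UD in \<open>auto simp: Ki_def\<close>)
      note one = this
      have yz: "hom_induced ?n ?X (U (Suc k) - K) ?E (- Ki k) id y = z k" by (rule Suc(4)) simp
      show ?thesis
        unfolding yz[symmetric]
        by (subst im)
          (simp_all only: one monoid.l_one[OF group.is_monoid[OF group_relative_homology_group] hom_induced_carrier] continuous_on_id', auto simp: Ki_def)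
    qed
    have "?a (U (Suc k)) y = ?a (U k) v1 \<otimes>\<^bsub>?Z\<^esub> ?a (Di k) v2"
      by (rule im) (use ca in \<open>auto simp: K_def\<close>)
    also have "\<dots> = w0 [^]\<^bsub>?Z\<^esub> k \<otimes>\<^bsub>?Z\<^esub> w0"
      using Suc(1)[OF _ v1 v1z] key[OF k v2 v2z] k by simp
    finally show ?case by simp
  qed
  have KU: "K \<subseteq> U p" using cov by (fastforce simp: K_def U_def Di_def)
  have eU: "hom_induced ?n (top_of_set (U p)) (U p - K) ?E (- K) id
      \<in> Group.iso (?H (U p)) (relative_homology_group ?n ?E (- K))"
    by (rule excision_euclidean[OF oU clK KU]) simp
  obtain y where y: "y \<in> carrier (?H (U p))"
    and yz: "hom_induced ?n (top_of_set (U p)) (U p - K) ?E (- K) id y = hom_induced ?n ?E (-cball 0 R) ?E (- K) id u"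
    by (rule iso_preimage[OF eU]) (auto simp: hom_induced_carrier)
  have push: "hom_induced ?n (top_of_set (U p)) (U p - K) ?E T f y = hom_induced ?n ?E (-cball 0 R) ?E T f u"
    if f: "continuous_on UNIV f" "f \<in> - K \<rightarrow> T" for f T
  proof -
    have "hom_induced ?n (top_of_set (U p)) (U p - K) ?E T f y
        = hom_induced ?n ?E (-K) ?E T f (hom_induced ?n (top_of_set (U p)) (U p - K) ?E (- K) id y)"
      by (subst hom_induced_compose') (use f continuous_on_subset[OF f(1)] in auto)
    also have "\<dots> = hom_induced ?n ?E (-cball 0 R) ?E T f u"
      unfolding yz by (subst hom_induced_compose') (use f KL in auto)
    finally show ?thesis .
  qed
  \<comment> \<open>One class is seen as a \<open>p\<close>-th power and, through the straight
    homotopy from \<open>a\<close> to the identity near infinity, as an indivisible class.\<close>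
  have "?a (U p) y = w0 [^]\<^bsub>?Z\<^esub> p"
    by (rule main[OF _ y]) (auto intro!: push simp: z_def Ki_def)
  moreover have "?a (U p) y = hom_induced ?n ?E (-cball 0 R) ?E (-{0}) a u"
    by (rule push) (use ca in \<open>auto simp: K_def\<close>)
  moreover have "hom_induced ?n ?E (-cball 0 R) ?E (-{0}) a u = hom_induced ?n ?E (-cball 0 R) ?E (-{0}) id u"
  proof (rule fun_cong[OF hom_induced_linear_homotopy[OF ca]])
    fix x :: 'a and s :: real assume x: "x \<in> - cball 0 R" and s: "0 \<le> s" "s \<le> 1"
    have eq: "(1 - s) *\<^sub>R a x + s *\<^sub>R id x = x + (1 - s) *\<^sub>R (a x - x)"
      by (simp add: algebra_simps)
    have "norm ((1 - s) *\<^sub>R (a x - x)) \<le> norm (a x - x)"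
      using s by (simp add: mult_left_le_one_le)
    also have "\<dots> \<le> B" by (rule abnd)
    finally have *: "norm ((1 - s) *\<^sub>R (a x - x)) \<le> B" .
    have "norm x > B" using x RB by simp
    then have "norm (x + (1 - s) *\<^sub>R (a x - x)) > 0"
      using norm_diff_ineq[of x "(1 - s) *\<^sub>R (a x - x)"] * by linarith
    then show "(1 - s) *\<^sub>R a x + s *\<^sub>R id x \<in> - {0}" unfolding eq by auto
  qed auto
  ultimately show False
    using und[OF p, of w0] by (simp add: w0_def hom_induced_carrier)
qed

section \<open>Periodic maps with bounded displacement\<close>

text \<open>Prime period ensures that a point not fixed by \<open>h\<close> is fixed by no power
  \<open>h ^^ d\<close> with \<open>0 < d < p\<close>, so its orbit has exactly \<open>p\<close>
  points.\<close>

locale prime_periodic_map =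
  fixes h :: "'a::euclidean_space \<Rightarrow> 'a" and p :: nat
  assumes prime_p: "prime p" and cont_h: "continuous_on UNIV h" and h_pow: "h ^^ p = id"
begin

lemma p_gt_1: "p > 1" and p_gt_0: "p > 0"
  by (rule prime_gt_1_nat[OF prime_p], rule prime_gt_0_nat[OF prime_p])

lemmas cont_pow = continuous_on_funpow[OF cont_h]

lemma pow_mod: "(h ^^ (i mod p)) x = (h ^^ i) x"
  by (rule funpow_mod_eq) (simp add: h_pow)

lemma pow_add: "(h ^^ i) ((h ^^ j) x) = (h ^^ (i + j)) x"
  by (simp add: funpow_add)

lemma pow_inverse: "i \<le> p \<Longrightarrow> (h ^^ (p - i)) ((h ^^ i) x) = x"
  by (simp add: pow_add h_pow)

lemma fixed_of_pow_fixed: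
  assumes "(h ^^ d) x = x" "0 < d" "d < p"
  shows "h x = x"
proof -
  have "coprime d p"
    using assms prime_p by (metis coprime_commute dvd_imp_le linorder_not_le prime_imp_coprime)
  then obtain k where k: "[d * k = 1] (mod p)"
    using cong_solve_coprime_nat by auto
  have "(h ^^ (d * k)) x = x" 
    using assms(1) by (induction k) (simp_all add: funpow_add)
  moreover have "(h ^^ (d * k)) x = (h ^^ ((d * k) mod p)) x" by (simp add: pow_mod)
  moreover have "(d * k) mod p = 1" using k p_gt_1 by (simp add: cong_def)
  ultimately show ?thesis by simp
qed

lemma pow_distinct:
  assumes "h x \<noteq> x" "i < p" "j < p" "i \<noteq> j"
  shows "(h ^^ i) x \<noteq> (h ^^ j) x"
proof -
  have *: False if "(h ^^ i) x = (h ^^ j) x" "i < j" "j < p" for i j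
  proof -
    have "p - i + j = (j - i) + p" using that by simp
    then have "(h ^^ (p - i + j)) x = (h ^^ (j - i)) ((h ^^ p) x)" by (simp only: pow_add)
    then have "(h ^^ (j - i)) x = (h ^^ (p - i)) ((h ^^ j) x)" by (simp add: h_pow pow_add)
    also have "\<dots> = (h ^^ (p - i)) ((h ^^ i) x)" using that by simp
    also have "\<dots> = x" by (rule pow_inverse) (use that in simp)
    finally have "(h ^^ (j - i)) x = x" .
    moreover have "0 < j - i" "j - i < p" using that by linarith+
    ultimately show False using fixed_of_pow_fixed assms(1) by blast
  qed
  show ?thesis using *[of i j] *[of j i] assms by (metis linorder_neqE_nat)
qed

lemma closed_pow_image: "compact S \<Longrightarrow> closed ((h ^^ i) ` S)"
  by (rule compact_imp_closed[OF compact_continuous_image[OF continuous_on_subset[OF cont_pow subset_UNIV]]])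

lemma sum_over_period: "(\<Sum>i<p. f ((h ^^ i) (h x))) = (\<Sum>i<p. f ((h ^^ i) x))"
  for f :: "'a \<Rightarrow> 'b::ab_group_add"
proof -
  have "(\<Sum>i<p. f ((h ^^ i) (h x))) = (\<Sum>i<p. f ((h ^^ Suc i) x))"
    by (simp add: funpow_swap1)
  also have "\<dots> = (\<Sum>i<Suc p. f ((h ^^ i) x)) - f x"
    by (subst sum.lessThan_Suc_shift) simp
  also have "\<dots> = (\<Sum>i<p. f ((h ^^ i) x))" using h_pow by simp
  finally show ?thesis .
qed

section \<open>Sets with disjoint translates and perturbation of invariant maps\<close>

definition displaced :: "'a set \<Rightarrow> bool" where
  "displaced C \<longleftrightarrow> (\<forall>i<p. \<forall>j<p. i \<noteq> j \<longrightarrow> (h ^^ i) ` C \<inter> (h ^^ j) ` C = {})"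

lemma displaced_subset: "displaced C \<Longrightarrow> C' \<subseteq> C \<Longrightarrow> displaced C'"
  unfolding displaced_def by (meson Int_mono disjoint_iff image_mono subset_iff)

text \<open>The orbit of \<open>x\<close> consists of \<open>p\<close> distinct points, and finitely
  many iterates are continuous at \<open>x\<close>; images staying within a third of the least orbit
  distance cannot meet.\<close>

lemma displaced_cball:
  assumes "h x \<noteq> x"
  obtains r where "r > 0" "displaced (cball x r)"
proof -
  define P where "P = {(i, j). i < p \<and> j < p \<and> i \<noteq> j}"
  have fP: "finite P" by (rule finite_subset[of _ "{..<p} \<times> {..<p}"]) (auto simp: P_def)
  define s where "s = Min ((\<lambda>(i, j). dist ((h ^^ i) x) ((h ^^ j) x)) ` P) / 3"
  have neP: "(0, 1) \<in> P" using p_gt_1 by (simp add: P_def)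
  have s0: "s > 0" unfolding s_def
  proof -
    have "0 < Min ((\<lambda>(i, j). dist ((h ^^ i) x) ((h ^^ j) x)) ` P)"
    proof (subst Min_gr_iff)
      show "\<forall>d\<in>(\<lambda>(i, j). dist ((h ^^ i) x) ((h ^^ j) x)) ` P. 0 < d"
        using pow_distinct[OF assms] by (auto simp: P_def)
    qed (use fP neP in auto)
    then show "0 < Min ((\<lambda>(i, j). dist ((h ^^ i) x) ((h ^^ j) x)) ` P) / 3" by simp
  qed
  have sle: "3 * s \<le> dist ((h ^^ i) x) ((h ^^ j) x)" if "i < p" "j < p" "i \<noteq> j" for i j
    unfolding s_def using fP that by (simp, intro Min_le) (auto simp: P_def)
  have "\<forall>\<^sub>F u in nhds x. dist ((h ^^ i) u) ((h ^^ i) x) < s" for i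
    using cont_pow[of i] s0 unfolding continuous_on_iff eventually_nhds_metric by auto
  then have "\<forall>\<^sub>F u in nhds x. \<forall>i\<in>{..<p}. dist ((h ^^ i) u) ((h ^^ i) x) < s"
    by (intro eventually_ball_finite) auto
  then obtain r where r: "r > 0" "\<And>u i. dist u x < r \<Longrightarrow> i < p \<Longrightarrow> dist ((h ^^ i) u) ((h ^^ i) x) < s"
    unfolding eventually_nhds_metric by auto
  have "displaced (cball x (r/2))"
    unfolding displaced_def
  proof (intro allI impI equals0I)
    fix i j y assume ij: "i < p" "j < p" "i \<noteq> j" and "y \<in> (h ^^ i) ` cball x (r/2) \<inter> (h ^^ j) ` cball x (r/2)"
    then obtain u v where uv: "u \<in> cball x (r/2)" "v \<in> cball x (r/2)"
      and yu: "y = (h ^^ i) u" and yv: "y = (h ^^ j) v" by blast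
    have u: "dist u x < r" "y = (h ^^ i) u" and v: "dist v x < r" "y = (h ^^ j) v"
      using uv yu yv r(1) by (simp_all add: dist_commute)
    have "dist ((h ^^ i) x) ((h ^^ j) x) \<le> dist y ((h ^^ i) x) + dist y ((h ^^ j) x)"
      by (metis dist_commute dist_triangle)
    also have "\<dots> < s + s" using r(2)[OF u(1) ij(1)] r(2)[OF v(1) ij(2)] u v by auto
    finally show False using sle[OF ij] s0 by simp
  qed
  then show ?thesis using that[of "r/2"] r by simp
qed

text \<open>A polynomial approximation sends the sphere to a null set, so a small shift makes it
  miss \<open>y\<close>. The correction is prescribed on the sphere, set to zero on its other
  translates, extended by Tietze and summed over orbits: this keeps invariance, and on the sphere
  only the term with \<open>i = 0\<close> survives.\<close>

lemma perturb_off_sphere: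
  fixes a :: "'a \<Rightarrow> 'a"
  assumes ca: "continuous_on UNIV a" and inv: "\<And>x. a (h x) = a x" and e: "e > 0"
    and disp: "displaced (sphere c r)"
  obtains a' where "continuous_on UNIV a'" "\<And>x. a' (h x) = a' x" "\<And>x. norm (a' x - a x) < e"
    "y \<notin> a' ` sphere c r"
proof -
  let ?S = "sphere c r"
  \<comment> \<open>The correction sums \<open>p\<close> terms of size at most \<open>e'\<close>;
    half of each \<open>e'\<close> pays for the approximation and half for the shift.\<close>
  define e' where "e' = e / (2 * p)"
  have e': "e' > 0" using e p_gt_0 by (simp add: e'_def)
  obtain q where q: "polynomial_function q" "\<And>x. x \<in> ?S \<Longrightarrow> norm (a x - q x) < e' / 2"
    using Stone_Weierstrass_polynomial_function[where S="?S" and f=a and e="e'/2"] compact_sphere continuous_on_subset[OF ca subset_UNIV] e' by auto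
  have "negligible (q ` ?S)"
    by (rule negligible_differentiable_image_negligible)
      (simp_all add: negligible_sphere differentiable_on_polynomial_function[OF q(1)])
  moreover have "\<not> negligible (ball y (e'/2))" using e' by (intro open_not_negligible) auto
  ultimately obtain w where w: "w \<in> ball y (e'/2)" "w \<notin> q ` ?S"
    using negligible_subset by blast
  define d where "d x = q x + (y - w) - a x" for x
  have cd: "continuous_on UNIV d"
    unfolding d_def by (intro continuous_intros ca continuous_on_polymonial_function q)
  have nd: "norm (d x) \<le> e'" if "x \<in> ?S" for x
  proof -
    have "d x = - (a x - q x) + (y - w)" by (simp add: d_def)
    then have "norm (d x) \<le> norm (a x - q x) + norm (y - w)"
      by (metis norm_minus_cancel norm_triangle_ineq)
    then show ?thesis using q(2)[OF that] w by (simp add: dist_norm)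
  qed
  let ?S' = "\<Union>i\<in>{1..<p}. (h ^^ i) ` ?S"
  have clS': "closed ?S'"
    by (intro closed_UN ballI closed_pow_image compact_sphere) simp
  have dj: "?S \<inter> ?S' = {}"
    using disp p_gt_0 unfolding displaced_def by (fastforce dest: spec[of _ 0])
  let ?d = "\<lambda>x. if x \<in> ?S then d x else 0"
  have cont: "continuous_on (?S \<union> ?S') ?d"
  proof (rule continuous_on_cases)
    show "\<forall>x. x \<in> ?S \<and> x \<notin> ?S \<or> x \<in> ?S' \<and> x \<in> ?S \<longrightarrow> d x = 0" using dj by blast
  qed (use clS' in \<open>simp_all add: continuous_on_subset[OF cd subset_UNIV]\<close>)
  have cl: "closedin (top_of_set UNIV) (?S \<union> ?S')"
    using clS' by (simp add: closed_Un)
  have bd: "norm (?d x) \<le> e'" if "x \<in> ?S \<union> ?S'" for x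
    using nd[of x] e' by auto
  obtain g where cg: "continuous_on UNIV g" and g: "\<And>x. x \<in> ?S \<union> ?S' \<Longrightarrow> g x = ?d x"
    and ng': "\<And>x. x \<in> UNIV \<Longrightarrow> norm (g x) \<le> e'"
    by (rule Tietze[OF cont cl less_imp_le[OF e'] bd]) (rule that | assumption)+
  note ng = ng'[OF UNIV_I]
  define a' where "a' x = a x + (\<Sum>i<p. g ((h ^^ i) x))" for x
  show ?thesis
  proof
    show "continuous_on UNIV a'"
      unfolding a'_def by (intro continuous_intros ca continuous_on_compose2[OF cg cont_pow]) auto
    show "a' (h x) = a' x" for x by (simp only: a'_def inv sum_over_period)
    show "norm (a' x - a x) < e" for x
    proof -
      have "norm (a' x - a x) \<le> (\<Sum>i<p. e')"
        unfolding a'_def by (simp only: add_diff_cancel_left') (intro sum_norm_le ng)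
      also have "\<dots> = e / 2" using p_gt_0 by (simp add: e'_def)
      finally show ?thesis using e by simp
    qed
    show "y \<notin> a' ` ?S"
    proof
      assume "y \<in> a' ` ?S"
      then obtain x where x: "x \<in> ?S" "y = a' x" by auto
      have "(\<Sum>i<p. g ((h ^^ i) x)) = (\<Sum>i\<in>{0}. g ((h ^^ i) x))"
      proof (rule sum.mono_neutral_right)
        show "\<forall>i\<in>{..<p} - {0}. g ((h ^^ i) x) = 0"
        proof
          fix i assume i: "i \<in> {..<p} - {0}"
          have m: "(h ^^ i) x \<in> ?S'" using i x(1) by (intro UN_I[of i] imageI) auto
          then have "(h ^^ i) x \<notin> ?S" using dj by blast
          then show "g ((h ^^ i) x) = 0" using g[OF UnI2[OF m]] by simp
        qed
      qed (use p_gt_0 in auto)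
      also have "\<dots> = d x" using g[of x] x by simp
      finally have "y = q x + (y - w)" using x by (simp add: a'_def d_def)
      then show False using w x by (metis add_diff_cancel_right' diff_add_cancel add.commute diff_diff_eq2 imageI add_right_cancel)
    qed
  qed
qed

text \<open>A compact image missing \<open>y\<close> stays a positive distance
  \<open>\<delta>\<close> away, so the spheres can be treated one at a time with perturbations
  smaller than the distance already gained.\<close>

lemma perturb_off_spheres:
  fixes a :: "'a \<Rightarrow> 'a"
  assumes J: "finite J" and disp: "\<And>c r. (c, r) \<in> J \<Longrightarrow> displaced (sphere c r)"
    and ca: "continuous_on UNIV a" and inv: "\<And>x. a (h x) = a x" and e: "e > 0"
  obtains a' where "continuous_on UNIV a'" "\<And>x. a' (h x) = a' x" "\<And>x. norm (a' x - a x) < e"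
    "\<And>c r. (c, r) \<in> J \<Longrightarrow> y \<notin> a' ` sphere c r"
proof -
  have "\<exists>a'. continuous_on UNIV a' \<and> (\<forall>x. a' (h x) = a' x) \<and> (\<forall>x. norm (a' x - a x) < e)
    \<and> (\<forall>(c, r)\<in>J. y \<notin> a' ` sphere c r)"
    using J disp e
  proof (induction J arbitrary: e rule: finite_induct)
    case empty
    then show ?case using ca inv by (intro exI[of _ a]) auto
  next
    case (insert j J)
    obtain b where b: "continuous_on UNIV b" "\<And>x. b (h x) = b x" "\<And>x. norm (b x - a x) < e/2"
      and bJ: "\<And>c r. (c, r) \<in> J \<Longrightarrow> y \<notin> b ` sphere c r"
    proof -
      have "\<exists>b. continuous_on UNIV b \<and> (\<forall>x. b (h x) = b x) \<and> (\<forall>x. norm (b x - a x) < e/2)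
          \<and> (\<forall>(c, r)\<in>J. y \<notin> b ` sphere c r)"
        by (rule insert.IH) (use insert.prems in auto)
      then show ?thesis using that by blast
    qed
    obtain c r where j: "j = (c, r)" by force
    let ?K = "\<Union>(c, r)\<in>J. b ` sphere c r"
    have clK: "closed ?K"
    proof (intro closed_UN insert.hyps ballI)
      fix x assume "x \<in> J"
      have "closed (b ` sphere (fst x) (snd x))"
        by (intro compact_imp_closed compact_continuous_image continuous_on_subset[OF b(1)]) auto
      then show "closed (case x of (c, r) \<Rightarrow> b ` sphere c r)" by (simp add: case_prod_unfold)
    qed
    have yK: "y \<notin> ?K" using bJ by auto
    obtain \<delta> where \<delta>: "\<delta> > 0" "\<forall>z\<in>?K. \<delta> \<le> dist y z"
      using separate_point_closed[OF clK yK] by blast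
    obtain a' where a': "continuous_on UNIV a'" "\<And>x. a' (h x) = a' x" "\<And>x. norm (a' x - b x) < min (e/2) \<delta>"
      "y \<notin> a' ` sphere c r"
      using perturb_off_sphere[OF b(1,2), of "min (e/2) \<delta>" c r y] insert.prems \<delta>(1) j by auto
    have "norm (a' x - a x) < e" for x
      using norm_triangle_ineq[of "a' x - b x" "b x - a x"] a'(3)[of x] b(3)[of x] by simp
    moreover have "y \<notin> a' ` sphere c' r'" if "(c', r') \<in> J" for c' r'
    proof
      assume "y \<in> a' ` sphere c' r'"
      then obtain x where x: "x \<in> sphere c' r'" "y = a' x" by auto
      have "b x \<in> ?K" using that x(1) by (intro UN_I[of "(c', r')"]) auto
      then have "\<delta> \<le> dist y (b x)" using \<delta>(2) by blast
      then show False using a'(3)[of x] x by (simp add: dist_norm)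
    qed
    ultimately show ?case using a' j by (intro exI[of _ a']) auto
  qed
  then show ?thesis using that by blast
qed

text \<open>The average \<open>a\<close> of the iterates is invariant and fixes the fixed points of \<open>h\<close>, so \<open>h\<close> acts freely near the
  preimage of a small ball around a non-fixed point \<open>y\<close>. Cover this preimage by balls disjoint from their translates. Once
  \<open>a\<close> is perturbed so that \<open>y\<close> is not in the image of the bounding spheres, the preimage of \<open>y\<close> splits into pieces permuted by
  \<open>h\<close>; a sphere is mapped off \<open>y\<close> because its image under a polynomial map is negligible.\<close>
theorem bounded_displacement_imp_id:
  assumes bnd: "\<And>x. norm (h x - x) \<le> B"
  shows "h = id"
proof (rule ccontr)
  assume "h \<noteq> id"
  then obtain y where y: "h y \<noteq> y" by (auto simp: fun_eq_iff)
  have B0: "B \<ge> 0" using bnd[of 0] norm_ge_zero order_trans by blast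
  define a where "a x = (1 / p) *\<^sub>R (\<Sum>i<p. (h ^^ i) x)" for x
  have ca: "continuous_on UNIV a" unfolding a_def by (intro continuous_intros cont_pow)
  have inva: "a (h x) = a x" for x
    using sum_over_period[of "\<lambda>y. y" x] by (simp only: a_def)
  have afix: "a x = x" if "h x = x" for x
  proof -
    have "(h ^^ i) x = x" for i by (induction i) (simp_all add: that)
    then show ?thesis using p_gt_0 by (simp add: a_def sum_constant_scaleR)
  qed
  note bndi = funpow_displacement[of h B, OF bnd]
  have abnd: "norm (a x - x) \<le> p * B" for x
  proof -
    have "a x - x = (1 / p) *\<^sub>R (\<Sum>i<p. (h ^^ i) x - x)"
      using p_gt_0 by (simp add: a_def sum_subtractf sum_constant_scaleR algebra_simps)
    then have "norm (a x - x) = (1 / p) * norm (\<Sum>i<p. (h ^^ i) x - x)" by simp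
    also have "\<dots> \<le> (1 / p) * (\<Sum>i<p. p * B)"
    proof (intro mult_left_mono sum_norm_le)
      fix i assume "i \<in> {..<p}"
      then have "i * B \<le> p * B" using B0 by (intro mult_right_mono) auto
      then show "norm ((h ^^ i) x - x) \<le> p * B" using bndi[of i x] by simp
    qed simp
    finally show ?thesis using p_gt_0 by simp
  qed
  define F where "F = {x. h x = x}"
  have "closed F" unfolding F_def by (intro closed_Collect_eq cont_h continuous_intros)
  moreover have "y \<notin> F" using y by (simp add: F_def)
  ultimately obtain e where e: "e > 0" "\<And>x. x \<in> F \<Longrightarrow> e \<le> dist y x"
    using separate_point_closed[of F y] by auto
  define K where "K = a -` cball y (e/2)"
  have Kfree: "h x \<noteq> x" if "x \<in> K" for x
    using afix[of x] that e(2)[of x] e(1) by (auto simp: K_def F_def)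
  have "closed K" unfolding K_def using ca by (simp add: closed_vimage continuous_on_eq_continuous_within)
  moreover have "bounded K"
    unfolding bounded_iff
  proof (intro exI ballI)
    fix x assume "x \<in> K"
    then have "norm (a x - y) \<le> e/2" by (simp add: K_def dist_norm norm_minus_commute)
    then show "norm x \<le> norm y + e/2 + p * B"
      using abnd[of x] norm_triangle_ineq[of "a x - y" y] norm_triangle_ineq4[of "a x" "a x - x"] by simp
  qed
  ultimately have cK: "compact K" by (simp add: compact_eq_bounded_closed)
  have "\<exists>r. r > 0 \<and> displaced (cball x r)" if "x \<in> K" for x
    using displaced_cball[OF Kfree[OF that]] by blast
  then obtain r where r: "\<And>x. x \<in> K \<Longrightarrow> r x > 0 \<and> displaced (cball x (r x))" by metis
  obtain C where C: "C \<subseteq> K" "finite C" "K \<subseteq> (\<Union>x\<in>C. ball x (r x))"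
  proof (rule compactE_image[OF cK, of K "\<lambda>x. ball x (r x)"])
    show "K \<subseteq> (\<Union>x\<in>K. ball x (r x))"
    proof
      fix x assume "x \<in> K"
      then show "x \<in> (\<Union>x\<in>K. ball x (r x))" using r[of x] by (intro UN_I[of x]) simp_all
    qed
    fix C assume "C \<subseteq> K" "finite C" "K \<subseteq> (\<Union>x\<in>C. ball x (r x))"
    then show thesis by (rule that)
  qed (rule open_ball)
  have fin: "finite ((\<lambda>x. (x, r x)) ` C)" using C(2) by simp
  have disp: "displaced (sphere c s)" if "(c, s) \<in> (\<lambda>x. (x, r x)) ` C" for c s
  proof -
    have cs: "c \<in> K" "s = r c" using that C(1) by auto
    show ?thesis
      unfolding cs(2) by (rule displaced_subset[OF conjunct2[OF r[OF cs(1)]] sphere_cball])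
  qed
  have e2: "0 < e/2" using e(1) by simp
  obtain a' where a': "continuous_on UNIV a'" "\<And>x. a' (h x) = a' x" "\<And>x. norm (a' x - a x) < e/2"
    and off0: "\<And>c s. (c, s) \<in> (\<lambda>x. (x, r x)) ` C \<Longrightarrow> y \<notin> a' ` sphere c s"
    by (rule perturb_off_spheres[OF fin disp ca inva e2, where y = y]) (rule that | assumption)+
  have ainvi: "a' ((h ^^ i) x) = a' x" for i x by (induction i) (auto simp: a'(2))
  obtain c where c: "bij_betw c {..<card C} C"
    using ex_bij_betw_nat_finite[OF C(2)] by (metis atLeast0LessThan)
  let ?m = "card C"
  have cC: "c j \<in> C" if "j < ?m" for j using c that by (auto simp: bij_betw_def)
  define V where "V j = ball (c j) (r (c j))" for j
  define W where "W j = cball (c j) (r (c j))" for j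
  have VW: "V j \<subseteq> W j" for j by (auto simp: V_def W_def)
  have dW: "displaced (W j)" if "j < ?m" for j using r cC[OF that] C(1) by (auto simp: W_def)
  \<comment> \<open>This is the gain from the perturbation: over \<open>y\<close> the closed and
    open balls agree, so subtracting closed sets below loses no orbit of preimages of
    \<open>y\<close>.\<close>
  have off: "x \<in> V j" if "x \<in> W j" "j < ?m" "a' x = y" for x j
    using off0[of "c j" "r (c j)"] cC[OF that(2)] that by (force simp: V_def W_def)
  \<comment> \<open>Removing all translates of the earlier closed balls keeps \<open>E j\<close>
    open and separates pieces of different index under all powers of \<open>h\<close>; within one
    index \<open>displaced\<close> does this.\<close>
  define E where "E j = V j - (\<Union>l<j. \<Union>i<p. (h ^^ i) ` W l)" for j
  define D where "D = (\<Union>j<?m. E j)"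
  have "open D"
    unfolding D_def E_def
    by (intro open_UN ballI open_Diff closed_UN closed_pow_image) (simp_all add: V_def W_def)
  have disjoint: "(h ^^ i) ` D \<inter> (h ^^ i') ` D = {}" if i: "i < p" "i' < p" "i \<noteq> i'" for i i'
  proof (rule equals0I)
    have less: False if "u \<in> E j" "v \<in> E l" "(h ^^ i) u = (h ^^ i') v" "l < j" "i < p" for u v j l i i'
    proof -
      have "u = (h ^^ (p - i)) ((h ^^ i') v)" using that pow_inverse[of i u] by simp
      then have "u = (h ^^ ((p - i + i') mod p)) v" by (simp add: pow_add pow_mod)
      moreover have "v \<in> W l" using that VW by (auto simp: E_def)
      moreover have "(p - i + i') mod p < p" using p_gt_0 by simp
      ultimately show False using that unfolding E_def by blast
    qed
    fix x assume "x \<in> (h ^^ i) ` D \<inter> (h ^^ i') ` D"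
    then obtain u v j l where u: "u \<in> E j" "x = (h ^^ i) u" "j < ?m" and v: "v \<in> E l" "x = (h ^^ i') v" "l < ?m"
      by (auto simp: D_def)
    consider "l < j" | "j < l" | "j = l" by linarith
    then show False
    proof cases
      case 3
      then have "u \<in> W j" "v \<in> W j" using u(1) v(1) VW by (auto simp: E_def)
      then have "x \<in> (h ^^ i) ` W j \<inter> (h ^^ i') ` W j" using u(2) v(2) by blast
      then show False using dW[OF u(3)] i unfolding displaced_def by blast
    qed (use less[of u j v l i i'] less[of v l u j i' i] u v i in auto)
  qed
  have cover: "\<exists>i<p. x \<in> (h ^^ i) ` D" if "a' x = y" for x
  proof -
    have "x \<in> K" using a'(3)[of x] that by (simp add: K_def dist_norm)
    then obtain x' where "x' \<in> C" "x \<in> ball x' (r x')" using C(3) by auto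
    then have "x' \<in> c ` {..<?m}" using c by (simp add: bij_betw_def)
    then obtain j0 where "j0 < ?m" "x' = c j0" by auto
    then have "x \<in> (h ^^ 0) ` V j0" using \<open>x \<in> ball x' (r x')\<close> by (simp add: V_def)
    \<comment> \<open>The least index of a ball met by the orbit of \<open>x\<close> is the piece
      from which nothing of this orbit was removed.\<close>
    define P where "P l \<longleftrightarrow> l < ?m \<and> (\<exists>i<p. x \<in> (h ^^ i) ` V l)" for l
    have "P j0" unfolding P_def using \<open>j0 < ?m\<close> \<open>x \<in> (h ^^ 0) ` V j0\<close> p_gt_0 by blast
    then obtain j where Pj: "P j" and Pmin: "\<And>l. l < j \<Longrightarrow> \<not> P l"
      using exists_least_iff[of P] by blast
    have j: "j < ?m \<and> (\<exists>i<p. x \<in> (h ^^ i) ` V j)" using Pj by (simp add: P_def)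
    have jmin: "\<not> (l < ?m \<and> (\<exists>i<p. x \<in> (h ^^ i) ` V l))" if "l < j" for l
      using Pmin[OF that] by (simp add: P_def)
    from j obtain i u where i: "i < p" and u: "u \<in> V j" "x = (h ^^ i) u" by auto
    have au: "a' u = y" using that u ainvi by simp
    have "u \<in> E j"
      unfolding E_def
    proof (intro DiffI u(1) notI)
      assume "u \<in> (\<Union>l<j. \<Union>i<p. (h ^^ i) ` W l)"
      then obtain l k w where l: "l < j" "w \<in> W l" "u = (h ^^ k) w" by auto
      have "w \<in> V l" using off[OF l(2)] l j au ainvi by auto
      moreover have "x = (h ^^ ((i + k) mod p)) w" using u l by (simp add: pow_add pow_mod)
      moreover have "(i + k) mod p < p" using p_gt_0 by simp
      ultimately show False using jmin[OF l(1)] l(1) j by (meson image_eqI less_trans)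
    qed
    then show ?thesis using i u j by (auto simp: D_def)
  qed
  show False
  proof (rule no_invariant_map_with_free_zero_set[of p h "p * B + e + norm y" "\<lambda>x. a' x - y" D])
    show "continuous_on UNIV (\<lambda>x. a' x - y)" by (intro continuous_intros a')
    show "norm (h x - x) \<le> p * B + e + norm y" for x
    proof -
      have "1 * B \<le> p * B" using B0 p_gt_0 by (intro mult_right_mono) auto
      then show ?thesis using bnd[of x] e(1) norm_ge_zero[of y] by linarith
    qed
    show "norm (a' x - y - x) \<le> p * B + e + norm y" for x
    proof -
      have "norm (a' x - y - x) \<le> norm (a' x - x) + norm y"
        using norm_triangle_ineq4[of "a' x - x" y] by (simp add: algebra_simps)
      moreover have "norm (a' x - x) \<le> norm (a' x - a x) + norm (a x - x)"
        using norm_triangle_ineq[of "a' x - a x" "a x - x"] by simp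
      ultimately show ?thesis using a'(3)[of x] abnd[of x] e(1) by linarith
    qed
    show "a' (h x) - y = a' x - y" for x by (simp add: a'(2))
    show "\<exists>i<p. x \<in> (h ^^ i) ` D" if "a' x - y = 0" for x using cover[of x] that by simp
  qed (rule p_gt_1 cont_h h_pow \<open>open D\<close> disjoint; assumption)+
qed

end

text \<open>Descent on the period: for a prime \<open>p\<close> dividing \<open>m = k * p\<close>,
  the map \<open>h ^^ k\<close> has period \<open>p\<close> and still bounded displacement, hence is
  the identity, and \<open>k\<close> replaces \<open>m\<close>.\<close>

theorem periodic_bounded_displacement_imp_id:
  fixes h :: "'a::euclidean_space \<Rightarrow> 'a"
  assumes "continuous_on UNIV h" "m > 0" "h ^^ m = id" and bnd: "\<And>x. norm (h x - x) \<le> B"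
  shows "h = id"
  using assms(2,3)
proof (induction m rule: less_induct)
  case (less m)
  show ?case
  proof (cases "m = 1")
    case False
    then obtain p where p: "prime p" "p dvd m" using prime_factor_nat by blast
    then obtain k where k: "m = k * p" by (metis dvd_div_mult_self)
    have k0: "k > 0" using less.prems k by simp
    have "k < m" using k k0 prime_gt_1_nat[OF p(1)] by simp
    note cont = continuous_on_funpow[OF assms(1)]
    note bndi = funpow_displacement[of h B, OF bnd]
    have "(h ^^ k) ^^ p = id" using less.prems(2) unfolding k funpow_mult .
    then have "prime_periodic_map (h ^^ k) p"
      by unfold_locales (rule p(1), rule cont)
    then have "h ^^ k = id"
      using bndi by (rule prime_periodic_map.bounded_displacement_imp_id)
    then show ?thesis using less.IH[OF \<open>k < m\<close> k0] by simp
  qed (use less.prems in simp)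
qed

section \<open>The covering by Euclidean space\<close>

lemma isom_apply_mult:
  "isom_apply (g \<otimes>\<^bsub>Isom\<^esub> h) x = isom_apply g (isom_apply h x)"
  by (cases g; cases h) (simp add: isom_apply_def matrix_vector_right_distrib matrix_vector_mul_assoc add.assoc)

lemma isom_apply_one: "isom_apply \<one>\<^bsub>Isom\<^esub> x = x" "isom_apply (mat 1, t) x = x + t"
  by (simp_all add: isom_apply_def)

lemma dist_isom_apply:
  fixes g :: "(real^'n^'n) \<times> (real^'n)"
  assumes "g \<in> carrier Isom" shows "dist (isom_apply g x) (isom_apply g y) = dist x y"
proof -
  have "orthogonal_matrix (fst g)" using assms by auto
  then show ?thesis
    by (simp add: isom_apply_def dist_norm matrix_vector_mult_diff_distrib[symmetric])
qed

lemma continuous_on_isom_apply [continuous_intros]: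
  "continuous_on S f \<Longrightarrow> continuous_on S (\<lambda>x. isom_apply g (f x :: real^'n))"
  unfolding isom_apply_def
  by (intro continuous_intros continuous_on_compose2[OF linear_continuous_on[OF matrix_vector_mul_bounded_linear[of "fst g"], of UNIV]]) auto

lemma isom_apply_inject: "isom_apply g = isom_apply h \<longleftrightarrow> g = h"
  for g h :: "(real^'n^'n) \<times> (real^'n)"
proof
  assume eq: "isom_apply g = isom_apply h"
  have s: "snd g = snd h" using fun_cong[OF eq, of 0] by (simp add: isom_apply_def)
  have "fst g *v x = fst h *v x" for x using fun_cong[OF eq, of x] s by (simp add: isom_apply_def)
  then have "fst g = fst h" by (simp add: matrix_eq)
  then show "g = h" using s by (rule prod_eqI)
qed simp

section \<open>Proper and free action, and the covering map\<close>

context crystallographic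
begin

lemma pi_Isom: "g \<in> \<pi> \<Longrightarrow> g \<in> carrier Isom"
  using subgroup.subset[OF subgroup_pi] by blast

lemma pi_mult: "g \<in> \<pi> \<Longrightarrow> h \<in> \<pi> \<Longrightarrow> g \<otimes>\<^bsub>Isom\<^esub> h \<in> \<pi>"
  by (rule subgroup.m_closed[OF subgroup_pi])

lemma pi_inv: "g \<in> \<pi> \<Longrightarrow> inv\<^bsub>Isom\<^esub> g \<in> \<pi>"
  by (rule subgroup.m_inv_closed[OF subgroup_pi])

lemma pi_one: "\<one>\<^bsub>Isom\<^esub> \<in> \<pi>"
  by (rule subgroup.one_closed[OF subgroup_pi])

lemma pi_pow: "g \<in> \<pi> \<Longrightarrow> g [^]\<^bsub>Isom\<^esub> (k::nat) \<in> \<pi>"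
  by (induction k) (simp_all only: nat_pow_0 nat_pow_Suc pi_one pi_mult)

lemma act_inv: "g \<in> \<pi> \<Longrightarrow> isom_apply (inv\<^bsub>Isom\<^esub> g) (isom_apply g x) = x"
  "g \<in> \<pi> \<Longrightarrow> isom_apply g (isom_apply (inv\<^bsub>Isom\<^esub> g) x) = x"
  using group.l_inv[OF group_Isom pi_Isom, of g] group.r_inv[OF group_Isom pi_Isom, of g]
  by (simp_all only: isom_apply_mult[symmetric] isom_apply_one)

lemma act_pow: "isom_apply (g [^]\<^bsub>Isom\<^esub> (k::nat)) = isom_apply g ^^ k"
proof (induction k)
  case 0
  show ?case by (rule ext) (simp only: nat_pow_0 isom_apply_one funpow_0)
next
  case (Suc k)
  show ?case by (rule ext) (simp only: nat_pow_Suc isom_apply_mult Suc funpow_Suc_right comp_apply)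
qed

text \<open>Properness of the action: linear parts preserve norms, so a bound on the image of
  \<open>x\<close> bounds the translation part and \<open>finite_bounded\<close> applies.\<close>

lemma finite_moves: "finite {g \<in> \<pi>. dist (isom_apply g x) y \<le> R}"
proof (rule finite_subset[OF _ finite_bounded[of "R + norm y + norm x"]], clarify)
  fix A a assume g: "(A, a) \<in> \<pi>" and d: "dist (isom_apply (A, a) x) y \<le> R"
  have "a = (isom_apply (A, a) x - y) + y - A *v x" by (simp add: isom_apply_def)
  then have "norm a \<le> norm ((isom_apply (A, a) x - y) + y) + norm (A *v x)" by (metis norm_triangle_ineq4)
  also have "\<dots> \<le> norm (isom_apply (A, a) x - y) + norm y + norm x"
    using norm_orthogonal[OF orth[OF g], of x] norm_triangle_ineq[of "isom_apply (A, a) x - y" y] by simp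
  finally show "norm (snd (A, a)) \<le> R + norm y + norm x" using d by (simp add: dist_norm)
qed

text \<open>All powers of \<open>g\<close> fix \<open>x\<close>; by properness two of them coincide,
  so \<open>g\<close> has finite order and torsion-freeness applies.\<close>

lemma free_action:
  assumes g: "g \<in> \<pi>" and fixed: "isom_apply g x = x"
  shows "g = \<one>\<^bsub>Isom\<^esub>"
proof -
  have fix_pow: "isom_apply (g [^]\<^bsub>Isom\<^esub> (k::nat)) x = x" for k
    unfolding act_pow by (induction k) (simp_all add: fixed)
  have "range (\<lambda>k::nat. g [^]\<^bsub>Isom\<^esub> k) \<subseteq> {h \<in> \<pi>. dist (isom_apply h x) x \<le> 0}"
    using pi_pow[OF g] fix_pow by auto
  then have "finite (range (\<lambda>k::nat. g [^]\<^bsub>Isom\<^esub> k))" by (rule finite_subset[OF _ finite_moves])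
  then have "\<not> inj (\<lambda>k::nat. g [^]\<^bsub>Isom\<^esub> k)" using finite_imageD infinite_UNIV_nat by blast
  then obtain k l :: nat where kl: "k < l" "g [^]\<^bsub>Isom\<^esub> k = g [^]\<^bsub>Isom\<^esub> l"
    unfolding inj_def by (metis linorder_neqE_nat)
  have "isom_apply g ^^ (l - k) = id"
  proof
    fix y
    define w where "w = isom_apply (inv\<^bsub>Isom\<^esub> (g [^]\<^bsub>Isom\<^esub> k)) y"
    have w: "(isom_apply g ^^ k) w = y"
      unfolding w_def act_pow[symmetric] by (rule act_inv(2)[OF pi_pow[OF g]])
    have "(isom_apply g ^^ (l - k)) ((isom_apply g ^^ k) w) = (isom_apply g ^^ l) w"
      using kl(1) by (simp add: funpow_add[symmetric, THEN fun_cong, unfolded comp_apply])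
    also have "\<dots> = (isom_apply g ^^ k) w" by (simp only: act_pow[symmetric] kl(2))
    finally show "(isom_apply g ^^ (l - k)) y = id y" by (simp add: w)
  qed
  then have "isom_apply (g [^]\<^bsub>Isom\<^esub> (l - k)) = isom_apply \<one>\<^bsub>Isom\<^esub>"
    unfolding act_pow by (simp add: fun_eq_iff isom_apply_one(1) del: Isom_simps)
  then have "g [^]\<^bsub>Isom\<^esub> (l - k) = \<one>\<^bsub>Isom\<^esub>" by (simp only: isom_apply_inject)
  then show ?thesis by (rule torsion_free[OF g, rotated]) (use kl in simp)
qed

lemma act_eq_imp_eq:
  assumes "g \<in> \<pi>" "h \<in> \<pi>" "isom_apply g x = isom_apply h x"
  shows "g = h"
proof -
  have "isom_apply (inv\<^bsub>Isom\<^esub> h \<otimes>\<^bsub>Isom\<^esub> g) x = x"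
    using act_inv(1)[OF assms(2)] by (simp only: isom_apply_mult assms(3))
  then have "inv\<^bsub>Isom\<^esub> h \<otimes>\<^bsub>Isom\<^esub> g = \<one>\<^bsub>Isom\<^esub>"
    by (rule free_action[OF pi_mult[OF pi_inv[OF assms(2)] assms(1)]])
  then have "isom_apply (inv\<^bsub>Isom\<^esub> h) (isom_apply g y) = y" for y
    by (metis isom_apply_mult isom_apply_one(1))
  then have "isom_apply g y = isom_apply h y" for y
    using act_inv(2)[OF assms(2), of "isom_apply g y"] by simp
  then show ?thesis unfolding isom_apply_inject[symmetric] by (rule ext)
qed

text \<open>Only finitely many elements move \<open>x\<close> by at most 1, and by freeness all but
  the identity move it by a positive amount. Isometry carries the least of these amounts to every
  pair of orbit points.\<close>

lemma separated:
  obtains r where "r > 0" "\<And>g h. g \<in> \<pi> \<Longrightarrow> h \<in> \<pi> \<Longrightarrow> dist (isom_apply g x) (isom_apply h x) < r \<Longrightarrow> g = h"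
proof -
  let ?F = "{g \<in> \<pi>. dist (isom_apply g x) x \<le> 1} - {\<one>\<^bsub>Isom\<^esub>}"
  have fin: "finite ((\<lambda>g. dist (isom_apply g x) x) ` ?F)" using finite_moves by simp
  define r where "r = Min (insert 1 ((\<lambda>g. dist (isom_apply g x) x) ` ?F))"
  have "0 < d" if "d \<in> insert 1 ((\<lambda>g. dist (isom_apply g x) x) ` ?F)" for d
    using that free_action[of _ x] by (auto simp del: Isom_simps)
  then have r0: "r > 0" unfolding r_def using fin by (subst Min_gr_iff) auto
  have r1: "g = \<one>\<^bsub>Isom\<^esub>" if "g \<in> \<pi>" "dist (isom_apply g x) x < r" for g
  proof (rule ccontr)
    assume "g \<noteq> \<one>\<^bsub>Isom\<^esub>"
    moreover have "r \<le> 1" unfolding r_def using fin by (intro Min_le) auto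
    ultimately have "dist (isom_apply g x) x \<in> (\<lambda>g. dist (isom_apply g x) x) ` ?F" using that by auto
    then have "r \<le> dist (isom_apply g x) x" unfolding r_def using fin by (intro Min_le) auto
    then show False using that by simp
  qed
  have "g = h" if "g \<in> \<pi>" "h \<in> \<pi>" "dist (isom_apply g x) (isom_apply h x) < r" for g h
  proof -
    have "dist (isom_apply (inv\<^bsub>Isom\<^esub> h \<otimes>\<^bsub>Isom\<^esub> g) x) x = dist (isom_apply g x) (isom_apply h x)"
      using dist_isom_apply[OF pi_Isom[OF pi_inv[OF that(2)]], of "isom_apply g x" "isom_apply h x"]
      by (simp only: isom_apply_mult act_inv(1)[OF that(2)])
    then have "inv\<^bsub>Isom\<^esub> h \<otimes>\<^bsub>Isom\<^esub> g = \<one>\<^bsub>Isom\<^esub>"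
      using r1[OF pi_mult[OF pi_inv[OF that(2)] that(1)]] that(3) by simp
    then have "isom_apply g x = isom_apply h x"
      using act_inv(2)[OF that(2), of "isom_apply g x"] by (metis isom_apply_mult isom_apply_one(1))
    then show ?thesis by (rule act_eq_imp_eq[OF that(1,2)])
  qed
  then show ?thesis by (rule that[OF r0])
qed

definition orbit :: "real^'n \<Rightarrow> (real^'n) set" where
  "orbit x = (\<lambda>g. isom_apply g x) ` \<pi>"

lemma orbit_self: "x \<in> orbit x"
  unfolding orbit_def using pi_one isom_apply_one(1)[of x] by (metis image_eqI)

lemma orbit_nonempty: "orbit x \<noteq> {}"
  using orbit_self by blast

lemma orbit_act: assumes "g \<in> \<pi>" shows "orbit (isom_apply g x) = orbit x"
proof -
  have "(\<lambda>h. isom_apply h (isom_apply g x)) ` \<pi> \<subseteq> (\<lambda>h. isom_apply h x) ` \<pi>" if "g \<in> \<pi>" for g x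
    using pi_mult[OF _ that] isom_apply_mult[of _ g x] by (metis (no_types, lifting) image_eqI image_subsetI)
  from this[OF assms, of x] this[OF pi_inv[OF assms], of "isom_apply g x"] show ?thesis
    unfolding orbit_def act_inv(1)[OF assms] by blast
qed

lemma closed_orbit: "closed (orbit x)"
proof -
  obtain r where r: "r > 0" "\<And>g h. g \<in> \<pi> \<Longrightarrow> h \<in> \<pi> \<Longrightarrow> dist (isom_apply g x) (isom_apply h x) < r \<Longrightarrow> g = h"
    by (rule separated, rule that)
  show ?thesis
  proof (rule discrete_imp_closed[OF r(1)], intro ballI impI)
    fix y z assume "y \<in> orbit x" "z \<in> orbit x" "dist z y < r"
    then show "z = y" unfolding orbit_def using r(2) by blast
  qed
qed

lemma orbit_infdist_less:
  assumes "infdist y (orbit x) < r"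
  obtains g where "g \<in> \<pi>" "dist y (isom_apply g x) < r"
proof -
  have "\<exists>z\<in>orbit x. dist y z < r"
    using assms orbit_nonempty[of x] unfolding infdist_def
    by (subst (asm) if_not_P, simp, subst (asm) cINF_less_iff) auto
  then show ?thesis unfolding orbit_def using that by blast
qed

text \<open>Cocompactness bounds the distance to an orbit, so that these distance functions are
  bounded and \<open>proj\<close> can take values in the bounded continuous functions.\<close>

lemma infdist_orbit_bound: obtains d where "\<And>x y. infdist y (orbit x) \<le> norm x + d"
proof -
  obtain d where d: "\<And>x. \<exists>(A, a)\<in>\<pi>. norm (a - x) \<le> d" by (rule coarsely_dense, rule that)
  have "infdist y (orbit x) \<le> norm x + d" for x y
  proof -
    obtain A a where Aa: "(A, a) \<in> \<pi>" "norm (a - y) \<le> d" using d[of y] by blast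
    have "isom_apply (A, a) x \<in> orbit x" unfolding orbit_def using Aa(1) by (rule imageI)
    then have "infdist y (orbit x) \<le> dist y (isom_apply (A, a) x)" by (rule infdist_le)
    also have "\<dots> = norm (A *v x + (a - y))"
      unfolding isom_apply_def dist_norm by (subst norm_minus_commute) (simp add: algebra_simps)
    also have "\<dots> \<le> norm x + d"
      using norm_triangle_ineq[of "A *v x" "a - y"] Aa(2) norm_orthogonal[OF orth[OF Aa(1)], of x] by simp
    finally show ?thesis .
  qed
  then show ?thesis by (rule that)
qed

text \<open>The covering projection, with the quotient space realised as a subspace of a normed space.\<close>
definition proj :: "real^'n \<Rightarrow> ((real^'n) \<Rightarrow>\<^sub>C real)" where
  "proj x = Bcontfun (\<lambda>y. infdist y (orbit x))"

lemma proj_apply: "apply_bcontfun (proj x) y = infdist y (orbit x)"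
proof -
  obtain d where d: "\<And>x y. infdist y (orbit x) \<le> norm x + d" by (rule infdist_orbit_bound, rule that)
  have "bounded (range (\<lambda>y. infdist y (orbit x)))"
    unfolding bounded_iff using d[of _ x] by (intro exI[of _ "norm x + d"]) (simp add: infdist_nonneg)
  then have "(\<lambda>y. infdist y (orbit x)) \<in> bcontfun"
    unfolding bcontfun_def by (auto intro: continuous_on_infdist continuous_on_id)
  then show ?thesis unfolding proj_def by (simp add: Bcontfun_inverse)
qed

lemma proj_eq_iff: "proj x = proj y \<longleftrightarrow> (\<exists>g\<in>\<pi>. isom_apply g x = y)"
proof
  assume "proj x = proj y"
  then have "infdist y (orbit x) = infdist y (orbit y)" by (metis proj_apply)
  then have "infdist y (orbit x) = 0" using orbit_self by simp
  then have "y \<in> orbit x" using in_closed_iff_infdist_zero[OF closed_orbit orbit_nonempty] by blast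
  then show "\<exists>g\<in>\<pi>. isom_apply g x = y" by (auto simp: orbit_def)
next
  assume "\<exists>g\<in>\<pi>. isom_apply g x = y"
  then obtain g where "g \<in> \<pi>" "isom_apply g x = y" by blast
  then have "orbit y = orbit x" using orbit_act by blast
  then show "proj x = proj y" by (simp add: proj_def)
qed

lemma dist_proj_le: "dist (proj x) (proj y) \<le> dist x y"
proof (rule dist_bound)
  have *: "infdist z (orbit x) \<le> infdist z (orbit y) + dist x y" for x y z
  proof (rule field_le_epsilon)
    fix e :: real assume "e > 0"
    then obtain g where g: "g \<in> \<pi>" "dist z (isom_apply g y) < infdist z (orbit y) + e"
      using orbit_infdist_less[of z y "infdist z (orbit y) + e"] by auto
    have "isom_apply g x \<in> orbit x" unfolding orbit_def using g(1) by (rule imageI)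
    then have "infdist z (orbit x) \<le> dist z (isom_apply g x)" by (rule infdist_le)
    also have "\<dots> \<le> dist z (isom_apply g y) + dist (isom_apply g x) (isom_apply g y)"
      by (rule dist_triangle2)
    finally show "infdist z (orbit x) \<le> infdist z (orbit y) + dist x y + e"
      using g(2) dist_isom_apply[OF pi_Isom[OF g(1)], of x y] by simp
  qed
  show "dist (apply_bcontfun (proj x) z) (apply_bcontfun (proj y) z) \<le> dist x y" for z
    using *[of z x y] *[of z y x] by (simp add: proj_apply dist_real_def dist_commute abs_le_iff)
qed

lemma continuous_proj: "continuous_on S proj"
  unfolding continuous_on_iff using dist_proj_le by (meson le_less_trans)

text \<open>Evaluated at \<open>y\<close>, the two distance functions differ by the distance from
  \<open>y\<close> to the orbit of \<open>x\<close>; within \<open>r/4\<close> of \<open>c\<close>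
  no orbit point is closer to \<open>y\<close> than \<open>x\<close> itself.\<close>

lemma proj_local_isometry:
  assumes r: "\<And>g h. g \<in> \<pi> \<Longrightarrow> h \<in> \<pi> \<Longrightarrow> dist (isom_apply g c) (isom_apply h c) < r \<Longrightarrow> g = h"
    and x: "x \<in> ball c (r/4)" and y: "y \<in> ball c (r/4)"
  shows "dist (proj x) (proj y) = dist x y"
proof (rule antisym[OF dist_proj_le])
  have xy: "dist x y < r / 2"
    using x y dist_triangle3[of x y c] by simp
  have "dist x y \<le> infdist y (orbit x)"
  proof (rule ccontr)
    assume "\<not> dist x y \<le> infdist y (orbit x)"
    then obtain g where g: "g \<in> \<pi>" "dist y (isom_apply g x) < dist x y"
      using orbit_infdist_less[of y x "dist x y"] by auto
    have "dist (isom_apply g c) (isom_apply \<one>\<^bsub>Isom\<^esub> c) \<le> dist (isom_apply g c) (isom_apply g x) + dist (isom_apply g x) y + dist y c"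
      unfolding isom_apply_one(1) 
      using dist_triangle[of "isom_apply g c" c y] dist_triangle[of "isom_apply g c" y "isom_apply g x"] by simp
    also have "\<dots> < r/4 + r/2 + r/4"
      using g(2) xy x y dist_isom_apply[OF pi_Isom[OF g(1)], of c x] by (simp add: dist_commute)
    finally have "g = \<one>\<^bsub>Isom\<^esub>" by (intro r[OF g(1) pi_one]) simp
    then show False using g(2) by (simp only: isom_apply_one(1) dist_commute)
  qed
  also have "infdist y (orbit x) = dist (apply_bcontfun (proj x) y) (apply_bcontfun (proj y) y)"
    using orbit_self by (simp add: proj_apply dist_real_def infdist_nonneg)
  also have "\<dots> \<le> dist (proj x) (proj y)" by (rule dist_bounded)
  finally show "dist x y \<le> dist (proj x) (proj y)" .
qed

lemma proj_ball: "proj ` ball c s = range proj \<inter> ball (proj c) s"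
proof
  show "proj ` ball c s \<subseteq> range proj \<inter> ball (proj c) s"
  proof
    fix z assume "z \<in> proj ` ball c s"
    then obtain x where "z = proj x" "dist c x < s" by auto
    then show "z \<in> range proj \<inter> ball (proj c) s" using dist_proj_le[of c x] by simp
  qed
  show "range proj \<inter> ball (proj c) s \<subseteq> proj ` ball c s"
  proof
    fix z assume "z \<in> range proj \<inter> ball (proj c) s"
    then obtain x where z: "z = proj x" and d: "dist (proj c) (proj x) < s" by auto
    have "infdist c (orbit x) = dist (apply_bcontfun (proj c) c) (apply_bcontfun (proj x) c)"
      using orbit_self by (simp add: proj_apply dist_real_def infdist_nonneg)
    also have "\<dots> \<le> dist (proj c) (proj x)" by (rule dist_bounded)
    finally have "infdist c (orbit x) < s" using d by simp
    then obtain g where g: "g \<in> \<pi>" "dist c (isom_apply g x) < s" by (rule orbit_infdist_less)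
    have "proj x = proj (isom_apply g x)" unfolding proj_eq_iff using g(1) by blast
    then show "z \<in> proj ` ball c s" using g(2) z by (simp add: image_iff) (metis mem_ball)
  qed
qed

text \<open>The balls of radius \<open>r/4\<close> around the orbit of \<open>c\<close> are disjoint
  and each maps isometrically onto the same open set, so the inverse branches are
  continuous.\<close>

lemma covering_proj: "covering_space UNIV proj (range proj)"
proof (rule covering_spaceI)
  show "continuous_on UNIV proj" by (rule continuous_proj)
  fix z assume "z \<in> range proj"
  then obtain c where z: "z = proj c" by auto
  obtain r where r: "r > 0" "\<And>g h. g \<in> \<pi> \<Longrightarrow> h \<in> \<pi> \<Longrightarrow> dist (isom_apply g c) (isom_apply h c) < r \<Longrightarrow> g = h"
    by (rule separated, rule that)
  define T where "T = range proj \<inter> ball (proj c) (r/4)"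
  define v where "v = (\<lambda>g. ball (isom_apply g c) (r/4)) ` \<pi>"
  have pc: "proj (isom_apply g c) = proj c" if "g \<in> \<pi>" for g
    using proj_eq_iff[of c "isom_apply g c"] that by auto
  have img: "proj ` ball (isom_apply g c) (r/4) = T" if "g \<in> \<pi>" for g
    unfolding T_def proj_ball pc[OF that] ..
  have sep: "g' = h'" if "g \<in> \<pi>" "g' \<in> \<pi>" "h' \<in> \<pi>"
    "dist (isom_apply g' (isom_apply g c)) (isom_apply h' (isom_apply g c)) < r" for g g' h'
  proof -
    have "g' \<otimes>\<^bsub>Isom\<^esub> g = h' \<otimes>\<^bsub>Isom\<^esub> g"
      by (rule r(2)[OF pi_mult[OF that(2,1)] pi_mult[OF that(3,1)]]) (use that(4) in \<open>simp only: isom_apply_mult\<close>)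
    then have "isom_apply g' (isom_apply g y) = isom_apply h' (isom_apply g y)" for y
      by (metis isom_apply_mult)
    from this[of "isom_apply (inv\<^bsub>Isom\<^esub> g) y" for y] have "isom_apply g' y = isom_apply h' y" for y
      unfolding act_inv(2)[OF that(1)] .
    then show ?thesis unfolding isom_apply_inject[symmetric] by (rule ext)
  qed
  show "\<exists>T. z \<in> T \<and> openin (top_of_set (range proj)) T \<and>
          (\<exists>v. \<Union>v = UNIV \<inter> proj -` T \<and> (\<forall>u\<in>v. openin (top_of_set UNIV) u) \<and>
               pairwise disjnt v \<and> (\<forall>u\<in>v. \<exists>q. homeomorphism u T proj q))"
  proof (intro exI[of _ T] conjI exI[of _ v] ballI)
    show "z \<in> T" using z r(1) by (simp add: T_def)
    show "openin (top_of_set (range proj)) T" unfolding T_def by (intro openin_open_Int) simp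
    show "\<Union>v = UNIV \<inter> proj -` T"
    proof (rule Set.set_eqI, rule iffI)
      fix x assume "x \<in> \<Union>v"
      then show "x \<in> UNIV \<inter> proj -` T" unfolding v_def using img by blast
    next
      fix x assume "x \<in> UNIV \<inter> proj -` T"
      then have "proj x \<in> proj ` ball c (r/4)" unfolding proj_ball T_def by simp
      then obtain w where w: "w \<in> ball c (r/4)" "proj w = proj x" by auto
      then obtain g where g: "g \<in> \<pi>" "isom_apply g w = x" using proj_eq_iff by blast
      have "dist (isom_apply g c) x < r/4" using w(1) dist_isom_apply[OF pi_Isom[OF g(1)], of c w] g(2) by simp
      then show "x \<in> \<Union>v" unfolding v_def using g(1) by auto
    qed
    show "openin (top_of_set UNIV) u" if "u \<in> v" for u using that by (auto simp: v_def)
    show "pairwise disjnt v"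
    proof (rule pairwiseI)
      fix u w assume uw: "u \<in> v" "w \<in> v" "u \<noteq> w"
      then obtain g h where g: "g \<in> \<pi>" "u = ball (isom_apply g c) (r/4)" and h: "h \<in> \<pi>" "w = ball (isom_apply h c) (r/4)"
        by (auto simp: v_def)
      show "disjnt u w"
      proof (rule ccontr)
        assume "\<not> disjnt u w"
        then obtain x where "dist (isom_apply g c) x < r/4" "dist (isom_apply h c) x < r/4"
          unfolding g h disjnt_def by auto
        then have "dist (isom_apply g c) (isom_apply h c) < r"
          using dist_triangle2[of "isom_apply g c" "isom_apply h c" x] r(1) by linarith
        then have "g = h" by (rule r(2)[OF g(1) h(1)])
        then show False using uw g h by simp
      qed
    qed
    fix u assume "u \<in> v"
    then obtain g where g: "g \<in> \<pi>" "u = ball (isom_apply g c) (r/4)" by (auto simp: v_def)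
    have iso: "dist (proj x) (proj y) = dist x y" if "x \<in> u" "y \<in> u" for x y
      by (rule proj_local_isometry[of "isom_apply g c" r, OF sep[OF g(1)]]) (use that g(2) in auto)
    have inj: "inj_on proj u" using iso by (intro inj_onI) (metis dist_eq_0_iff)
    have imT: "proj ` u = T" using img[OF g(1)] g(2) by simp
    show "\<exists>q. homeomorphism u T proj q"
    proof (intro exI[of _ "inv_into u proj"] homeomorphismI continuous_proj)
      show "continuous_on T (inv_into u proj)"
        unfolding continuous_on_iff
      proof (intro ballI allI impI)
        fix y e assume y: "y \<in> T" and e: "(0::real) < e"
        show "\<exists>d>0. \<forall>x'\<in>T. dist x' y < d \<longrightarrow> dist (inv_into u proj x') (inv_into u proj y) < e"
        proof (intro exI[of _ e] conjI ballI impI e)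
          fix x' assume x': "x' \<in> T" "dist x' y < e"
          show "dist (inv_into u proj x') (inv_into u proj y) < e"
            using iso[of "inv_into u proj x'" "inv_into u proj y"] x' y unfolding imT[symmetric]
            by (simp add: inv_into_into f_inv_into_f)
        qed
      qed
    qed (use imT inj in \<open>auto simp: inv_into_into f_inv_into_f inv_into_f_f\<close>)
  qed
qed simp

end

section \<open>Lifting maps of the flat manifold\<close>

locale flat_manifold = crystallographic \<pi> for \<pi> :: "((real^'n^'n) \<times> (real^'n)) set" +
  fixes X :: "'m topology" and q :: "real^'n \<Rightarrow> 'm"
  assumes quot: "quotient_map euclidean X q"
    and fibres: "\<And>x y. q x = q y \<longleftrightarrow> (\<exists>g\<in>\<pi>. isom_apply g x = y)"
begin

lemma topspace_X: "topspace X = range q"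
  using quotient_imp_surjective_map[OF quot] by simp

lemma q_proj: "q x = q y \<longleftrightarrow> proj x = proj y"
  by (simp only: fibres proj_eq_iff)

lemma q_act: "g \<in> \<pi> \<Longrightarrow> q (isom_apply g x) = q x"
  using fibres[of x "isom_apply g x"] by auto

text \<open>\<open>X\<close> is an abstract topology, so \<open>f\<close> is transported to the
  metric model by \<open>j\<close>, continuous because \<open>q\<close> is a quotient map. Euclidean
  space is contractible, hence the resulting map is nullhomotopic and lifts through the
  covering.\<close>

lemma lift_exists:
  assumes f: "continuous_map X X f"
  obtains F where "continuous_on UNIV F" "\<And>x. q (F x) = f (q x)"
proof -
  define j where "j m = proj (SOME x. q x = m)" for m
  have jq: "j (q x) = proj x" for x
    unfolding j_def using someI[of "\<lambda>y. q y = q x" x] q_proj by blast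
  have cj: "continuous_map X euclidean j"
  proof (rule continuous_compose_quotient_map[OF quot])
    have "j \<circ> q = proj" by (rule ext) (simp add: jq)
    then show "continuous_map euclidean euclidean (j \<circ> q)" using continuous_proj[of UNIV] by simp
  qed
  have cq: "continuous_map euclidean X q" using quot by (rule quotient_imp_continuous_map)
  have "continuous_map euclidean euclidean (j \<circ> (f \<circ> q))"
    by (intro continuous_map_compose[OF continuous_map_compose[OF cq f] cj])
  then have cont: "continuous_on UNIV (j \<circ> (f \<circ> q))" by simp
  have into: "(j \<circ> (f \<circ> q)) \<in> UNIV \<rightarrow> range proj" by (auto simp: j_def)
  obtain a where hom: "homotopic_with_canon (\<lambda>h. True) UNIV (range proj) (j \<circ> (f \<circ> q)) (\<lambda>x. a)"
    by (rule nullhomotopic_from_contractible[OF cont into contractible_UNIV], rule that)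
  obtain F where F: "continuous_on UNIV F" "F ` UNIV \<subseteq> UNIV" "\<And>x. x \<in> UNIV \<Longrightarrow> proj (F x) = (j \<circ> (f \<circ> q)) x"
    by (rule covering_space_lift_inessential_function[OF covering_proj hom], rule that)
  have "q (F x) = f (q x)" for x
  proof -
    have "q x \<in> topspace X" by (simp add: topspace_X)
    then have "f (q x) \<in> topspace X" using continuous_map_image_subset_topspace[OF f] by blast
    then obtain y where y: "f (q x) = q y" unfolding topspace_X by auto
    have "proj (F x) = j (q y)" using F(3)[of x] y by simp
    then show ?thesis unfolding y q_proj jq .
  qed
  then show ?thesis by (rule that[OF F(1)])
qed

text \<open>An element of \<pi> matches the two lifts at 0, and unique lifting over a connected
  space extends the match everywhere.\<close>

lemma lift_unique:
  assumes F: "continuous_on UNIV F" and H: "continuous_on UNIV H"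
    and eq: "\<And>x::real^'n. q (F x) = q (H x)"
  obtains g where "g \<in> \<pi>" "\<And>x. F x = isom_apply g (H x)"
proof -
  obtain g where g: "g \<in> \<pi>" "isom_apply g (H 0) = F 0" using eq[of 0] fibres by metis
  have "F x = isom_apply g (H x)" for x
  proof (rule covering_space_lift_unique[OF covering_proj, where T = UNIV and a = 0 and f = "\<lambda>x. proj (F x)"
        and ?g1.0 = F and ?g2.0 = "\<lambda>x. isom_apply g (H x)"])
    show "continuous_on UNIV (\<lambda>x. proj (F x))"
      by (rule continuous_on_compose2[OF continuous_proj F subset_UNIV])
    show "continuous_on UNIV (\<lambda>x. isom_apply g (H x))" by (intro continuous_intros H)
    show "proj (F x) = proj (isom_apply g (H x))" for x
      using eq[of x] q_act[OF g(1), of "H x"] q_proj[of "F x" "isom_apply g (H x)"] by simp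
  qed (use g F in auto)
  then show ?thesis by (rule that[OF g(1)])
qed

end

section \<open>Lifts of the action\<close>

lemma additive_int_vec_matrix:
  fixes f :: "int^'n \<Rightarrow> int^'m"
  assumes add: "\<And>y z. f (y + z) = f y + f z"
  shows "f z = (\<chi> i j. f (axis j 1) $ i) *v z"
proof -
  have f0: "f 0 = 0" using add[of 0 0] by simp
  have fneg: "f (- z) = - f z" for z using add[of z "- z"] f0 by (simp add: eq_neg_iff_add_eq_0 add.commute)
  have fnat: "f (int k *s z) = int k *s f z" for k z
  proof (induction k)
    case (Suc k)
    have "int (Suc k) *s z = z + int k *s z" by (simp add: vec_eq_iff algebra_simps)
    then have "f (int (Suc k) *s z) = f z + int k *s f z" by (simp only: add Suc)
    then show ?case by (simp add: vec_eq_iff algebra_simps)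
  qed (simp add: f0)
  have fint: "f (k *s z) = k *s f z" for k z
  proof (cases k rule: int_cases2)
    case (nonpos m)
    have "k *s z = - (int m *s z)" using nonpos by (simp add: vec_eq_iff)
    then have "f (k *s z) = - (int m *s f z)" by (simp only: fneg fnat)
    then show ?thesis using nonpos by (simp add: vec_eq_iff)
  qed (simp add: fnat)
  have fsum: "f (sum g A) = (\<Sum>a\<in>A. f (g a))" if "finite A" for A :: "'n set" and g
    using that by (induction A rule: finite_induct) (simp_all add: f0 add)
  have "f z = f (\<Sum>j\<in>UNIV. (z $ j) *s axis j 1)" by (simp add: basis_expansion)
  also have "\<dots> = (\<Sum>j\<in>UNIV. (z $ j) *s f (axis j 1))" by (simp add: fsum fint)
  finally show ?thesis by (simp add: vec_eq_iff matrix_vector_mult_def mult.commute)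
qed

lemma matrix_vector_mult_axis: "(A *v axis j 1) $ i = A $ i $ j"
  for A :: "'a::semiring_1^'n^'m"
  by (simp add: matrix_vector_mult_def axis_def if_distrib cong: if_cong)

lemma group_GLZ: "group (GLZ :: (int^'n^'n) monoid)"
proof (rule groupI)
  fix A B C :: "int^'n^'n"
  assume A: "A \<in> carrier GLZ" and B: "B \<in> carrier GLZ"
  obtain A' B' where A': "A ** A' = mat 1" "A' ** A = mat 1" and B': "B ** B' = mat 1" "B' ** B = mat 1"
    using A B by (auto simp: GLZ_def)
  have "(A ** B) ** (B' ** A') = A ** (B ** B') ** A'" "(B' ** A') ** (A ** B) = B' ** (A' ** A) ** B"
    by (simp_all only: matrix_mul_assoc)
  then have "(A ** B) ** (B' ** A') = mat 1" "(B' ** A') ** (A ** B) = mat 1" by (simp_all add: A' B')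
  then show "A \<otimes>\<^bsub>GLZ\<^esub> B \<in> carrier GLZ" by (auto simp: GLZ_def)
  show "\<exists>D\<in>carrier GLZ. D \<otimes>\<^bsub>GLZ\<^esub> A = \<one>\<^bsub>GLZ\<^esub>" using A' by (auto simp: GLZ_def)
qed (auto simp: GLZ_def matrix_mul_assoc)

lemma GLZ_simps: "x \<otimes>\<^bsub>GLZ\<^esub> y = x ** y" "\<one>\<^bsub>GLZ\<^esub> = mat 1"
  by (simp_all add: GLZ_def)

lemma inv_GLZ: "A ** B = mat 1 \<Longrightarrow> B ** A = mat 1 \<Longrightarrow> inv\<^bsub>GLZ\<^esub> A = B"
  by (rule group.inv_equality[OF group_GLZ]) (auto simp: GLZ_def)

context crystallographic
begin

lemma L_act: "t \<in> L \<Longrightarrow> (mat 1, t) \<in> \<pi>"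
  by (simp add: L_def)

text \<open>The powers of \<open>g\<close> have at most \<open>c\<close> linear parts, so a positive
  exponent of at most \<open>c\<close> already gives a translation; \<open>fact c\<close> is a
  common multiple of these exponents.\<close>

lemma pi_exponent: obtains k :: nat where "k > 0" "\<And>g. g \<in> \<pi> \<Longrightarrow> fst (g [^]\<^bsub>Isom\<^esub> k) = mat 1"
proof
  define c where "c = card (fst ` \<pi>)"
  show "fact c > (0::nat)" by simp
  fix g assume g: "g \<in> \<pi>"
  have "\<not> inj_on (\<lambda>i::nat. fst (g [^]\<^bsub>Isom\<^esub> i)) {..c}"
  proof
    assume "inj_on (\<lambda>i::nat. fst (g [^]\<^bsub>Isom\<^esub> i)) {..c}"
    then have "card {..c} \<le> card (fst ` \<pi>)"
      by (rule card_inj_on_le) (use finite_linear_parts pi_pow[OF g] in auto)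
    then show False by (simp add: c_def)
  qed
  then obtain i j :: nat where ij: "i < j" "j \<le> c" "fst (g [^]\<^bsub>Isom\<^esub> i) = fst (g [^]\<^bsub>Isom\<^esub> j)"
    unfolding inj_on_def by (metis atMost_iff linorder_neqE_nat)
  interpret I: group "Isom :: ((real^'n^'n) \<times> (real^'n)) monoid" by (rule group_Isom)
  have gI: "g \<in> carrier Isom" by (rule pi_Isom[OF g])
  have fst_mult: "fst (x \<otimes>\<^bsub>Isom\<^esub> y) = fst x ** fst y" for x y :: "(real^'n^'n) \<times> (real^'n)"
    by (cases x; cases y) simp
  define A where "A = fst (g [^]\<^bsub>Isom\<^esub> i)"
  define D where "D = fst (g [^]\<^bsub>Isom\<^esub> (j - i))"
  have oA: "orthogonal_matrix A" unfolding A_def using pi_pow[OF g, of i] orth by (metis prod.collapse)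
  have "A ** D = A"
    using I.nat_pow_mult[OF gI, of i "j - i"] ij fst_mult unfolding A_def D_def by (metis le_add_diff_inverse less_imp_le)
  then have "transpose A ** (A ** D) = transpose A ** A" by simp
  then have D: "D = mat 1" using oA by (simp add: matrix_mul_assoc orthogonal_matrix_cancel)
  have "j - i dvd fact c" using ij by (intro dvd_fact) auto
  then obtain m where m: "fact c = (j - i) * m" by (auto elim: dvdE)
  have "fst ((g [^]\<^bsub>Isom\<^esub> (j - i)) [^]\<^bsub>Isom\<^esub> (n::nat)) = mat 1" for n
    by (induction n) (simp_all only: nat_pow_0 nat_pow_Suc fst_mult D_def[symmetric] D, simp_all)
  from this[of m] show "fst (g [^]\<^bsub>Isom\<^esub> (fact c :: nat)) = mat 1"
    unfolding I.nat_pow_pow[OF gI, of "j - i" m] m .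
qed

lemma fixes_lattice_imp_id:
  assumes "\<And>t. t \<in> L \<Longrightarrow> A *v t = t" shows "A = mat 1"
proof -
  have "A *v x = id x" for x
  proof (rule linear_eq_on_span[of "(*v) A" id L])
    show "x \<in> span L" using euclidean_lattice.spanning[OF lattice_L] by simp
  qed (simp_all add: linear_id assms)
  then show ?thesis by (simp add: matrix_eq)
qed

text \<open>The right-hand side survives conjugation by a homeomorphism that need not be affine. For
  a translation, a common exponent makes every \<open>h ^^ k\<close> a translation too; conversely,
  commuting with multiples of lattice translations makes the linear part fix the spanning set
  \<open>L\<close>.\<close>

lemma translation_iff:
  assumes g: "g \<in> \<pi>"
  shows "fst g = mat 1 \<longleftrightarrow> (\<exists>k>0. \<forall>h\<in>\<pi>. isom_apply g \<circ> (isom_apply h ^^ k) = (isom_apply h ^^ k) \<circ> isom_apply g)"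
proof
  assume 1: "fst g = mat 1"
  obtain k :: nat where k: "k > 0" "\<And>g. g \<in> \<pi> \<Longrightarrow> fst (g [^]\<^bsub>Isom\<^esub> k) = mat 1"
    by (rule pi_exponent, rule that)
  show "\<exists>k>0. \<forall>h\<in>\<pi>. isom_apply g \<circ> (isom_apply h ^^ k) = (isom_apply h ^^ k) \<circ> isom_apply g"
  proof (intro exI[of _ k] conjI ballI k(1))
    fix h assume "h \<in> \<pi>"
    then show "isom_apply g \<circ> (isom_apply h ^^ k) = (isom_apply h ^^ k) \<circ> isom_apply g"
      unfolding act_pow[symmetric] using k(2)[of h] 1 by (simp add: fun_eq_iff isom_apply_def)
  qed
next
  assume "\<exists>k>0. \<forall>h\<in>\<pi>. isom_apply g \<circ> (isom_apply h ^^ k) = (isom_apply h ^^ k) \<circ> isom_apply g"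
  then obtain k :: nat where k: "k > 0" and comm: "\<And>h. h \<in> \<pi> \<Longrightarrow> isom_apply g \<circ> (isom_apply h ^^ k) = (isom_apply h ^^ k) \<circ> isom_apply g"
    by blast
  have fixL: "fst g *v t = t" if t: "t \<in> L" for t
  proof -
    have pw: "(isom_apply (mat 1, t) ^^ n) x = x + real n *\<^sub>R t" for n x
      by (induction n) (simp_all add: isom_apply_one algebra_simps)
    have "isom_apply g (0 + real k *\<^sub>R t) = isom_apply g 0 + real k *\<^sub>R t"
      using fun_cong[OF comm[OF L_act[OF t]], of 0] by (simp add: pw)
    then have "real k *\<^sub>R (fst g *v t) = real k *\<^sub>R t"
      by (simp add: isom_apply_def matrix_vector_mult_scaleR)
    then show ?thesis using k by simp
  qed
  then show "fst g = mat 1" by (rule fixes_lattice_imp_id)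
qed

end

locale flat_action = flat_manifold \<pi> X q
  for \<pi> :: "((real^'n^'n) \<times> (real^'n)) set" and X :: "'m topology" and q :: "real^'n \<Rightarrow> 'm" +
  fixes G :: "('g, 'b) monoid_scheme" and \<phi> :: "'g \<Rightarrow> 'm \<Rightarrow> 'm"
  assumes group_G: "group G" and finite_G: "finite (carrier G)"
    and eff: "effective_homeo_action G X \<phi>"
begin

definition lifts :: "(real^'n \<Rightarrow> real^'n) \<Rightarrow> 'g \<Rightarrow> bool" where
  "lifts F g \<longleftrightarrow> g \<in> carrier G \<and> continuous_on UNIV F \<and> (\<forall>x. q (F x) = \<phi> g (q x))"

lemma q_topspace: "q x \<in> topspace X"
  by (simp add: topspace_X)

lemma phi_mult: "g \<in> carrier G \<Longrightarrow> h \<in> carrier G \<Longrightarrow> \<phi> (g \<otimes>\<^bsub>G\<^esub> h) (q x) = \<phi> g (\<phi> h (q x))"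
  using eff q_topspace by (simp add: effective_homeo_action_def)

lemma phi_one: "\<phi> \<one>\<^bsub>G\<^esub> (q x) = q x"
  using eff q_topspace by (simp add: effective_homeo_action_def)

lemma lift_ex: assumes "g \<in> carrier G" shows "\<exists>F. lifts F g"
proof -
  have "homeomorphic_map X X (\<phi> g)" using eff assms by (simp add: effective_homeo_action_def)
  then have cm: "continuous_map X X (\<phi> g)" by (rule homeomorphic_imp_continuous_map)
  obtain F where "continuous_on UNIV F" "\<And>x. q (F x) = \<phi> g (q x)" by (rule lift_exists[OF cm], rule that)
  then show ?thesis using assms by (auto simp: lifts_def)
qed

lemma lifts_compose:
  assumes "lifts F g" "lifts H h" shows "lifts (F \<circ> H) (g \<otimes>\<^bsub>G\<^esub> h)"
proof -
  have "continuous_on UNIV (\<lambda>x. F (H x))"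
    by (rule continuous_on_compose2[OF _ _ subset_UNIV]) (use assms in \<open>simp_all add: lifts_def\<close>)
  then show ?thesis
    using assms monoid.m_closed[OF group.is_monoid[OF group_G]] by (simp add: lifts_def phi_mult o_def)
qed

lemma lifts_act: "g \<in> \<pi> \<Longrightarrow> lifts (isom_apply g) \<one>\<^bsub>G\<^esub>"
  unfolding lifts_def
  by (auto simp: phi_one q_act monoid.one_closed[OF group.is_monoid[OF group_G]] intro!: continuous_on_isom_apply[OF continuous_on_id, unfolded id_def])

lemma lifts_same:
  assumes "lifts F g" "lifts H g"
  obtains \<gamma> where "\<gamma> \<in> \<pi>" "F = isom_apply \<gamma> \<circ> H"
proof -
  have c: "continuous_on UNIV F" "continuous_on UNIV H" and e: "\<And>x. q (F x) = q (H x)"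
    using assms by (simp_all add: lifts_def)
  obtain \<gamma> where g: "\<gamma> \<in> \<pi>" "\<And>x. F x = isom_apply \<gamma> (H x)" by (rule lift_unique[OF c e], rule that)
  have "F = isom_apply \<gamma> \<circ> H" by (rule ext) (simp add: g(2))
  then show ?thesis by (rule that[OF g(1)])
qed

lemma lifts_id: "lifts id \<one>\<^bsub>G\<^esub>"
proof -
  have "isom_apply \<one>\<^bsub>Isom\<^esub> = (id :: real^'n \<Rightarrow> real^'n)" by (rule ext) (simp only: isom_apply_one id_apply)
  then show ?thesis using lifts_act[OF pi_one] by simp
qed

lemma lifts_one_iff: "lifts F \<one>\<^bsub>G\<^esub> \<longleftrightarrow> F \<in> isom_apply ` \<pi>"
proof
  assume l: "lifts F \<one>\<^bsub>G\<^esub>"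
  obtain \<gamma> where "\<gamma> \<in> \<pi>" "F = isom_apply \<gamma> \<circ> id" by (rule lifts_same[OF l lifts_id], rule that)
  then show "F \<in> isom_apply ` \<pi>" by simp
qed (auto intro: lifts_act)

text \<open>As \<open>q\<close> is onto, \<open>g\<close> and \<open>h\<close> act alike on all of
  \<open>X\<close>, and effectiveness of the action identifies them.\<close>

lemma lifts_determines:
  assumes F: "lifts F g" and F': "lifts F h" shows "g = h"
proof -
  interpret G: group G by (rule group_G)
  have g: "g \<in> carrier G" and h: "h \<in> carrier G" using assms by (simp_all add: lifts_def)
  have "\<phi> (inv\<^bsub>G\<^esub> h \<otimes>\<^bsub>G\<^esub> g) m = m" if "m \<in> topspace X" for m
  proof -
    have "m \<in> range q" using that topspace_X by simp
    then obtain x where x: "m = q x" by blast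
    have "\<phi> g (q x) = \<phi> h (q x)" using F F' unfolding lifts_def by metis
    then have "\<phi> (inv\<^bsub>G\<^esub> h \<otimes>\<^bsub>G\<^esub> g) (q x) = \<phi> (inv\<^bsub>G\<^esub> h \<otimes>\<^bsub>G\<^esub> h) (q x)"
      by (simp only: phi_mult[OF G.inv_closed[OF h] g] phi_mult[OF G.inv_closed[OF h] h])
    then show ?thesis using h x by (simp add: phi_one)
  qed
  then have "inv\<^bsub>G\<^esub> h \<otimes>\<^bsub>G\<^esub> g = \<one>\<^bsub>G\<^esub>"
    using eff g h by (simp add: effective_homeo_action_def)
  then have "inv\<^bsub>G\<^esub> g = inv\<^bsub>G\<^esub> h" by (rule G.inv_equality[OF _ g G.inv_closed[OF h]])
  then have "inv\<^bsub>G\<^esub> (inv\<^bsub>G\<^esub> g) = inv\<^bsub>G\<^esub> (inv\<^bsub>G\<^esub> h)" by simp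
  then show ?thesis using g h by simp
qed

text \<open>A lift of the inverse element inverts \<open>F\<close> only up to elements of \<pi>;
  correcting by one of them gives a right inverse, and injectivity of \<open>F\<close> makes it
  two-sided.\<close>

lemma lifts_inverse:
  assumes F: "lifts F g"
  obtains H where "lifts H (inv\<^bsub>G\<^esub> g)" "F \<circ> H = id" "H \<circ> F = id"
proof -
  interpret G: group G by (rule group_G)
  have g: "g \<in> carrier G" using F by (simp add: lifts_def)
  obtain K where K: "lifts K (inv\<^bsub>G\<^esub> g)" using lift_ex[OF G.inv_closed[OF g]] by blast
  have "lifts (F \<circ> K) \<one>\<^bsub>G\<^esub>" "lifts (K \<circ> F) \<one>\<^bsub>G\<^esub>"
    using lifts_compose[OF F K] lifts_compose[OF K F] g by simp_all
  then obtain a b where a: "a \<in> \<pi>" "F \<circ> K = isom_apply a" and b: "b \<in> \<pi>" "K \<circ> F = isom_apply b"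
    unfolding lifts_one_iff by auto
  define H where "H = K \<circ> isom_apply (inv\<^bsub>Isom\<^esub> a)"
  have FH: "F \<circ> H = id"
  proof
    fix x show "(F \<circ> H) x = id x"
      using fun_cong[OF a(2), of "isom_apply (inv\<^bsub>Isom\<^esub> a) x"] act_inv(2)[OF a(1), of x] by (simp add: H_def)
  qed
  have "inj F"
  proof (rule injI)
    fix x y assume "F x = F y"
    then have "isom_apply b x = isom_apply b y" using fun_cong[OF b(2), of x] fun_cong[OF b(2), of y] by simp
    then show "x = y" using act_inv(1)[OF b(1)] by metis
  qed
  have "H \<circ> F = id"
  proof
    fix x
    have "F (H (F x)) = F x" using fun_cong[OF FH, of "F x"] by simp
    then show "(H \<circ> F) x = id x" using \<open>inj F\<close> by (simp add: inj_eq)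
  qed
  moreover have "lifts H (inv\<^bsub>G\<^esub> g)"
    using lifts_compose[OF K lifts_act[OF pi_inv[OF a(1)]]] g by (simp add: H_def)
  ultimately show ?thesis using that FH by blast
qed

text \<open>The conjugate \<open>\<gamma>\<close> of the translation by \<open>F\<close> lies in
  \<pi>. Conjugation by \<open>F\<close> also maps \<pi> to itself, so the criterion of
  \<open>translation_iff\<close> passes from the translation to \<open>\<gamma>\<close>.\<close>

lemma lifts_translation:
  assumes F: "lifts F g" and t: "t \<in> L"
  shows "F t - F 0 \<in> L" and "F (x + t) = F x + (F t - F 0)"
proof -
  interpret G: group G by (rule group_G)
  have g: "g \<in> carrier G" using F by (simp add: lifts_def)
  let ?t = "isom_apply (mat 1, t)"
  obtain H where H: "lifts H (inv\<^bsub>G\<^esub> g)" "F \<circ> H = id" "H \<circ> F = id" by (rule lifts_inverse[OF F], rule that)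
  have Ft: "lifts (F \<circ> ?t) g" using lifts_compose[OF F lifts_act[OF L_act[OF t]]] g by simp
  obtain \<gamma> where \<gamma>: "\<gamma> \<in> \<pi>" "F \<circ> ?t = isom_apply \<gamma> \<circ> F" by (rule lifts_same[OF Ft F], rule that)
  have conj: "\<exists>h'\<in>\<pi>. isom_apply h \<circ> F = F \<circ> isom_apply h'" if h: "h \<in> \<pi>" for h
  proof -
    have "lifts (H \<circ> (isom_apply h \<circ> F)) \<one>\<^bsub>G\<^esub>"
      using lifts_compose[OF H(1) lifts_compose[OF lifts_act[OF h] F]] g by simp
    then obtain h' where h': "h' \<in> \<pi>" "H \<circ> (isom_apply h \<circ> F) = isom_apply h'" unfolding lifts_one_iff by auto
    have "isom_apply h \<circ> F = F \<circ> isom_apply h'"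
      unfolding h'(2)[symmetric] by (simp only: o_assoc H(2) id_o)
    then show ?thesis using h'(1) by (rule bexI)
  qed
  have "fst (mat 1 :: real^'n^'n, t) = mat 1" by simp
  then obtain k :: nat where k: "k > 0" "\<And>h. h \<in> \<pi> \<Longrightarrow> ?t \<circ> (isom_apply h ^^ k) = (isom_apply h ^^ k) \<circ> ?t"
    using translation_iff[OF L_act[OF t]] by blast
  have "isom_apply \<gamma> \<circ> (isom_apply h ^^ k) = (isom_apply h ^^ k) \<circ> isom_apply \<gamma>" if h: "h \<in> \<pi>" for h
  proof -
    obtain h' where h': "h' \<in> \<pi>" "isom_apply h \<circ> F = F \<circ> isom_apply h'" using conj[OF h] by blast
    have pw: "(isom_apply h ^^ n) (F x) = F ((isom_apply h' ^^ n) x)" for n x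
      by (induction n) (simp_all add: fun_cong[OF h'(2), unfolded comp_apply])
    have \<gamma>F: "isom_apply \<gamma> (F x) = F (?t x)" for x using fun_cong[OF \<gamma>(2), of x] by simp
    have "isom_apply \<gamma> ((isom_apply h ^^ k) (F x)) = (isom_apply h ^^ k) (isom_apply \<gamma> (F x))" for x
      using fun_cong[OF k(2)[OF h'(1)], of x] by (simp add: pw \<gamma>F)
    from this[of "H y" for y] show ?thesis
      using H(2) by (simp add: fun_eq_iff)
  qed
  then have "fst \<gamma> = mat 1" using translation_iff[OF \<gamma>(1)] k(1) by blast
  then obtain s where s: "\<gamma> = (mat 1, s)" by (metis prod.collapse)
  have Fs: "F (x + t) = F x + s" for x
    using fun_cong[OF \<gamma>(2), of x] by (simp add: s isom_apply_one(2))
  have "F t - F 0 = s" using Fs[of 0] by simp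
  then show "F t - F 0 \<in> L" "F (x + t) = F x + (F t - F 0)" using \<gamma>(1) Fs by (simp_all add: s L_def)
qed

section \<open>Conjugation on the lattice as an integer matrix\<close>

definition W :: "real^'n^'n" where
  "W = (SOME W. det W \<noteq> 0 \<and> L = {W *v of_int_vec z | z. True})"

lemma translation_basis: "det W \<noteq> 0" "L = {W *v of_int_vec z | z. True}"
proof -
  have "\<exists>W::real^'n^'n. det W \<noteq> 0 \<and> L = {W *v of_int_vec z | z. True}"
    using euclidean_lattice.integral_basis[OF lattice_L] by metis
  then have "det W \<noteq> 0 \<and> L = {W *v of_int_vec z | z. True}" unfolding W_def by (rule someI_ex)
  then show "det W \<noteq> 0" "L = {W *v of_int_vec z | z. True}" by blast+
qed

lemma W_L: "W *v of_int_vec z \<in> L"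
  using translation_basis(2) by blast

lemma W_inject: "W *v x = W *v y \<longleftrightarrow> x = y"
proof -
  have "inj ((*v) W)" using translation_basis(1) det_nz_iff_inj[of "(*v) W"] by (simp add: matrix_vector_mul_linear)
  then show ?thesis by (rule inj_eq)
qed

text \<open>The matrix in the basis \<open>W\<close> of conjugation by \<open>F\<close> on
  translations: translation by \<open>t\<close> becomes translation by \<open>F t - F 0\<close>. The
  choice has this meaning only when \<open>F\<close> is a lift.\<close>

definition rho :: "(real^'n \<Rightarrow> real^'n) \<Rightarrow> int^'n^'n" where
  "rho F = (SOME M. \<forall>z. F (W *v of_int_vec z) - F 0 = W *v of_int_vec (M *v z))"

lemma rho:
  assumes F: "lifts F g"
  shows "F (W *v of_int_vec z) - F 0 = W *v of_int_vec (rho F *v z)"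
proof -
  have "\<forall>z. \<exists>y. F (W *v of_int_vec z) - F 0 = W *v of_int_vec y"
    using lifts_translation(1)[OF F W_L] translation_basis(2) by blast
  then obtain f where f: "\<And>z. F (W *v of_int_vec z) - F 0 = W *v of_int_vec (f z)" by metis
  have "f (y + z) = f y + f z" for y z
  proof -
    have "W *v of_int_vec (f (y + z)) = F (W *v of_int_vec y + W *v of_int_vec z) - F 0"
      by (simp add: f[symmetric] of_int_vec_add matrix_vector_right_distrib)
    also have "\<dots> = (F (W *v of_int_vec y) - F 0) + (F (W *v of_int_vec z) - F 0)"
      by (simp add: lifts_translation(2)[OF F W_L])
    also have "\<dots> = W *v of_int_vec (f y + f z)"
      by (simp add: f of_int_vec_add matrix_vector_right_distrib)
    finally show ?thesis by (simp add: W_inject)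
  qed
  then have "f z = (\<chi> i j. f (axis j 1) $ i) *v z" for z by (rule additive_int_vec_matrix)
  then have "\<forall>z. F (W *v of_int_vec z) - F 0 = W *v of_int_vec ((\<chi> i j. f (axis j 1) $ i) *v z)"
    using f by metis
  then have "\<forall>z. F (W *v of_int_vec z) - F 0 = W *v of_int_vec (rho F *v z)"
    unfolding rho_def by (rule someI)
  then show ?thesis by blast
qed

lemma rho_eqI:
  assumes F: "lifts F g" and M: "\<And>z. F (W *v of_int_vec z) - F 0 = W *v of_int_vec (M *v z)"
  shows "rho F = M"
proof -
  have "rho F *v z = M *v z" for z
    using rho[OF F, of z] M[of z] by (simp add: W_inject)
  then have "(rho F *v axis j 1) $ i = (M *v axis j 1) $ i" for i j by simp
  then show ?thesis unfolding matrix_vector_mult_axis by (simp add: vec_eq_iff)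
qed

lemma rho_compose:
  assumes F: "lifts F g" and H: "lifts H h"
  shows "rho (F \<circ> H) = rho F ** rho H"
proof (rule rho_eqI[OF lifts_compose[OF F H]])
  fix z
  have "H (W *v of_int_vec z) = H 0 + W *v of_int_vec (rho H *v z)"
    using rho[OF H, of z] by (simp add: algebra_simps)
  then have "(F \<circ> H) (W *v of_int_vec z) - (F \<circ> H) 0 = F (W *v of_int_vec (rho H *v z)) - F 0"
    by (simp add: lifts_translation(2)[OF F W_L])
  then show "(F \<circ> H) (W *v of_int_vec z) - (F \<circ> H) 0 = W *v of_int_vec (rho F ** rho H *v z)"
    by (simp add: rho[OF F] matrix_vector_mul_assoc)
qed

lemma rho_id: "rho id = mat 1"
  by (rule rho_eqI[OF lifts_id]) simp

lemma rho_eq_1_iff: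
  assumes F: "lifts F g"
  shows "rho F = mat 1 \<longleftrightarrow> (\<forall>t\<in>L. \<forall>x. F (x + t) = F x + t)"
proof
  assume 1: "rho F = mat 1"
  show "\<forall>t\<in>L. \<forall>x. F (x + t) = F x + t"
  proof (intro ballI allI)
    fix t x assume t: "t \<in> L"
    then obtain z where z: "t = W *v of_int_vec z" using translation_basis(2) by blast
    have "F t - F 0 = t" using rho[OF F, of z] by (simp add: 1 z)
    then show "F (x + t) = F x + t" using lifts_translation(2)[OF F t, of x] by simp
  qed
next
  assume *: "\<forall>t\<in>L. \<forall>x. F (x + t) = F x + t"
  show "rho F = mat 1"
  proof (rule rho_eqI[OF F])
    fix z
    have "F (0 + W *v of_int_vec z) = F 0 + W *v of_int_vec z" using * W_L by blast
    then show "F (W *v of_int_vec z) - F 0 = W *v of_int_vec (mat 1 *v z)" by simp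
  qed
qed

text \<open>On \<pi> the matrix is the linear part read in the lattice basis, and a linear part is
  determined by its action on the spanning set \<open>L\<close>.\<close>

lemma rho_act_1_iff: assumes "\<gamma> \<in> \<pi>" shows "rho (isom_apply \<gamma>) = mat 1 \<longleftrightarrow> fst \<gamma> = mat 1"
proof -
  have "(\<forall>t\<in>L. \<forall>x. isom_apply \<gamma> (x + t) = isom_apply \<gamma> x + t) \<longleftrightarrow> (\<forall>t\<in>L. fst \<gamma> *v t = t)"
    by (auto simp: isom_apply_def matrix_vector_right_distrib)
  also have "\<dots> \<longleftrightarrow> fst \<gamma> = mat 1"
  proof
    assume *: "\<forall>t\<in>L. fst \<gamma> *v t = t"
    then show "fst \<gamma> = mat 1" by (intro fixes_lattice_imp_id) simp
  qed simp
  finally show ?thesis using rho_eq_1_iff[OF lifts_act[OF assms]] by simp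
qed

lemma rho_inverse:
  assumes F: "lifts F g" and H: "lifts H h" and "F \<circ> H = id" "H \<circ> F = id"
  shows "rho F ** rho H = mat 1" "rho H ** rho F = mat 1"
  using rho_compose[OF F H] rho_compose[OF H F] assms(3,4) rho_id by simp_all

end

section \<open>The central extension by the translations\<close>

context flat_action
begin

text \<open>\<open>F x - x\<close> is periodic under \<open>L\<close>, so its values on the compact
  parallelepiped \<open>Q\<close> bound it everywhere.\<close>

lemma bounded_displacement:
  assumes F: "lifts F g" and 1: "rho F = mat 1"
  obtains B where "\<And>x. norm (F x - x) \<le> B"
proof -
  have cF: "continuous_on UNIV F" using F by (simp add: lifts_def)
  define Q where "Q = (*v) W ` cbox 0 (\<chi> i. 1)"
  have cQ: "compact Q"
    unfolding Q_def by (intro compact_continuous_image linear_continuous_on matrix_vector_mul_bounded_linear compact_cbox)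
  have "compact ((\<lambda>x. F x - x) ` Q)" (is "compact ?D")
    by (intro compact_continuous_image continuous_on_diff continuous_on_id continuous_on_subset[OF cF] cQ) simp
  then have "bounded ?D" by (rule compact_imp_bounded)
  then obtain B where "\<forall>v\<in>?D. norm v \<le> B" unfolding bounded_iff by blast
  then have B: "norm (F y - y) \<le> B" if "y \<in> Q" for y using that by blast
  have "norm (F x - x) \<le> B" for x
  proof -
    obtain Wi where Wi: "W ** Wi = mat 1"
      using translation_basis(1) invertible_det_nz[of W] unfolding invertible_def by auto
    define c where "c = Wi *v x"
    have Wc: "W *v c = x" by (simp add: c_def matrix_vector_mul_assoc Wi)
    define z :: "int^'n" where "z = (\<chi> i. \<lfloor>c $ i\<rfloor>)"
    define t where "t = W *v of_int_vec z"
    have t: "t \<in> L" unfolding t_def by (rule W_L)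
    define y where "y = W *v (c - of_int_vec z)"
    have "0 \<le> c $ i - of_int \<lfloor>c $ i\<rfloor> \<and> c $ i - of_int \<lfloor>c $ i\<rfloor> \<le> 1" for i by linarith
    then have "c - of_int_vec z \<in> cbox 0 (\<chi> i. 1)"
      unfolding mem_box_cart by (simp add: z_def)
    then have "y \<in> Q" by (simp add: Q_def y_def)
    moreover have x: "x = y + t" by (simp add: y_def t_def matrix_vector_mult_diff_distrib Wc)
    moreover have "F (y + t) = F y + t" using 1 t rho_eq_1_iff[OF F] by blast
    ultimately show ?thesis using B[of y] by simp
  qed
  then show ?thesis by (rule that)
qed

lemma finite_order_imp_id:
  assumes F: "lifts F g" and 1: "rho F = mat 1" and m: "m > 0" "F ^^ m = id"
  shows "F = id"
proof -
  obtain B where "\<And>x. norm (F x - x) \<le> B" by (rule bounded_displacement[OF F 1], rule that)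
  then show ?thesis
    using periodic_bounded_displacement_imp_id[of F m B] F m by (simp add: lifts_def)
qed

lemma rho_one_lifts_one:
  assumes F: "lifts F \<one>\<^bsub>G\<^esub>" and 1: "rho F = mat 1"
  obtains t where "t \<in> L" "\<And>x. F x = x + t"
proof -
  obtain \<gamma> where \<gamma>: "\<gamma> \<in> \<pi>" "F = isom_apply \<gamma>" using F unfolding lifts_one_iff by blast
  have "fst \<gamma> = mat 1" using 1 rho_act_1_iff[OF \<gamma>(1)] \<gamma>(2) by simp
  then have g: "\<gamma> = (mat 1, snd \<gamma>)" by (metis prod.collapse)
  have "snd \<gamma> \<in> L" using \<gamma>(1) g by (metis L_def mem_Collect_eq)
  moreover have "F x = x + snd \<gamma>" for x unfolding \<gamma>(2) by (subst g) (rule isom_apply_one(2))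
  ultimately show ?thesis by (rule that)
qed

lemma lifts_pow:
  assumes F: "lifts F g" shows "lifts (F ^^ k) (g [^]\<^bsub>G\<^esub> (k::nat))"
proof (induction k)
  case 0
  show ?case unfolding funpow.simps(1) nat_pow_0 by (rule lifts_id)
next
  case (Suc k)
  show ?case unfolding funpow_Suc_right nat_pow_Suc by (rule lifts_compose[OF Suc F])
qed

lemma rho_pow: "lifts F g \<Longrightarrow> rho F = mat 1 \<Longrightarrow> rho (F ^^ k) = mat 1"
proof (induction k)
  case 0
  show ?case unfolding funpow.simps(1) by (rule rho_id)
next
  case (Suc k)
  show ?case
    unfolding funpow.simps(2) rho_compose[OF Suc.prems(1) lifts_pow[OF Suc.prems(1)]] Suc.IH[OF Suc.prems] Suc.prems(2)
    by simp
qed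

text \<open>If every element of \<open>G\<close> has a lift commuting with the translations, the central extension
  of \<open>G\<close> by \<open>L\<close> formed by these lifts is torsion-free. The sum \<open>S\<close> of the chosen lifts plays the role of the
  transfer: \<open>S \<circ> F - S\<close> is constant, additive in \<open>F\<close>, and vanishes only for \<open>F = id\<close>.\<close>
lemma commuting_lifts_imp_comm_group:
  assumes all: "\<And>g. g \<in> carrier G \<Longrightarrow> \<exists>F. lifts F g \<and> rho F = mat 1"
  shows "comm_group G"
proof -
  interpret G: group G by (rule group_G)
  obtain r where r: "\<And>g. g \<in> carrier G \<Longrightarrow> lifts (r g) g" "\<And>g. g \<in> carrier G \<Longrightarrow> rho (r g) = mat 1"
    using all by metis
  define S where "S x = (\<Sum>g\<in>carrier G. r g x)" for x
  have S_shift: "\<exists>v. \<forall>x. S (F x) = S x + v" if F: "lifts F h" "rho F = mat 1" for F h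
  proof -
    have h: "h \<in> carrier G" using F by (simp add: lifts_def)
    \<comment> \<open>Both \<open>r g \<circ> F\<close> and the chosen lift of the product lift the
      same element and commute with \<open>L\<close>, so they differ by a translation.\<close>
    have "\<exists>t. \<forall>x. r g (F x) = r (g \<otimes>\<^bsub>G\<^esub> h) x + t" if g: "g \<in> carrier G" for g
    proof -
      have gh: "g \<otimes>\<^bsub>G\<^esub> h \<in> carrier G" using g h by simp
      obtain H where H: "lifts H (inv\<^bsub>G\<^esub> (g \<otimes>\<^bsub>G\<^esub> h))" "r (g \<otimes>\<^bsub>G\<^esub> h) \<circ> H = id" "H \<circ> r (g \<otimes>\<^bsub>G\<^esub> h) = id"
        by (rule lifts_inverse[OF r(1)[OF gh]], rule that)
      have "mat 1 ** rho H = mat 1"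
        using rho_inverse(1)[OF r(1)[OF gh] H] r(2)[OF gh] by simp
      then have rH: "rho H = mat 1" by simp
      have l: "lifts ((r g \<circ> F) \<circ> H) \<one>\<^bsub>G\<^esub>"
        using lifts_compose[OF lifts_compose[OF r(1)[OF g] F(1)] H(1)] gh by simp
      have "rho ((r g \<circ> F) \<circ> H) = mat 1"
        using rho_compose[OF lifts_compose[OF r(1)[OF g] F(1)] H(1)] rho_compose[OF r(1)[OF g] F(1)] r(2)[OF g] F(2) rH by simp
      then obtain t where t: "\<And>x. ((r g \<circ> F) \<circ> H) x = x + t" using rho_one_lifts_one[OF l] by metis
      have "r g (F x) = r (g \<otimes>\<^bsub>G\<^esub> h) x + t" for x
        using t[of "r (g \<otimes>\<^bsub>G\<^esub> h) x"] fun_cong[OF H(3), of x] by simp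
      then show ?thesis by blast
    qed
    then obtain t where t: "\<And>g x. g \<in> carrier G \<Longrightarrow> r g (F x) = r (g \<otimes>\<^bsub>G\<^esub> h) x + t g" by metis
    have bij: "bij_betw (\<lambda>g. g \<otimes>\<^bsub>G\<^esub> h) (carrier G) (carrier G)"
      by (rule bij_betw_byWitness[where f' = "\<lambda>g. g \<otimes>\<^bsub>G\<^esub> inv\<^bsub>G\<^esub> h"]) (use h in \<open>auto simp: G.m_assoc\<close>)
    have "S (F x) = S x + (\<Sum>g\<in>carrier G. t g)" for x
    proof -
      have "S (F x) = (\<Sum>g\<in>carrier G. r (g \<otimes>\<^bsub>G\<^esub> h) x + t g)"
        unfolding S_def by (rule sum.cong) (simp_all add: t)
      also have "\<dots> = (\<Sum>g\<in>carrier G. r (g \<otimes>\<^bsub>G\<^esub> h) x) + (\<Sum>g\<in>carrier G. t g)"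
        by (rule sum.distrib)
      also have "(\<Sum>g\<in>carrier G. r (g \<otimes>\<^bsub>G\<^esub> h) x) = S x"
        unfolding S_def by (rule sum.reindex_bij_betw[OF bij])
      finally show ?thesis .
    qed
    then show ?thesis by blast
  qed
  \<comment> \<open>\<open>F ^^ N\<close> lifts the identity and is translation by some
    \<open>t\<close>. It preserves \<open>S\<close>, while this translation shifts \<open>S\<close>
    by \<open>N\<close> times \<open>t\<close>; so \<open>t = 0\<close> and \<open>F\<close> has
    finite order.\<close>
  have S_inj: "F = id" if F: "lifts F h" "rho F = mat 1" and S0: "\<And>x. S (F x) = S x" for F h
  proof -
    have h: "h \<in> carrier G" using F by (simp add: lifts_def)
    define N where "N = order G"
    have N0: "N > 0" using finite_G unfolding N_def by (simp add: G.order_gt_0_iff_finite)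
    have l: "lifts (F ^^ N) \<one>\<^bsub>G\<^esub>"
      using lifts_pow[OF F(1), of N] G.pow_order_eq_1[OF h] by (simp add: N_def)
    obtain t where t: "t \<in> L" "\<And>x. (F ^^ N) x = x + t"
      by (rule rho_one_lifts_one[OF l rho_pow[OF F]], rule that)
    have "S ((F ^^ n) x) = S x" for n x by (induction n) (simp_all add: S0)
    then have "S (0 + t) = S 0" using t(2) by metis
    moreover have "S (0 + t) = S 0 + real N *\<^sub>R t"
    proof -
      have "r g (0 + t) = r g 0 + t" if "g \<in> carrier G" for g
        using rho_eq_1_iff[OF r(1)[OF that]] r(2)[OF that] t(1) by blast
      then have "S (0 + t) = (\<Sum>g\<in>carrier G. r g 0 + t)" unfolding S_def by (intro sum.cong) simp_all
      also have "\<dots> = S 0 + (\<Sum>g\<in>carrier G. t)" unfolding S_def by (rule sum.distrib)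
      also have "(\<Sum>g\<in>carrier G. t) = real N *\<^sub>R t" by (simp only: sum_constant_scaleR N_def order_def)
      finally show ?thesis .
    qed
    ultimately have "t = 0" using N0 by simp
    then have "F ^^ N = id" using t(2) by (simp add: fun_eq_iff)
    then show ?thesis by (rule finite_order_imp_id[OF F N0])
  qed
  have comm: "g \<otimes>\<^bsub>G\<^esub> h = h \<otimes>\<^bsub>G\<^esub> g" if g: "g \<in> carrier G" and h: "h \<in> carrier G" for g h
  proof -
    have gh: "lifts (r g \<circ> r h) (g \<otimes>\<^bsub>G\<^esub> h)" and hg: "lifts (r h \<circ> r g) (h \<otimes>\<^bsub>G\<^esub> g)"
      using lifts_compose r(1) g h by blast+
    have rgh: "rho (r g \<circ> r h) = mat 1" and rhg: "rho (r h \<circ> r g) = mat 1"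
      using rho_compose[OF r(1) r(1)] r(2) g h by simp_all
    obtain K where K: "lifts K (inv\<^bsub>G\<^esub> (h \<otimes>\<^bsub>G\<^esub> g))" "(r h \<circ> r g) \<circ> K = id" "K \<circ> (r h \<circ> r g) = id"
      by (rule lifts_inverse[OF hg], rule that)
    have "mat 1 ** rho K = mat 1" using rho_inverse(1)[OF hg K] rhg by simp
    then have rK: "rho K = mat 1" by simp
    obtain v where v: "\<And>x. S (r g x) = S x + v" using S_shift[OF r(1)[OF g] r(2)[OF g]] by blast
    obtain w where w: "\<And>x. S (r h x) = S x + w" using S_shift[OF r(1)[OF h] r(2)[OF h]] by blast
    \<comment> \<open>\<open>S\<close> shifts by \<open>v + w\<close> in either order of
      composition, so the commutator of the two lifts preserves \<open>S\<close>.\<close>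
    have "(r g \<circ> r h) \<circ> K = id"
    proof (rule S_inj)
      show "lifts ((r g \<circ> r h) \<circ> K) ((g \<otimes>\<^bsub>G\<^esub> h) \<otimes>\<^bsub>G\<^esub> inv\<^bsub>G\<^esub> (h \<otimes>\<^bsub>G\<^esub> g))"
        by (rule lifts_compose[OF gh K(1)])
      show "rho ((r g \<circ> r h) \<circ> K) = mat 1" using rho_compose[OF gh K(1)] rgh rK by simp
      fix x
      have "S (((r g \<circ> r h) \<circ> K) x) = S (K x) + w + v" by (simp add: v w)
      also have "\<dots> = S (((r h \<circ> r g) \<circ> K) x)" by (simp add: v w)
      also have "\<dots> = S x" using K(2) by simp
      finally show "S (((r g \<circ> r h) \<circ> K) x) = S x" .
    qed
    then have "lifts id ((g \<otimes>\<^bsub>G\<^esub> h) \<otimes>\<^bsub>G\<^esub> inv\<^bsub>G\<^esub> (h \<otimes>\<^bsub>G\<^esub> g))"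
      using lifts_compose[OF gh K(1)] by simp
    then have "(g \<otimes>\<^bsub>G\<^esub> h) \<otimes>\<^bsub>G\<^esub> inv\<^bsub>G\<^esub> (h \<otimes>\<^bsub>G\<^esub> g) = \<one>\<^bsub>G\<^esub>"
      by (rule lifts_determines[OF _ lifts_id])
    then have "inv\<^bsub>G\<^esub> (inv\<^bsub>G\<^esub> (h \<otimes>\<^bsub>G\<^esub> g)) = g \<otimes>\<^bsub>G\<^esub> h"
      by (rule G.inv_equality) (use g h in simp_all)
    then show ?thesis using g h by simp
  qed
  show ?thesis by (rule G.group_comm_groupI) (rule comm)
qed

text \<open>\<open>N\<close> is normal because any element of \<open>G\<close> has a lift to
  conjugate with and \<open>rho\<close> is multiplicative; simplicity leaves two cases, and
  \<open>commuting_lifts_imp_comm_group\<close> excludes \<open>N = carrier G\<close>.\<close>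

lemma kernel_rho:
  assumes simple: "simple_group G" and nonab: "\<not> comm_group G"
    and F: "lifts F g" and 1: "rho F = mat 1"
  shows "g = \<one>\<^bsub>G\<^esub>"
proof -
  interpret G: group G by (rule group_G)
  define N where "N = {g. \<exists>F. lifts F g \<and> rho F = mat 1}"
  have "N \<lhd> G"
  proof (rule G.normal_invI)
    show "subgroup N G"
    proof
      show "N \<subseteq> carrier G" by (auto simp: N_def lifts_def)
      show "\<one>\<^bsub>G\<^esub> \<in> N" using lifts_id rho_id by (auto simp: N_def)
      fix x y assume "x \<in> N" "y \<in> N"
      then obtain F H where "lifts F x" "rho F = mat 1" "lifts H y" "rho H = mat 1" by (auto simp: N_def)
      then show "x \<otimes>\<^bsub>G\<^esub> y \<in> N" unfolding N_def using lifts_compose[of F x H y] rho_compose[of F x H y] by auto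
    next
      fix x assume "x \<in> N"
      then obtain F where F: "lifts F x" "rho F = mat 1" by (auto simp: N_def)
      obtain H where H: "lifts H (inv\<^bsub>G\<^esub> x)" "F \<circ> H = id" "H \<circ> F = id" by (rule lifts_inverse[OF F(1)], rule that)
      have "rho H = mat 1" using rho_inverse(1)[OF F(1) H] F(2) by simp
      then show "inv\<^bsub>G\<^esub> x \<in> N" using H(1) by (auto simp: N_def)
    qed
    fix x h assume x: "x \<in> carrier G" and "h \<in> N"
    then obtain F where F: "lifts F h" "rho F = mat 1" by (auto simp: N_def)
    obtain K where K: "lifts K x" using lift_ex[OF x] by blast
    obtain H where H: "lifts H (inv\<^bsub>G\<^esub> x)" "K \<circ> H = id" "H \<circ> K = id" by (rule lifts_inverse[OF K], rule that)
    have "rho ((K \<circ> F) \<circ> H) = rho K ** rho F ** rho H"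
      using rho_compose[OF lifts_compose[OF K F(1)] H(1)] rho_compose[OF K F(1)] by simp
    also have "\<dots> = mat 1" using F(2) rho_inverse(1)[OF K H] by simp
    finally show "x \<otimes>\<^bsub>G\<^esub> h \<otimes>\<^bsub>G\<^esub> inv\<^bsub>G\<^esub> x \<in> N"
      unfolding N_def using lifts_compose[OF lifts_compose[OF K F(1)] H(1)] by blast
  qed
  then have "N = carrier G \<or> N = {\<one>\<^bsub>G\<^esub>}" by (rule simple_group.no_real_normal_subgroup[OF simple])
  moreover have "N \<noteq> carrier G"
  proof
    assume eq: "N = carrier G"
    have "comm_group G"
    proof (rule commuting_lifts_imp_comm_group)
      fix g assume "g \<in> carrier G"
      then show "\<exists>F. lifts F g \<and> rho F = mat 1" unfolding eq[symmetric] N_def by simp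
    qed
    then show False using nonab by simp
  qed
  moreover have "g \<in> N" using F 1 by (auto simp: N_def)
  ultimately show ?thesis by blast
qed

section \<open>The two linear groups and their quotient\<close>

definition lift_group :: "(real^'n \<Rightarrow> real^'n) set" where
  "lift_group = {F. \<exists>g. lifts F g}"

lemma rho_image_subgroup: "subgroup (rho ` lift_group) GLZ"
  and rho_act_subgroup: "subgroup (rho ` isom_apply ` \<pi>) GLZ"
proof -
  interpret G: group G by (rule group_G)
  have sub: "subgroup (rho ` A) GLZ"
    if A: "A \<subseteq> lift_group" "id \<in> A" and comp: "\<And>F H. F \<in> A \<Longrightarrow> H \<in> A \<Longrightarrow> F \<circ> H \<in> A"
      and inv: "\<And>F. F \<in> A \<Longrightarrow> \<exists>H\<in>A. F \<circ> H = id \<and> H \<circ> F = id" for A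
  proof
    have i: "\<exists>H\<in>A. rho F ** rho H = mat 1 \<and> rho H ** rho F = mat 1" if FA: "F \<in> A" for F
    proof -
      obtain H where H: "H \<in> A" "F \<circ> H = id" "H \<circ> F = id" using inv[OF FA] by blast
      obtain g h where "lifts F g" "lifts H h" using A FA H(1) unfolding lift_group_def by blast
      then show ?thesis using rho_inverse[OF _ _ H(2,3)] H(1) by blast
    qed
    show "rho ` A \<subseteq> carrier GLZ" using i by (fastforce simp: GLZ_def)
    show "\<one>\<^bsub>GLZ\<^esub> \<in> rho ` A" using A(2) rho_id by (metis GLZ_simps(2) imageI)
    fix x y assume "x \<in> rho ` A" "y \<in> rho ` A"
    then obtain F H where F: "F \<in> A" "x = rho F" and H: "H \<in> A" "y = rho H" by blast
    obtain g h where "lifts F g" "lifts H h" using A F(1) H(1) unfolding lift_group_def by blast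
    then have "x \<otimes>\<^bsub>GLZ\<^esub> y = rho (F \<circ> H)" by (simp add: GLZ_simps rho_compose F(2) H(2))
    then show "x \<otimes>\<^bsub>GLZ\<^esub> y \<in> rho ` A" using comp[OF F(1) H(1)] by blast
  next
    fix x assume "x \<in> rho ` A"
    then obtain F where F: "F \<in> A" "x = rho F" by blast
    obtain H where H: "H \<in> A" "F \<circ> H = id" "H \<circ> F = id" using inv[OF F(1)] by blast
    obtain g h where "lifts F g" "lifts H h" using A F(1) H(1) unfolding lift_group_def by blast
    then have "inv\<^bsub>GLZ\<^esub> x = rho H" unfolding F(2) by (intro inv_GLZ rho_inverse[OF _ _ H(2,3)])
    then show "inv\<^bsub>GLZ\<^esub> x \<in> rho ` A" using H(1) by blast
  qed
  show "subgroup (rho ` lift_group) GLZ"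
  proof (rule sub)
    show "id \<in> lift_group" using lifts_id by (auto simp: lift_group_def)
    show "F \<circ> H \<in> lift_group" if "F \<in> lift_group" "H \<in> lift_group" for F H
      using that lifts_compose unfolding lift_group_def by blast
    show "\<exists>H\<in>lift_group. F \<circ> H = id \<and> H \<circ> F = id" if FA: "F \<in> lift_group" for F
    proof -
      obtain g where F: "lifts F g" using FA by (auto simp: lift_group_def)
      obtain H where "lifts H (inv\<^bsub>G\<^esub> g)" "F \<circ> H = id" "H \<circ> F = id" by (rule lifts_inverse[OF F], rule that)
      then show ?thesis unfolding lift_group_def by blast
    qed
  qed simp
  show "subgroup (rho ` isom_apply ` \<pi>) GLZ"
  proof (rule sub)
    show "isom_apply ` \<pi> \<subseteq> lift_group" using lifts_act by (auto simp: lift_group_def)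
    show "id \<in> isom_apply ` \<pi>" using lifts_id lifts_one_iff by blast
    show "F \<circ> H \<in> isom_apply ` \<pi>" if "F \<in> isom_apply ` \<pi>" "H \<in> isom_apply ` \<pi>" for F H
      using that lifts_compose[of F "\<one>\<^bsub>G\<^esub>" H "\<one>\<^bsub>G\<^esub>"] unfolding lifts_one_iff[symmetric] by simp
    show "\<exists>H\<in>isom_apply ` \<pi>. F \<circ> H = id \<and> H \<circ> F = id" if "F \<in> isom_apply ` \<pi>" for F
    proof -
      have F: "lifts F \<one>\<^bsub>G\<^esub>" using that by (simp only: lifts_one_iff)
      obtain H where H: "lifts H (inv\<^bsub>G\<^esub> \<one>\<^bsub>G\<^esub>)" "F \<circ> H = id" "H \<circ> F = id" by (rule lifts_inverse[OF F], rule that)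
      have "lifts H \<one>\<^bsub>G\<^esub>" using H(1) by simp
      then have "H \<in> isom_apply ` \<pi>" by (simp only: lifts_one_iff)
      then show ?thesis using H(2,3) by blast
    qed
  qed
qed

text \<open>On \<pi> the matrix depends only on the linear part, which takes finitely many values;
  every other lift is an element of \<pi> composed with one of finitely many chosen lifts.\<close>

lemma finite_rho_image: "finite (rho ` lift_group)"
proof -
  interpret G: group G by (rule group_G)
  have "rho ` isom_apply ` \<pi> = (\<lambda>A. rho (isom_apply (SOME g. g \<in> \<pi> \<and> fst g = A))) ` fst ` \<pi>"
    unfolding image_image
  proof (rule image_cong[OF refl])
    fix g assume g: "g \<in> \<pi>"
    define h where "h = (SOME h. h \<in> \<pi> \<and> fst h = fst g)"
    have h: "h \<in> \<pi> \<and> fst h = fst g" unfolding h_def by (rule someI[of _ g]) (simp add: g)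
    have "rho (isom_apply g) = rho (isom_apply h)"
    proof (rule rho_eqI[OF lifts_act[OF g]])
      fix z
      have "isom_apply g (W *v of_int_vec z) - isom_apply g 0 = isom_apply h (W *v of_int_vec z) - isom_apply h 0"
        using h by (simp add: isom_apply_def)
      then show "isom_apply g (W *v of_int_vec z) - isom_apply g 0 = W *v of_int_vec (rho (isom_apply h) *v z)"
        using rho[OF lifts_act, of h z] h by simp
    qed
    then show "rho (isom_apply g) = rho (isom_apply (SOME h. h \<in> \<pi> \<and> fst h = fst g))" by (simp only: h_def)
  qed
  then have fin: "finite (rho ` isom_apply ` \<pi>)" using finite_linear_parts by simp
  obtain r where r: "\<And>g. g \<in> carrier G \<Longrightarrow> lifts (r g) g" using lift_ex by metis
  have "rho ` lift_group \<subseteq> (\<lambda>(M, g). M ** rho (r g)) ` (rho ` isom_apply ` \<pi> \<times> carrier G)"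
  proof
    fix M assume "M \<in> rho ` lift_group"
    then obtain F g where F: "lifts F g" "M = rho F" by (auto simp: lift_group_def)
    have g: "g \<in> carrier G" using F by (simp add: lifts_def)
    obtain \<gamma> where \<gamma>: "\<gamma> \<in> \<pi>" "F = isom_apply \<gamma> \<circ> r g" by (rule lifts_same[OF F(1) r[OF g]], rule that)
    have "M = rho (isom_apply \<gamma>) ** rho (r g)"
      using rho_compose[OF lifts_act[OF \<gamma>(1)] r[OF g]] F(2) \<gamma>(2) by simp
    then show "M \<in> (\<lambda>(M, g). M ** rho (r g)) ` (rho ` isom_apply ` \<pi> \<times> carrier G)"
      using \<gamma>(1) g by (intro image_eqI[of _ _ "(rho (isom_apply \<gamma>), g)"]) auto
  qed
  then show ?thesis using fin finite_G by (rule finite_subset[OF _ finite_imageI[OF finite_cartesian_product]])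
qed

text \<open>The first isomorphism theorem: by \<open>rho_act_1_iff\<close> the kernel on \<pi> is
  the translation subgroup.\<close>

lemma holonomy_iso: "(GLZ\<lparr>carrier := rho ` isom_apply ` \<pi>\<rparr>) \<cong> holonomy \<pi>"
proof -
  let ?P = "Isom\<lparr>carrier := \<pi>\<rparr>" and ?R = "GLZ\<lparr>carrier := rho ` isom_apply ` \<pi>\<rparr>"
  have gP: "group ?P" by (rule subgroup.subgroup_is_group[OF subgroup_pi group_Isom])
  have gR: "group ?R" by (rule subgroup.subgroup_is_group[OF rho_act_subgroup group_GLZ])
  have "(rho \<circ> isom_apply) \<in> hom ?P ?R"
  proof (rule homI)
    fix g h assume "g \<in> carrier ?P" "h \<in> carrier ?P"
    then have g: "g \<in> \<pi>" and h: "h \<in> \<pi>" by simp_all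
    have "isom_apply (g \<otimes>\<^bsub>Isom\<^esub> h) = isom_apply g \<circ> isom_apply h" by (rule ext) (simp only: isom_apply_mult comp_apply)
    then show "(rho \<circ> isom_apply) (g \<otimes>\<^bsub>?P\<^esub> h) = (rho \<circ> isom_apply) g \<otimes>\<^bsub>?R\<^esub> (rho \<circ> isom_apply) h"
      using rho_compose[OF lifts_act[OF g] lifts_act[OF h]] by (simp add: GLZ_simps)
  qed auto
  then interpret h: group_hom ?P ?R "rho \<circ> isom_apply"
    using gP gR by (simp add: group_hom_def group_hom_axioms_def)
  have "kernel ?P ?R (rho \<circ> isom_apply) = transl_subgroup \<pi>"
    unfolding kernel_def transl_subgroup_def using rho_act_1_iff by (auto simp: GLZ_simps)
  then have "holonomy \<pi> \<cong> ?R"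
    using h.FactGroup_iso by (simp add: holonomy_def image_comp)
  then show ?thesis
    unfolding holonomy_def[symmetric]
    by (rule group.iso_sym[rotated])
      (metis h.normal_kernel holonomy_def normal.factorgroup_is_group \<open>kernel ?P ?R (rho \<circ> isom_apply) = transl_subgroup \<pi>\<close>)
qed

text \<open>By \<open>kernel_rho\<close>, lifts with equal matrices cover the same element of
  \<open>G\<close>. Hence the homomorphism can be taken from the matrices onto \<open>G\<close>;
  this is \<open>\<theta>\<close>, and its kernel is the image of \<pi>, the lifts of the
  identity.\<close>

theorem simple_group_as_linear_quotient:
  assumes simple: "simple_group G" and nonab: "\<not> comm_group G"
  shows "rho ` isom_apply ` \<pi> \<lhd> (GLZ\<lparr>carrier := rho ` lift_group\<rparr>)"
    and "G \<cong> (GLZ\<lparr>carrier := rho ` lift_group\<rparr>) Mod (rho ` isom_apply ` \<pi>)"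
proof -
  interpret G: group G by (rule group_G)
  let ?R = "GLZ\<lparr>carrier := rho ` lift_group\<rparr>"
  have gR: "group ?R" by (rule subgroup.subgroup_is_group[OF rho_image_subgroup group_GLZ])
  have same: "g = h" if F: "lifts F g" and H: "lifts H h" and eq: "rho F = rho H" for F H g h
  proof -
    have g: "g \<in> carrier G" and h: "h \<in> carrier G" using F H by (simp_all add: lifts_def)
    obtain K where K: "lifts K (inv\<^bsub>G\<^esub> h)" "H \<circ> K = id" "K \<circ> H = id" by (rule lifts_inverse[OF H], rule that)
    have "rho (F \<circ> K) = mat 1" using rho_compose[OF F K(1)] rho_inverse(1)[OF H K] eq by simp
    then have "g \<otimes>\<^bsub>G\<^esub> inv\<^bsub>G\<^esub> h = \<one>\<^bsub>G\<^esub>" by (rule kernel_rho[OF simple nonab lifts_compose[OF F K(1)]])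
    then have "inv\<^bsub>G\<^esub> (inv\<^bsub>G\<^esub> h) = g" by (rule G.inv_equality) (use g h in simp_all)
    then show ?thesis using h by simp
  qed
  define \<theta> where "\<theta> M = (SOME g. \<exists>F. lifts F g \<and> rho F = M)" for M
  have \<theta>: "\<theta> (rho F) = g" if F: "lifts F g" for F g
  proof -
    have "\<exists>H. lifts H (\<theta> (rho F)) \<and> rho H = rho F"
      unfolding \<theta>_def by (rule someI[of _ g]) (use F in blast)
    then obtain H where "lifts H (\<theta> (rho F))" "rho H = rho F" by blast
    then show ?thesis by (rule same[OF _ F])
  qed
  have "\<theta> \<in> hom ?R G"
  proof (rule homI)
    fix M assume "M \<in> carrier ?R"
    then obtain F g where "lifts F g" "M = rho F" by (auto simp: lift_group_def)
    then show "\<theta> M \<in> carrier G" using \<theta> by (auto simp: lifts_def)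
  next
    fix M N assume "M \<in> carrier ?R" "N \<in> carrier ?R"
    then obtain F g H h where F: "lifts F g" "M = rho F" and H: "lifts H h" "N = rho H" by (auto simp: lift_group_def)
    show "\<theta> (M \<otimes>\<^bsub>?R\<^esub> N) = \<theta> M \<otimes>\<^bsub>G\<^esub> \<theta> N"
      using \<theta>[OF lifts_compose[OF F(1) H(1)]] \<theta>[OF F(1)] \<theta>[OF H(1)] rho_compose[OF F(1) H(1)]
      by (simp add: F(2) H(2) GLZ_simps)
  qed
  then interpret t: group_hom ?R G \<theta>
    using gR group_G by (simp add: group_hom_def group_hom_axioms_def)
  have ker: "kernel ?R G \<theta> = rho ` isom_apply ` \<pi>"
  proof (rule Set.set_eqI, rule iffI)
    fix M assume "M \<in> kernel ?R G \<theta>"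
    then obtain F g where F: "lifts F g" "M = rho F" "\<theta> M = \<one>\<^bsub>G\<^esub>" by (auto simp: kernel_def lift_group_def)
    then have "lifts F \<one>\<^bsub>G\<^esub>" using \<theta>[OF F(1)] by simp
    then show "M \<in> rho ` isom_apply ` \<pi>" unfolding lifts_one_iff F(2) by (rule imageI)
  next
    fix M assume "M \<in> rho ` isom_apply ` \<pi>"
    then obtain \<gamma> where \<gamma>: "\<gamma> \<in> \<pi>" "M = rho (isom_apply \<gamma>)" by blast
    have "isom_apply \<gamma> \<in> lift_group" using lifts_act[OF \<gamma>(1)] by (auto simp: lift_group_def)
    then show "M \<in> kernel ?R G \<theta>" using \<theta>[OF lifts_act[OF \<gamma>(1)]] by (simp add: kernel_def \<gamma>(2))
  qed
  have surj: "\<theta> ` carrier ?R = carrier G"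
  proof
    show "carrier G \<subseteq> \<theta> ` carrier ?R"
    proof
      fix g assume "g \<in> carrier G"
      then obtain F where F: "lifts F g" using lift_ex by blast
      then have "rho F \<in> carrier ?R" by (auto simp: lift_group_def)
      then show "g \<in> \<theta> ` carrier ?R" using \<theta>[OF F] by (metis imageI)
    qed
  qed auto
  show nrm: "rho ` isom_apply ` \<pi> \<lhd> ?R" using t.normal_kernel by (simp only: ker)
  have "?R Mod (rho ` isom_apply ` \<pi>) \<cong> G" using t.FactGroup_iso[OF surj] by (simp only: ker)
  then show "G \<cong> ?R Mod (rho ` isom_apply ` \<pi>)"
    by (rule group.iso_sym[OF normal.factorgroup_is_group[OF nrm]])
qed

end

theorem theorem4p1:
  fixes G :: "('g, 'b) monoid_scheme"
    and \<pi> :: "((real^'n^'n) \<times> (real^'n)) set"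
    and X :: "'m topology" and q :: "real^'n \<Rightarrow> 'm"
    and \<phi> :: "'g \<Rightarrow> 'm \<Rightarrow> 'm"
  assumes "simple_group G" and "finite (carrier G)" and "\<not> comm_group G"
    and "is_flat_manifold_quotient \<pi> X q"
    and "effective_homeo_action G X \<phi>"
  shows "\<exists>(\<Phi>s :: (int^'n^'n) set) \<Phi>'.
           subgroup \<Phi>s GLZ \<and> finite \<Phi>s
         \<and> \<Phi>' \<lhd> (GLZ\<lparr>carrier := \<Phi>s\<rparr>)
         \<and> (GLZ\<lparr>carrier := \<Phi>'\<rparr>) \<cong> holonomy \<pi>
         \<and> G \<cong> (GLZ\<lparr>carrier := \<Phi>s\<rparr>) Mod \<Phi>'"
proof -
  interpret simple_group G by (rule assms(1))
  interpret flat_action \<pi> X q G \<phi>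
    using assms(2,4,5) is_group
    by unfold_locales (simp_all add: is_flat_manifold_quotient_def)
  show ?thesis
    using rho_image_subgroup finite_rho_image simple_group_as_linear_quotient[OF assms(1,3)] holonomy_iso by blast
qed

end
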